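(* For every $\varepsilon>0$ there exist $C>0$ and $p_0$, depending only on $\varepsilon$, such that for every prime $p\ge p_0$ and every integer $N$ with $p^{1/(8\sqrt{\mathrm e})+\varepsilon}\le N<p$, one has $$\sharp\left(\mathbf M(N,p)\cap\mathcal M_2^{\neq\square}(p)\right)\ge C N^4 .$$
   Context: $\mathrm e$ is the base of natural logarithms, and $\sharp S$ denotes the cardinality of a finite set $S$. $\mathcal M_2^*(p)=\mathrm{GL}(2,\mathbb F_p)$ is the set of invertible $2\times 2$ matrices over the field $\mathbb F_p$ of $p$ elements, and $$\mathcal M_2^{\neq\square}(p)=\{A\in\mathcal M_2^*(p): A\neq B^2\text{ for all }B\in\mathcal M_2^*(p)\}.$$ For an integer $N\ge 2$, $\mathbf M(N,p)$ is the set of $2\times 2$ matrices over $\mathbb F_p$ of the form $\begin{pmatrix} a \bmod p & b\bmod p\\ c\bmod p& d\bmod p\end{pmatrix}$ with integers $0\le a,b,c,d\le N$. *)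

theory Defs
  imports
    "HOL-Number_Theory.Residues"
    "HOL-Analysis.Finite_Cartesian_Product"
begin

text \<open>
  Since the prime \<open>p\<close> is quantified inside the statement, the field \<open>\<bbbF>\<^sub>p\<close> is the ring
  \<^const>\<open>residue_ring\<close> with carrier \<open>{0..p - 1}\<close>, not a type. As usual, \<open>A $ i $ j\<close> is the entry
  in row \<open>i\<close> and column \<open>j\<close>; the index type \<open>2\<close> has the two elements \<open>1\<close> and \<open>2\<close>.
\<close>

definition mat2_monoid :: "('a, 'm) ring_scheme \<Rightarrow> ('a ^ 2 ^ 2) monoid" where
  "mat2_monoid R =
    \<lparr>carrier = {A. \<forall>i j. A $ i $ j \<in> carrier R},
     monoid.mult = (\<lambda>A B. \<chi> i j. A $ i $ 1 \<otimes>\<^bsub>R\<^esub> B $ 1 $ j \<oplus>\<^bsub>R\<^esub> A $ i $ 2 \<otimes>\<^bsub>R\<^esub> B $ 2 $ j),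
     one = (\<chi> i j. if i = j then \<one>\<^bsub>R\<^esub> else \<zero>\<^bsub>R\<^esub>)\<rparr>"

abbreviation mat2_mod :: "nat \<Rightarrow> (int ^ 2 ^ 2) monoid" where
  "mat2_mod p \<equiv> mat2_monoid (residue_ring (int p))"

definition GL2 :: "nat \<Rightarrow> (int ^ 2 ^ 2) set" where
  "GL2 p = Units (mat2_mod p)"

definition nonsquare_GL2 :: "nat \<Rightarrow> (int ^ 2 ^ 2) set" where
  "nonsquare_GL2 p = {A \<in> GL2 p. \<forall>B \<in> GL2 p. A \<noteq> B [^]\<^bsub>mat2_mod p\<^esub> (2::nat)}"

definition box_mat2 :: "nat \<Rightarrow> nat \<Rightarrow> (int ^ 2 ^ 2) set" where
  "box_mat2 N p =
    {(\<chi> i j. (A $ i $ j) mod int p) | A :: int ^ 2 ^ 2. \<forall>i j. 0 \<le> A $ i $ j \<and> A $ i $ j \<le> int N}"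

end

theory Submission
  imports Defs
    "HOL-Number_Theory.Number_Theory"
    "HOL-Computational_Algebra.Computational_Algebra"
    "HOL-Analysis.Harmonic_Numbers"
    "HOL-Real_Asymp.Real_Asymp"
    "Berlekamp_Zassenhaus.Finite_Field"
begin

text \<open>
  The determinant is multiplicative, so a matrix whose determinant is a quadratic nonresidue is not
  a square. It is therefore enough to find many matrices in the box whose determinant, computed in
  \<open>\<int>\<close>, is a nonresidue. Put \<open>M = N div 2\<close>. If \<open>M < a \<le> 2 * M\<close> and \<open>1 \<le> b \<le> M\<close> are coprime, then
  every \<open>1 \<le> n \<le> M\<^sup>2\<close> is of the form \<open>a * d - b * c\<close> with \<open>c\<close> and \<open>d\<close> in the box
  (\<open>determinant_completion\<close>), and a positive proportion of the pairs \<open>(a, b)\<close> is coprime. As \<open>M\<^sup>2\<close>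
  exceeds \<open>p powr (1 / (4 * sqrt (exp 1)) + \<epsilon>)\<close>, the claim follows from
  \<open>positive_proportion_of_nonresidues\<close>: the nonresidues have positive density in \<open>{1..X}\<close> for every
  \<open>X\<close> of at least this size.

  Let \<open>H\<close> be slightly larger than \<open>p powr (1 / 4)\<close>. Burgess' estimate \<open>burgess_character_sum\<close> makes
  almost half of \<open>{1..H}\<close> nonresidues, and each of them has a prime factor that is a nonresidue. By
  Mertens' theorem the primes between \<open>H powr \<theta>\<close> and \<open>H\<close> divide at most about \<open>ln (1 / \<theta>) * H\<close> of
  these integers, which is less than \<open>H / 2\<close> exactly if \<open>\<theta> > 1 / sqrt (exp 1)\<close>. Hence the sum of
  \<open>1 / q\<close> over the nonresidue primes \<open>q \<le> H powr \<theta>\<close> stays away from \<open>0\<close>. This is Vinogradov's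
  argument, and it produces one small nonresidue.

  For a positive density one multiplies these primes \<open>q\<close> with residues \<open>m \<le> X / q\<close>. The products
  are nonresidues, and a second moment shows that few of them coincide too often
  (\<open>minus_values_lower_bound\<close>). What is needed is that the residues have positive density below
  \<open>Y = X / q\<close>. Suppose that almost all integers up to \<open>Y\<close> are nonresidues, while almost all integers up
  to \<open>X\<close> are residues (otherwise nothing is left to show). Label the six edges of the complete graph
  on four vertices by integers \<open>a, b, c, d, e, g\<close> and each vertex by the product of its three edges.
  The product of the four vertices is a square. The sizes of the labels can be chosen such that one
  vertex is a typical integer up to \<open>Y\<close> and the other three are typical integers up to \<open>X\<close>; then
  the product of the four characters is \<open>-1\<close>, which is absurd. This is \<open>plus_values_at_lower_scale\<close>;
  it uses of the character only that it is completely multiplicative with values \<open>1\<close> and \<open>-1\<close>.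

  Burgess' estimate rests on Weil's bound for the sum of the quadratic character over the values of a
  product of linear polynomials. It is proved here with Stepanov's method: a polynomial that vanishes
  to high order wherever the character is \<open>1\<close> must have large degree (\<open>stepanov_bound\<close>).
\<close>

section \<open>Stepanov's bound for products of linear polynomials\<close>

text \<open>
  If two assignments supported on \<open>I\<close> have the same image then their difference is a solution, and
  there are more assignments than images.
\<close>
lemma homogeneous_system_nonzero_solution:
  fixes L :: "('i \<Rightarrow> 'a::{finite, ab_group_add, zero_neq_one}) \<Rightarrow> 'e \<Rightarrow> 'a"
  assumes diff: "\<And>c d e. L (\<lambda>i. c i - d i) e = L c e - L d e"
    and fin: "finite I" "finite E" and more: "card E < card I"
  shows "\<exists>c. (\<exists>i\<in>I. c i \<noteq> 0) \<and> (\<forall>i. i \<notin> I \<longrightarrow> c i = 0) \<and> (\<forall>e\<in>E. L c e = 0)"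
proof -
  define ext :: "('i \<Rightarrow> 'a) \<Rightarrow> 'i \<Rightarrow> 'a" where "ext = (\<lambda>g i. if i \<in> I then g i else 0)"
  define A where "A = ext ` (PiE I (\<lambda>_. UNIV))"
  define F where "F = (\<lambda>c. restrict (L c) E)"
  have two: "CARD('a) > 1"
    using card_mono[of UNIV "{0, 1 :: 'a}"] by simp
  have cardA: "card A = CARD('a) ^ card I"
  proof -
    have "inj_on ext (PiE I (\<lambda>_. UNIV))"
    proof (rule inj_onI)
      fix g h assume gh: "g \<in> PiE I (\<lambda>_. UNIV)" "h \<in> PiE I (\<lambda>_. UNIV)" "ext g = ext h"
      show "g = h"
      proof (rule PiE_ext[OF gh(1,2)])
        fix i assume "i \<in> I" thus "g i = h i" using fun_cong[OF gh(3), of i] by (simp add: ext_def)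
      qed
    qed
    thus ?thesis unfolding A_def using fin by (simp add: card_image card_PiE)
  qed
  have "F ` A \<subseteq> PiE E (\<lambda>_. UNIV)" unfolding F_def by auto
  hence "card (F ` A) \<le> card (PiE E (\<lambda>_. UNIV :: 'a set))"
    by (intro card_mono) (auto intro!: finite_PiE fin)
  also have "\<dots> = CARD('a) ^ card E" using fin by (simp add: card_PiE)
  also have "\<dots> < CARD('a) ^ card I" using two more by (intro power_strict_increasing) auto
  finally have "card (F ` A) < card A" using cardA by simp
  hence "\<not> inj_on F A" by (rule pigeonhole)
  then obtain c d where cd: "c \<in> A" "d \<in> A" "F c = F d" "c \<noteq> d" by (auto simp: inj_on_def)
  from cd(4) obtain i where i: "c i \<noteq> d i" by auto
  have out: "c j = 0" "d j = 0" if "j \<notin> I" for j using cd(1,2) that by (auto simp: A_def ext_def)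
  show ?thesis
  proof (intro exI[of _ "\<lambda>i. c i - d i"] conjI)
    show "\<exists>i\<in>I. c i - d i \<noteq> 0" using i out by (metis right_minus_eq)
    show "\<forall>i. i \<notin> I \<longrightarrow> c i - d i = 0" using out by auto
    show "\<forall>e\<in>E. L (\<lambda>i. c i - d i) e = 0"
    proof
      fix e assume "e \<in> E"
      with fun_cong[OF cd(3), of e] have "L c e = L d e" by (simp add: F_def)
      thus "L (\<lambda>i. c i - d i) e = 0" by (simp add: diff)
    qed
  qed
qed

lemma higher_pderiv_at_root:
  fixes a :: "'a::field" and Q :: "'a poly"
  shows "poly ((pderiv ^^ m) ([:-a, 1:] ^ m * Q)) a = of_nat (fact m) * poly Q a"
proof (induction m arbitrary: Q)
  case (Suc m)
  have "pderiv ([:-a, 1:] ^ Suc m * Q) = [:-a, 1:] ^ m * (smult (of_nat (Suc m)) Q + [:-a, 1:] * pderiv Q)"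
    by (simp add: pderiv_mult pderiv_power_Suc pderiv_pCons algebra_simps smult_add_left del: power_Suc of_nat_Suc)
       (simp add: algebra_simps)
  hence "(pderiv ^^ Suc m) ([:-a, 1:] ^ Suc m * Q) = (pderiv ^^ m) ([:-a, 1:] ^ m * (smult (of_nat (Suc m)) Q + [:-a, 1:] * pderiv Q))"
    by (simp only: funpow_Suc_right o_apply)
  thus ?case by (simp only: Suc.IH) (simp add: algebra_simps)
qed auto

lemma fact_nonzero_CHAR:
  assumes "prime CHAR('a::field)" "m < CHAR('a)"
  shows "of_nat (fact m) \<noteq> (0 :: 'a)"
proof -
  have "\<not> CHAR('a) dvd fact m" using assms prime_dvd_fact_iff by (metis not_le)
  thus ?thesis by (simp add: of_nat_eq_0_iff_char_dvd)
qed

text \<open>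
  If the order of the root were \<open>m < l\<close>, the \<open>m\<close>-th derivative would have the value \<open>fact m * Q(a)\<close>
  with \<open>Q(a) \<noteq> 0\<close>; the factorial is invertible because \<open>m\<close> is less than the characteristic.
\<close>
lemma power_dvd_if_higher_pderivs_vanish:
  fixes R :: "'a::field poly"
  assumes "prime CHAR('a)" and l: "l \<le> CHAR('a)" and R: "R \<noteq> 0"
    and van: "\<And>k. k < l \<Longrightarrow> poly ((pderiv ^^ k) R) a = 0"
  shows "l \<le> order a R"
proof (rule ccontr)
  assume "\<not> l \<le> order a R"
  hence less: "order a R < l" by simp
  obtain Q where Q: "R = [:-a, 1:] ^ order a R * Q" "\<not> [:-a, 1:] dvd Q" using order_decomp[OF R] by blast
  have "poly ((pderiv ^^ order a R) R) a = of_nat (fact (order a R)) * poly Q a"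
    using higher_pderiv_at_root[where m = "order a R" and a = a and Q = Q] Q(1) by simp
  moreover have "of_nat (fact (order a R)) \<noteq> (0 :: 'a)" using assms less by (intro fact_nonzero_CHAR) auto
  ultimately have "poly Q a = 0" using van[OF less] by simp
  thus False using Q(2) by (simp add: poly_eq_0_iff_dvd)
qed

lemma card_mult_le_degree:
  fixes R :: "'a::{field,finite} poly"
  assumes R: "R \<noteq> 0" and S: "\<And>x. x \<in> S \<Longrightarrow> l \<le> order x R"
  shows "l * card S \<le> degree R"
proof -
  have "finite S" by simp
  thus ?thesis using R S
  proof (induction S arbitrary: R rule: finite_induct)
    case (insert x S)
    have "[:-x, 1:] ^ l dvd R" using insert.prems(2)[of x] by (simp add: order_divides)
    then obtain Q where Q: "R = [:-x, 1:] ^ l * Q" by (elim dvdE)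
    have Q0: "Q \<noteq> 0" using Q insert.prems(1) by auto
    have "l \<le> order y Q" if y: "y \<in> S" for y
    proof -
      have "order y ([:-x, 1:] ^ l) = 0"
        using y insert.hyps by (intro order_0I) auto
      hence "order y R = order y Q" using Q insert.prems(1) by (simp add: order_mult)
      thus ?thesis using insert.prems(2)[of y] y by simp
    qed
    hence "l * card S \<le> degree Q" using insert.IH[OF Q0] by blast
    moreover have "degree R = l + degree Q" using Q Q0 by (simp add: degree_mult_eq degree_power_eq)
    ultimately show ?case using insert.hyps by simp
  qed auto
qed

text \<open>
  The derivatives of \<open>f ^ N * r\<close> keep the factor \<open>f ^ (N - k)\<close>, and this is the cofactor. Powers of
  \<open>x ^ p\<close> are constants for the derivation and pass through it.
\<close>
fun higher_numerator :: "'a::idom poly \<Rightarrow> nat \<Rightarrow> nat \<Rightarrow> 'a poly \<Rightarrow> 'a poly" where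
  "higher_numerator f N 0 r = r"
| "higher_numerator f N (Suc k) r =
     smult (of_nat (N - k)) (pderiv f * higher_numerator f N k r) + f * pderiv (higher_numerator f N k r)"

lemma pderiv_monom_CHAR_mult:
  "pderiv (monom (1::'a::idom) (j * CHAR('a))) = 0"
proof -
  have "(of_nat (j * CHAR('a)) :: 'a) = 0" by simp
  thus ?thesis by (simp only: pderiv_monom) simp
qed

lemma higher_pderiv_power_times:
  fixes f :: "'a::idom poly"
  assumes "k \<le> N"
  shows "(pderiv ^^ k) (f ^ N * r * monom 1 (j * CHAR('a))) =
    f ^ (N - k) * higher_numerator f N k r * monom 1 (j * CHAR('a))"
  using assms
proof (induction k)
  case (Suc k)
  obtain n where n: "N - k = Suc n" "N - Suc k = n" using Suc.prems by (metis Suc_diff_Suc Suc_le_lessD)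
  have IH: "(pderiv ^^ k) (f ^ N * r * monom 1 (j * CHAR('a))) =
    f ^ Suc n * higher_numerator f N k r * monom 1 (j * CHAR('a))" using Suc n by simp
  show ?case
    unfolding funpow.simps o_apply IH higher_numerator.simps n
    by (subst pderiv_mult, subst pderiv_mult, subst pderiv_power_Suc)
       (simp add: pderiv_monom_CHAR_mult algebra_simps smult_add_left)
qed auto

lemma degree_pderiv_le: "degree (pderiv f) \<le> degree f - 1"
  for f :: "'a::idom poly"
  by (intro degree_le allI impI) (simp add: coeff_pderiv coeff_eq_0)

text \<open>
  Each derivative costs only \<open>degree f - 1\<close> in the degree, whatever \<open>N\<close> is. This makes it possible to
  take \<open>N\<close> as large as \<open>p / 2\<close>.
\<close>
lemma degree_higher_numerator:
  fixes f :: "'a::idom poly"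
  assumes "degree f \<ge> 1"
  shows "degree (higher_numerator f N k r) \<le> degree r + k * (degree f - 1)"
proof (induction k)
  case (Suc k)
  let ?T = "higher_numerator f N k r"
  have "degree (smult (of_nat (N - k)) (pderiv f * ?T)) \<le> degree (pderiv f * ?T)"
    by (rule degree_smult_le)
  also have "\<dots> \<le> degree (pderiv f) + degree ?T" by (rule degree_mult_le)
  also have "\<dots> \<le> (degree f - 1) + degree ?T" using degree_pderiv_le[of f] by simp
  finally have 1: "degree (smult (of_nat (N - k)) (pderiv f * ?T)) \<le> (degree f - 1) + degree ?T" .
  have 2: "degree (f * pderiv ?T) \<le> (degree f - 1) + degree ?T"
  proof (cases "degree ?T = 0")
    case True
    hence "pderiv ?T = 0" by (metis degree_eq_zeroE pderiv_singleton)
    thus ?thesis by simp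
  next
    case False
    have "degree (f * pderiv ?T) \<le> degree f + degree (pderiv ?T)" by (rule degree_mult_le)
    also have "\<dots> \<le> degree f + (degree ?T - 1)" using degree_pderiv_le[of ?T] by simp
    finally show ?thesis using False assms by simp
  qed
  have "degree (higher_numerator f N (Suc k) r) \<le> (degree f - 1) + degree ?T"
    using 1 2 by (auto intro: degree_add_le)
  thus ?case using Suc.IH by simp
qed auto

lemma higher_numerator_diff:
  "higher_numerator f N k (r - s) = higher_numerator f N k r - higher_numerator f N k s"
proof (induction k)
  case (Suc k)
  show ?case unfolding higher_numerator.simps Suc.IH
    by (simp add: pderiv_diff right_diff_distrib smult_diff_right)
qed auto

text \<open>
  With \<open>h = (p - 1) div 2\<close>, the relation \<open>r = - s * f ^ h\<close> modulo \<open>x ^ p\<close> gives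
  \<open>r\<^sup>2 * f = s\<^sup>2 * f ^ p = s\<^sup>2\<close> modulo \<open>x ^ p\<close>, because \<open>f ^ p - 1 = (f - 1) ^ p\<close> is divisible by
  \<open>x ^ p\<close>. Both sides have degree less than \<open>p\<close>, so they are equal, and the parity of the degrees
  forces them to vanish.
\<close>
lemma even_odd_relation_modulo_monom:
  fixes f r s :: "'a::finite_field poly"
  assumes card: "CARD('a) = CHAR('a)" "odd CHAR('a)"
    and f0: "poly f 0 = 1" and fodd: "odd (degree f)"
    and dr: "2 * degree r + degree f < CHAR('a)" and ds: "2 * degree s < CHAR('a)"
    and dvd: "monom 1 (CHAR('a)) dvd r + s * f ^ ((CHAR('a) - 1) div 2)"
  shows "r = 0 \<and> s = 0"
proof -
  define p where "p = CHAR('a)"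
  define h where "h = (p - 1) div 2"
  have pp: "prime p" unfolding p_def by (rule prime_CHAR_semidom) (simp add: finite_imp_CHAR_pos)
  have p2: "p = Suc (2 * h)" using card(2) pp unfolding h_def p_def by (auto elim!: oddE)
  let ?X = "monom (1::'a) p"
  have "?X dvd f ^ p - 1"
  proof -
    have "poly (f - 1) 0 = 0" using f0 by simp
    hence "monom 1 1 dvd f - 1" by (subst (asm) poly_eq_0_iff_dvd) (simp add: monom_altdef)
    hence "monom 1 1 ^ p dvd (f - 1) ^ p" by (rule dvd_power_same)
    moreover have "(1 + (f - 1)) ^ p = 1 ^ p + (f - 1) ^ p"
      using pp by (intro freshmans_dream) (simp_all add: p_def)
    ultimately show ?thesis by (simp add: monom_power)
  qed
  moreover have "?X dvd (r + s * f ^ h) * (r - s * f ^ h) * f"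
    using dvd by (simp add: p_def h_def)
  moreover have "(r + s * f ^ h) * (r - s * f ^ h) * f = r^2 * f - s^2 * f ^ p"
    by (simp add: p2 power2_eq_square algebra_simps power_add mult_2_right)
  ultimately have "?X dvd (r^2 * f - s^2 * f ^ p) + s^2 * (f ^ p - 1)" by (intro dvd_add) auto
  hence D: "?X dvd r^2 * f - s^2" by (simp add: algebra_simps)
  have "degree (r^2 * f - s^2) < p"
  proof (rule degree_diff_less)
    have "degree (r^2 * f) \<le> degree (r^2) + degree f" by (rule degree_mult_le)
    also have "degree (r^2) \<le> degree r * 2" by (rule degree_power_le)
    finally show "degree (r^2 * f) < p" using dr by (simp add: p_def)
    have "degree (s^2) \<le> degree s * 2" by (rule degree_power_le)
    thus "degree (s^2) < p" using ds by (simp add: p_def)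
  qed
  hence eq: "r^2 * f = s^2" using dvd_imp_degree_le[OF D] by (auto simp: degree_monom_eq)
  have f: "f \<noteq> 0" using fodd by auto
  have "r = 0"
  proof (rule ccontr)
    assume r: "r \<noteq> 0"
    hence s: "s \<noteq> 0" using eq f by auto
    have "degree (r^2 * f) = 2 * degree r + degree f" using r f by (simp add: degree_mult_eq degree_power_eq)
    moreover have "degree (s^2) = 2 * degree s" using s by (simp add: degree_power_eq)
    ultimately show False using eq fodd by (metis even_add even_mult_iff even_numeral)
  qed
  thus ?thesis using eq by simp
qed

text \<open>
  The first nonzero term dominates modulo the next power of \<open>x ^ p\<close>, so the relation reduces to the
  previous lemma.
\<close>
lemma stepanov_polynomial_nonzero:
  fixes f :: "'a::finite_field poly" and r s :: "nat \<Rightarrow> 'a poly"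
  assumes card: "CARD('a) = CHAR('a)" "odd CHAR('a)"
    and f0: "poly f 0 = 1" and fodd: "odd (degree f)"
    and dr: "\<And>j. 2 * degree (r j) + degree f < CHAR('a)" and ds: "\<And>j. 2 * degree (s j) < CHAR('a)"
    and zero: "(\<Sum>j<J. (r j + s j * f ^ ((CHAR('a) - 1) div 2)) * monom 1 (j * CHAR('a))) = 0"
  shows "\<forall>j<J. r j = 0 \<and> s j = 0"
proof (rule ccontr)
  define p where "p = CHAR('a)"
  define t where "t = (\<lambda>j. r j + s j * f ^ ((p - 1) div 2))"
  assume "\<not> (\<forall>j<J. r j = 0 \<and> s j = 0)"
  hence ex: "\<exists>j. j < J \<and> \<not> (r j = 0 \<and> s j = 0)" by auto
  define i where "i = (LEAST j. j < J \<and> \<not> (r j = 0 \<and> s j = 0))"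
  have i: "i < J" "\<not> (r i = 0 \<and> s i = 0)" using LeastI_ex[OF ex] by (auto simp: i_def)
  have below: "t j = 0" if "j < i" for j
  proof -
    have "\<not> (j < J \<and> \<not> (r j = 0 \<and> s j = 0))" using not_less_Least that unfolding i_def by blast
    thus ?thesis using that i by (simp add: t_def)
  qed
  have "(\<Sum>j<J. t j * monom 1 (j * p)) = (\<Sum>j\<in>{i..<J}. t j * monom 1 (j * p))"
    by (rule sum.mono_neutral_right) (auto simp: below)
  also have "{i..<J} = insert i {Suc i..<J}" using i by auto
  also have "(\<Sum>j\<in>\<dots>. t j * monom 1 (j * p)) = t i * monom 1 (i * p) + (\<Sum>j\<in>{Suc i..<J}. t j * monom 1 (j * p))"
    by simp
  finally have eq: "t i * monom 1 (i * p) = - (\<Sum>j\<in>{Suc i..<J}. t j * monom 1 (j * p))"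
    using zero by (simp add: t_def p_def eq_neg_iff_add_eq_0)
  have "monom 1 (Suc i * p) dvd (\<Sum>j\<in>{Suc i..<J}. t j * monom 1 (j * p))"
  proof (intro dvd_sum dvd_mult)
    fix j assume "j \<in> {Suc i..<J}"
    hence "Suc i * p \<le> j * p" by (intro mult_right_mono) auto
    hence "monom (1::'a) (j * p) = monom 1 (Suc i * p) * monom 1 (j * p - Suc i * p)" by (simp add: mult_monom)
    thus "monom 1 (Suc i * p) dvd monom (1::'a) (j * p)" by simp
  qed
  hence "monom 1 p * monom 1 (i * p) dvd t i * monom 1 (i * p)" by (simp add: eq mult_monom)
  hence "monom 1 p dvd t i" by (simp only: dvd_mult_cancel_right) (simp add: monom_eq_0_iff)
  hence "r i = 0 \<and> s i = 0"
    using even_odd_relation_modulo_monom[OF card f0 fodd dr ds] by (simp add: t_def p_def)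
  thus False using i by simp
qed

text \<open>
  The auxiliary polynomial is \<open>\<Sum>j<J. (f ^ l * r\<^sub>j + f ^ (l + h) * s\<^sub>j) * x ^ (j * p)\<close> with unknown
  \<open>r\<^sub>j\<close> and \<open>s\<^sub>j\<close> of degree less than \<open>D\<close>. At a point with \<open>f ^ h = 1\<close> one has in addition \<open>x ^ p = x\<close>, so
  its \<open>k\<close>-th derivative there is \<open>f ^ (l - k)\<close> times a polynomial of degree about \<open>D + J + l * degree f\<close>
  only. To make this polynomial vanish identically for all \<open>k < l\<close> is a linear system with fewer
  equations than the \<open>2 * J * D\<close> unknowns. The resulting polynomial has a root of order \<open>l\<close> at every such
  point, and it is nonzero; so its degree bounds the number of these points.
\<close>
lemma stepanov_bound:
  fixes f :: "'a::finite_field poly"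
  assumes card: "CARD('a) = CHAR('a)" "odd CHAR('a)"
    and f0: "poly f 0 = 1" and fodd: "odd (degree f)"
    and D: "2 * D + degree f \<le> CHAR('a)" "D > 0"
    and l: "l \<le> CHAR('a)" "l > 0"
    and unknowns: "l * (D + J + l * (degree f - 1)) < 2 * J * D"
  shows "l * card {x. poly f x ^ ((CHAR('a) - 1) div 2) = 1}
           \<le> (l + (CHAR('a) - 1) div 2) * degree f + D + (J - 1) * CHAR('a)"
proof -
  define p where "p = CHAR('a)"
  define h where "h = (p - 1) div 2"
  define d where "d = degree f"
  define S where "S = {x. poly f x ^ h = 1}"
  have pp: "prime p" unfolding p_def by (rule prime_CHAR_semidom) (simp add: finite_imp_CHAR_pos)
  have d1: "d \<ge> 1" using fodd unfolding d_def by (cases "degree f") auto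
  have f: "f \<noteq> 0" using fodd by auto
  have J: "J > 0" using unknowns by (cases J) auto
  define P where "P = (\<lambda>(c :: bool \<times> nat \<times> nat \<Rightarrow> 'a) b j. \<Sum>i<D. monom (c (b, j, i)) i)"
  have P_diff: "P (\<lambda>x. c x - c' x) b j = P c b j - P c' b j" for c c' b j
    by (simp add: P_def sum_subtractf diff_monom[symmetric])
  have P_deg: "degree (P c b j) \<le> D - 1" for c b j
    unfolding P_def by (intro degree_sum_le) (auto intro: order.trans[OF degree_monom_le])
  have P_coeff: "coeff (P c b j) i = c (b, j, i)" if "i < D" for c b j i
    unfolding P_def coeff_sum using that by (simp add: if_distrib cong: if_cong)
  \<comment> \<open>The index \<open>b\<close> tells the two families of unknowns apart: \<open>P c False\<close> is \<open>r\<close> and \<open>P c True\<close> is \<open>s\<close>.\<close>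
  define N where "N = (\<lambda>b. if b then l + h else l)"
  define C where "C = (\<lambda>c k j. higher_numerator f (N False) k (P c False j) + higher_numerator f (N True) k (P c True j))"
  define E where "E = (\<lambda>c k. \<Sum>j<J. C c k j * monom 1 j)"
  have E_deg: "degree (E c k) < D + J + l * (d - 1)" if "k < l" for c k
  proof -
    have "degree (E c k) \<le> (D - 1 + l * (d - 1)) + (J - 1)"
      unfolding E_def
    proof (intro degree_sum_le finite_lessThan)
      fix j assume j: "j \<in> {..<J}"
      have T: "degree (higher_numerator f n k (P c b j)) \<le> D - 1 + l * (d - 1)" for n b
      proof -
        have "degree (higher_numerator f n k (P c b j)) \<le> degree (P c b j) + k * (d - 1)"
          using degree_higher_numerator d1 unfolding d_def by blast
        also have "\<dots> \<le> D - 1 + l * (d - 1)" using P_deg that by (intro add_mono mult_right_mono) auto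
        finally show ?thesis .
      qed
      have "degree (C c k j * monom 1 j)
        \<le> degree (C c k j) + degree (monom (1::'a) j)"
        by (rule degree_mult_le)
      also have "\<dots> \<le> (D - 1 + l * (d - 1)) + (J - 1)"
        using T j unfolding C_def by (intro add_mono degree_add_le) (auto simp: degree_monom_eq)
      finally show "degree (C c k j * monom 1 j) \<le> (D - 1 + l * (d - 1)) + (J - 1)" .
    qed
    thus ?thesis using J D(2) by linarith
  qed
  \<comment> \<open>A bound for the degrees of all \<open>E c k\<close>; each coefficient is one equation.\<close>
  define M where "M = D + J + l * (d - 1)"
  have "\<exists>c. (\<exists>i\<in>UNIV \<times> {..<J} \<times> {..<D}. c i \<noteq> 0) \<and> (\<forall>i. i \<notin> UNIV \<times> {..<J} \<times> {..<D} \<longrightarrow> c i = 0)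
    \<and> (\<forall>e\<in>{..<l} \<times> {..<M}. (\<lambda>c (k, i). coeff (E c k) i) c e = 0)"
  proof (rule homogeneous_system_nonzero_solution)
    show "card ({..<l} \<times> {..<M}) < card ((UNIV :: bool set) \<times> {..<J} \<times> {..<D})"
      using unknowns by (simp add: card_cartesian_product M_def d_def)
  next
    fix c c' :: "bool \<times> nat \<times> nat \<Rightarrow> 'a" and e :: "nat \<times> nat"
    have "E (\<lambda>x. c x - c' x) k = E c k - E c' k" for k
      unfolding E_def C_def P_diff higher_numerator_diff sum_subtractf[symmetric]
      by (intro sum.cong refl) (simp add: algebra_simps)
    thus "(case e of (k, i) \<Rightarrow> coeff (E (\<lambda>i. c i - c' i) k) i) =
      (case e of (k, i) \<Rightarrow> coeff (E c k) i) - (case e of (k, i) \<Rightarrow> coeff (E c' k) i)"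
      by (simp split: prod.split)
  qed auto
  then obtain c where c: "\<exists>i\<in>UNIV \<times> {..<J} \<times> {..<D}. c i \<noteq> 0"
    and "\<forall>e\<in>{..<l} \<times> {..<M}. (\<lambda>c (k, i). coeff (E c k) i) c e = 0" by blast
  hence cE: "coeff (E c k) i = 0" if "k < l" "i < M" for k i using that by auto
  have E0: "E c k = 0" if "k < l" for k
  proof (rule poly_eqI)
    fix i show "coeff (E c k) i = coeff 0 i"
      using cE[OF that, of i] E_deg[OF that, of c] by (cases "i < M") (auto simp: M_def coeff_eq_0)
  qed
  define R where "R = (\<Sum>j<J. f ^ N False * P c False j * monom 1 (j * p) + f ^ N True * P c True j * monom 1 (j * p))"
  have R_factor: "R = f ^ l * (\<Sum>j<J. (P c False j + P c True j * f ^ h) * monom 1 (j * p))"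
    unfolding R_def sum_distrib_left by (intro sum.cong refl) (simp add: N_def algebra_simps power_add)
  have "R \<noteq> 0"
  proof
    assume "R = 0"
    hence "(\<Sum>j<J. (P c False j + P c True j * f ^ h) * monom 1 (j * p)) = 0" using f by (simp add: R_factor)
    hence "\<forall>j<J. P c False j = 0 \<and> P c True j = 0"
      unfolding p_def h_def
    proof (intro stepanov_polynomial_nonzero[OF card f0 fodd])
      fix j
      have *: "2 * degree (P c b j) + degree f < CHAR('a)" for b using P_deg[of c b j] D by linarith
      show       "2 * degree (P c False j) + degree f < CHAR('a)" "2 * degree (P c True j) < CHAR('a)"
        using *[of False] *[of True] by linarith+
    qed auto
    moreover obtain b j i where "j < J" "i < D" "c (b, j, i) \<noteq> 0" using c by auto
    ultimately show False using P_coeff[of i c b j] by (cases b) auto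
  qed
  have deriv: "(pderiv ^^ k) R = (\<Sum>j<J. f ^ (N False - k) * higher_numerator f (N False) k (P c False j) * monom 1 (j * p)
      + f ^ (N True - k) * higher_numerator f (N True) k (P c True j) * monom 1 (j * p))" if "k \<le> l" for k
  proof -
    have zero: "(pderiv ^^ k) 0 = (0 :: 'a poly)" by (induction k) simp_all
    have add: "(pderiv ^^ k) (a + b) = (pderiv ^^ k) a + (pderiv ^^ k) b" for a b :: "'a poly"
      by (induction k) (simp_all add: pderiv_add)
    have sum: "(pderiv ^^ k) (\<Sum>j\<in>A. F j) = (\<Sum>j\<in>A. (pderiv ^^ k) (F j))" for F :: "nat \<Rightarrow> 'a poly" and A
      by (induction A rule: infinite_finite_induct) (simp_all add: add zero)
    show ?thesis unfolding R_def sum add p_def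
      using that by (intro sum.cong refl arg_cong2[of _ _ _ _ "(+)"] higher_pderiv_power_times) (auto simp: N_def)
  qed
  have "l \<le> order x R" if x: "x \<in> S" for x
  proof (rule power_dvd_if_higher_pderivs_vanish)
    show "prime CHAR('a)" using pp by (simp add: p_def)
    fix k assume k: "k < l"
    have xp: "x ^ (j * p) = x ^ j" for j
      using finite_field_power_card_eq_same[of x] card by (simp add: p_def power_mult mult.commute[of j])
    have fx: "poly f x ^ (N True - k) = poly f x ^ (l - k)"
    proof -
      have "l + h - k = (l - k) + h" using k by simp
      thus ?thesis using x by (simp add: N_def S_def power_add)
    qed
    have "poly ((pderiv ^^ k) R) x = poly f x ^ (l - k) * poly (E c k) x"
      using k unfolding deriv[OF less_imp_le[OF k]] E_def C_def
      by (simp add: poly_sum sum_distrib_left poly_monom xp fx) (simp add: N_def algebra_simps)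
    thus "poly ((pderiv ^^ k) R) x = 0" using E0[OF k] by simp
  qed (use l \<open>R \<noteq> 0\<close> in auto)
  hence "l * card S \<le> degree R" using \<open>R \<noteq> 0\<close> by (intro card_mult_le_degree) auto
  also have "degree R \<le> (l + h) * d + D + (J - 1) * p"
    unfolding R_def
  proof (intro degree_sum_le degree_add_le finite_lessThan)
    fix j assume j: "j \<in> {..<J}"
    have *: "degree (f ^ N b * P c b j * monom 1 (j * p)) \<le> (l + h) * d + D + (J - 1) * p" for b
    proof -
      have "degree (f ^ N b * P c b j * monom 1 (j * p)) \<le> degree (f ^ N b) + degree (P c b j) + degree (monom (1::'a) (j * p))"
        by (meson add_le_mono1 degree_mult_le order_trans)
      also have "\<dots> \<le> N b * d + D + (J - 1) * p"
        using P_deg[of c b j] j by (intro add_mono) (auto simp: degree_power_eq f d_def degree_monom_eq intro: order.trans)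
      also have "N b * d \<le> (l + h) * d" by (intro mult_right_mono) (auto simp: N_def)
      finally show ?thesis by simp
    qed
    show "degree (f ^ N False * P c False j * monom 1 (j * p)) \<le> (l + h) * d + D + (J - 1) * p"
      "degree (f ^ N True * P c True j * monom 1 (j * p)) \<le> (l + h) * d + D + (J - 1) * p" using * by blast+
  qed
  finally show ?thesis by (simp add: S_def h_def d_def p_def)
qed

text \<open>
  The order of vanishing \<open>l = 2 * u\<close> is about \<open>sqrt p\<close>, and \<open>J\<close> exceeds \<open>l / 2\<close> by \<open>degree f\<close>, which is
  just enough for the linear system. The main term of the degree is then \<open>l * p / 2\<close>. For
  \<open>sqrt p < 8 * degree f\<close> the bound is trivial.
\<close>
lemma stepanov_bound_sqrt:
  fixes f :: "'a::finite_field poly"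
  assumes card: "CARD('a) = CHAR('a)" "odd CHAR('a)"
    and f0: "poly f 0 = 1" and fodd: "odd (degree f)"
  shows "real (card {x. poly f x ^ ((CHAR('a) - 1) div 2) = 1})
           \<le> real CHAR('a) / 2 + 4 * real (degree f) * sqrt (real CHAR('a))"
proof -
  define p where "p = CHAR('a)"
  define d where "d = degree f"
  define S where "S = {x. poly f x ^ ((p - 1) div 2) = 1}"
  define q where "q = sqrt (real p)"
  have q2: "q * q = real p" by (simp add: q_def)
  have q0: "q \<ge> 0" by (simp add: q_def)
  have d1: "d \<ge> 1" using fodd unfolding d_def by (cases "degree f") auto
  have "real (card S) \<le> real p / 2 + 4 * real d * q"
  proof (cases "8 * real d \<le> q")
    case False
    have "card S \<le> CARD('a)" by (rule card_mono) auto
    hence "real (card S) \<le> real p / 2 + q * q / 2" using card(1) q2 by (simp add: p_def)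
    also have "q * q / 2 \<le> 4 * real d * q"
      using False q0 mult_right_mono[of q "8 * real d" q] by simp
    finally show ?thesis by simp
  next
    case True
    define u where "u = nat \<lfloor>q / 2\<rfloor>"
    define D where "D = (p - d) div 2"
    have q8: "q \<ge> 8" using True d1 by linarith
    have u: "real u \<le> q / 2" "q / 2 < real u + 1"
      using q0 unfolding u_def by linarith+
    have u3: "u \<ge> 3 * d" using u(2) True d1 by linarith
    have u0: "u > 0" using u3 d1 by linarith
    have "8 * real d * q \<le> q * q" using True q0 by (intro mult_right_mono) auto
    moreover have "8 * (8 * real d) \<le> q * (8 * real d)" using q8 by (intro mult_right_mono) auto
    ultimately have "64 * real d \<le> real p" using q2 by (simp add: mult_ac)
    hence dp: "64 * d \<le> p" by linarith
    have ev: "even (p - d)" using fodd card(2) dp by (simp add: p_def d_def)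
    hence D2: "2 * D = p - d" by (simp add: D_def)
    have Dp: "2 * D + d = p" using D2 dp by linarith
    have "4 * (real u * real u) \<le> q * q"
      using mult_mono[OF u(1) u(1)] q0 by simp
    hence "real (4 * (u * u)) \<le> real p" using q2 by simp
    hence u2p: "4 * (u * u) \<le> p" by linarith
    have "3 * (3 * (d * d)) \<le> u * u" using mult_mono[OF u3 u3] by (simp add: mult_ac)
    moreover have "3 * (u * d) \<le> u * u" using mult_left_mono[OF u3, of u] by (simp add: mult_ac)
    moreover have "u * u > 0" using u0 by simp
    ultimately have small: "d * d + 2 * (u * d) < 2 * (u * u)" by linarith
    have "4 * (u * u) * d \<le> p * d" using u2p by (rule mult_right_mono) simp
    moreover have "p * d = 2 * D * d + d * d" using Dp by (metis add_mult_distrib)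
    moreover have "4 * (u * u) * d = 4 * (u * u) * (d - 1) + 4 * (u * u)"
      using d1 by (cases d) (simp_all add: algebra_simps)
    ultimately have "4 * (u * u) * (d - 1) + 2 * (u * u) + 2 * (u * d) < 2 * D * d" using small by linarith
    hence unk: "(2 * u) * (D + (u + d) + (2 * u) * (d - 1)) < 2 * (u + d) * D"
      by (simp add: algebra_simps)
    have "2 * u \<le> p"
    proof -
      have "2 * u \<le> 4 * (u * u)" using u0 by (cases u) auto
      thus ?thesis using u2p by linarith
    qed
    hence "(2 * u) * card S \<le> (2 * u + (p - 1) div 2) * d + D + (u + d - 1) * p"
      using stepanov_bound[OF card f0 fodd, of D "2 * u" "u + d"] unk Dp u0 dp d1
      by (simp add: p_def d_def S_def)
    hence "real ((2 * u) * card S) \<le> real ((2 * u + (p - 1) div 2) * d + D + (u + d - 1) * p)"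
      by (simp only: of_nat_le_iff)
    also have "\<dots> = (2 * real u + real ((p - 1) div 2)) * real d + real D + (real u + real d - 1) * real p"
      using d1 by (simp add: of_nat_diff)
    also have "\<dots> \<le> (2 * real u + real p / 2) * real d + real p / 2 + (real u + real d - 1) * real p"
      using Dp by (intro add_mono mult_right_mono order.refl) linarith+
    also have "\<dots> \<le> real u * real p + 2 * real u * real d + 3 / 2 * (real d * (q * q))"
      using q2 by (simp add: algebra_simps)
    also have "3 / 2 * (real d * (q * q)) \<le> 3 / 2 * (real d * (q * (8 / 3 * real u)))"
      using q0 u(2) q8 by (intro mult_left_mono) auto
    finally have "real u * (2 * real (card S)) \<le> real u * (real p + 2 * real d + 4 * real d * q)"
      by (simp add: algebra_simps)
    hence "2 * real (card S) \<le> real p + 2 * real d + 4 * real d * q"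
      using u0 by (simp only: mult_le_cancel_left_pos of_nat_0_less_iff)
    moreover have "real d * 1 \<le> real d * q" using q8 by (intro mult_left_mono) auto
    ultimately show ?thesis by simp
  qed
  thus ?thesis by (simp add: S_def p_def q_def d_def)
qed

definition weil_bound_for_linear_products :: "nat \<Rightarrow> bool" where
  "weil_bound_for_linear_products p \<longleftrightarrow>
     (\<forall>(I :: nat set) c. finite I \<longrightarrow> odd (card I) \<longrightarrow> (\<forall>i\<in>I. \<not> int p dvd c i) \<longrightarrow>
        real (card {y \<in> {0..<int p}. Legendre (\<Prod>i\<in>I. 1 + c i * y) (int p) = 1})
          \<le> real p / 2 + 4 * real (card I) * sqrt (real p))"

text \<open>
  Polynomials over the field with \<open>p\<close> elements live over a type, and a type cannot depend on a variable.
  It can depend on a constant: if the bound failed for some prime, then it would fail for the prime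
  chosen here, and the elements below it form a type. So it suffices to prove the bound for this single prime.
  The value \<open>3\<close> is used if there is no counterexample, to have a prime in any case.
\<close>
definition weil_exception :: nat where
  "weil_exception = (if \<exists>p. prime p \<and> odd p \<and> \<not> weil_bound_for_linear_products p
     then SOME p. prime p \<and> odd p \<and> \<not> weil_bound_for_linear_products p else 3)"

lemma prime_weil_exception: "prime weil_exception" "odd weil_exception"
  unfolding weil_exception_def
  using someI_ex[of "\<lambda>p. prime p \<and> odd p \<and> \<not> weil_bound_for_linear_products p"] by auto

typedef weil_index = "{..<weil_exception}"
  using prime_gt_0_nat[OF prime_weil_exception(1)] by blast

lemma CARD_weil_index: "CARD(weil_index) = weil_exception"
  using type_definition.card[OF type_definition_weil_index] by simp

instance weil_index :: prime_card
  by standard (simp add: CARD_weil_index prime_weil_exception)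

text \<open>
  By Euler's criterion, \<open>Legendre\<close> equals \<open>1\<close> only at points with \<open>f ^ ((p - 1) div 2) = 1\<close>.
\<close>
lemma weil_bound_weil_exception: "weil_bound_for_linear_products weil_exception"
  unfolding weil_bound_for_linear_products_def
proof (intro allI impI)
  fix I :: "nat set" and c :: "nat \<Rightarrow> int"
  define p where "p = weil_exception"
  assume I: "finite I" "odd (card I)" "\<forall>i\<in>I. \<not> int weil_exception dvd c i"
  let ?F = "of_int :: int \<Rightarrow> weil_index mod_ring"
  have CH: "CHAR(weil_index mod_ring) = p" by (simp add: CARD_weil_index p_def)
  have F0: "?F a = 0 \<longleftrightarrow> int p dvd a" for a
    using of_int_eq_0_iff_char_dvd[of a, where ?'a = "weil_index mod_ring"] CH by simp
  define f where "f = (\<Prod>i\<in>I. [:1, ?F (c i):])"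
  have deg: "degree f = card I"
  proof -
    have "degree f = (\<Sum>i\<in>I. degree [:1, ?F (c i):])"
      unfolding f_def by (rule degree_prod_eq_sum_degree) auto
    also have "\<dots> = (\<Sum>i\<in>I. 1)" using I(3) F0 by (intro sum.cong) (auto simp: p_def)
    finally show ?thesis by simp
  qed
  have pf: "poly f (?F y) = ?F (\<Prod>i\<in>I. 1 + c i * y)" for y
    unfolding f_def poly_prod of_int_prod by (intro prod.cong refl) (simp add: mult.commute)
  define Y where "Y = {y \<in> {0..<int p}. Legendre (\<Prod>i\<in>I. 1 + c i * y) (int p) = 1}"
  define S where "S = {x. poly f x ^ ((p - 1) div 2) = 1}"
  have "card Y \<le> card S"
  proof (rule card_inj_on_le[of ?F])
    show "inj_on ?F Y"
    proof (rule inj_onI)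
      fix x y assume xy: "x \<in> Y" "y \<in> Y" and "?F x = ?F y"
      hence "?F (x - y) = 0" by simp
      hence "[x = y] (mod int p)" using F0[of "x - y"] by (simp only: cong_iff_dvd_diff)
      thus "x = y" using xy by (auto simp: unique_euclidean_semiring_class.cong_def Y_def)
    qed
    show "?F ` Y \<subseteq> S"
    proof (rule image_subsetI)
      fix y assume "y \<in> Y"
      hence L: "Legendre (\<Prod>i\<in>I. 1 + c i * y) (int p) = 1" by (simp add: Y_def)
      have "p > 2" using prime_weil_exception prime_ge_2_nat[of p] by (cases "p = 2") (auto simp: p_def)
      hence "[Legendre (\<Prod>i\<in>I. 1 + c i * y) (int p) = (\<Prod>i\<in>I. 1 + c i * y) ^ ((p - 1) div 2)] (mod int p)"
        using prime_weil_exception(1) euler_criterion[of p "\<Prod>i\<in>I. 1 + c i * y"] by (simp add: p_def)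
      hence "int p dvd (\<Prod>i\<in>I. 1 + c i * y) ^ ((p - 1) div 2) - 1"
        using L by (simp add: cong_iff_dvd_diff dvd_diff_commute)
      hence "?F ((\<Prod>i\<in>I. 1 + c i * y) ^ ((p - 1) div 2) - 1) = 0" by (simp only: F0)
      thus "?F y \<in> S" by (simp add: S_def pf del: of_int_prod)
    qed
  qed simp
  moreover have "real (card S) \<le> real p / 2 + 4 * real (card I) * sqrt (real p)"
    using stepanov_bound_sqrt[of f] prime_weil_exception(2) I(2)
    by (simp add: CH[symmetric] S_def deg CARD_weil_index) (simp add: f_def poly_prod p_def)
  ultimately show "real (card {y \<in> {0..<int weil_exception}. Legendre (\<Prod>i\<in>I. 1 + c i * y) (int weil_exception) = 1})
          \<le> real weil_exception / 2 + 4 * real (card I) * sqrt (real weil_exception)"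
    unfolding p_def Y_def by linarith
qed

theorem weil_bound_linear_product:
  assumes "prime p" "odd p"
  shows "weil_bound_for_linear_products p"
proof (rule ccontr)
  assume "\<not> ?thesis"
  hence "\<exists>p. prime p \<and> odd p \<and> \<not> weil_bound_for_linear_products p" using assms by blast
  hence "\<not> weil_bound_for_linear_products weil_exception"
    unfolding weil_exception_def
    using someI_ex[of "\<lambda>p. prime p \<and> odd p \<and> \<not> weil_bound_for_linear_products p"] by auto
  thus False using weil_bound_weil_exception by simp
qed

section \<open>Moments of short character sums\<close>
lemma Legendre_eq_0_iff: "Legendre a (int p) = 0 \<longleftrightarrow> int p dvd a"
  by (auto simp: Legendre_def cong_0_iff)

lemma Legendre_cases: "Legendre a p \<in> {-1, 0, 1}"
  by (auto simp: Legendre_def)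

lemma Legendre_cong: "[a = b] (mod p) \<Longrightarrow> Legendre a p = Legendre b p"
  by (simp add: Legendre_def QuadRes_def unique_euclidean_semiring_class.cong_def)

lemma Legendre_mult:
  assumes "prime p" "p > 2"
  shows "Legendre (a * b) (int p) = Legendre a (int p) * Legendre b (int p)"
proof -
  let ?L = "\<lambda>a. Legendre a (int p)" and ?h = "(p - 1) div 2"
  have "[?L a * ?L b = a ^ ?h * b ^ ?h] (mod int p)"
    using assms by (intro cong_mult euler_criterion)
  moreover have "[?L (a * b) = a ^ ?h * b ^ ?h] (mod int p)"
    using euler_criterion[OF assms, of "a * b"] by (simp add: power_mult_distrib)
  ultimately have "int p dvd ?L (a * b) - ?L a * ?L b"
    using cong_trans cong_sym cong_iff_dvd_diff by blast
  moreover have "\<bar>?L (a * b) - ?L a * ?L b\<bar> \<le> 2"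
    using Legendre_cases[of "a * b" "int p"] Legendre_cases[of a "int p"] Legendre_cases[of b "int p"] by auto
  ultimately show ?thesis
    using assms(2) zdvd_imp_le[of "int p" "\<bar>?L (a * b) - ?L a * ?L b\<bar>"] by (cases "?L (a * b) = ?L a * ?L b") auto
qed

lemma Legendre_prod:
  assumes "prime p" "p > 2"
  shows "Legendre (\<Prod>i\<in>I. f i) (int p) = (\<Prod>i\<in>I. Legendre (f i) (int p))"
proof (induction I rule: infinite_finite_induct)
  have "Legendre (1 * 1) (int p) = Legendre 1 (int p) * Legendre 1 (int p)" by (rule Legendre_mult[OF assms])
  moreover have "Legendre 1 (int p) \<noteq> 0" using assms by (simp add: Legendre_eq_0_iff)
  ultimately have L1: "Legendre 1 (int p) = 1" by simp
  { case (infinite A) thus ?case using L1 by simp }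
  { case empty thus ?case using L1 by simp }
  { case (insert x A) thus ?case by (simp add: Legendre_mult[OF assms]) }
qed

lemma card_roots_prod_le:
  assumes p: "prime p" and I: "finite I"
    and uniq: "\<And>i x y. i \<in> I \<Longrightarrow> x \<in> A \<Longrightarrow> y \<in> A \<Longrightarrow> int p dvd f i x \<Longrightarrow> int p dvd f i y \<Longrightarrow> x = y"
  shows "card {x \<in> A. int p dvd (\<Prod>i\<in>I. f i x)} \<le> card I"
proof -
  have "{x \<in> A. int p dvd (\<Prod>i\<in>I. f i x)} \<subseteq> (\<Union>i\<in>I. {x \<in> A. int p dvd f i x})"
    using p I prime_dvd_prod_iff[of I "int p"] by auto
  moreover have fin: "finite {x \<in> A. int p dvd f i x}" "card {x \<in> A. int p dvd f i x} \<le> 1" if "i \<in> I" for i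
  proof -
    have "{x \<in> A. int p dvd f i x} \<subseteq> {x}" if "x \<in> {x \<in> A. int p dvd f i x}" for x
      using that uniq[OF \<open>i \<in> I\<close>] by blast
    hence "{x \<in> A. int p dvd f i x} = {} \<or> (\<exists>x. {x \<in> A. int p dvd f i x} = {x})" by blast
    then consider "{x \<in> A. int p dvd f i x} = {}" | x where "{x \<in> A. int p dvd f i x} = {x}" by blast
    thus "finite {x \<in> A. int p dvd f i x}" "card {x \<in> A. int p dvd f i x} \<le> 1"
      by (cases; simp only:; simp)+
  qed
  ultimately have "card {x \<in> A. int p dvd (\<Prod>i\<in>I. f i x)} \<le> card (\<Union>i\<in>I. {x \<in> A. int p dvd f i x})"
    using I by (intro card_mono) auto
  also have "\<dots> \<le> (\<Sum>i\<in>I. card {x \<in> A. int p dvd f i x})" using I by (rule card_UN_le)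
  also have "\<dots> \<le> (\<Sum>i\<in>I. 1)" using fin by (intro sum_mono) auto
  finally show ?thesis by simp
qed

lemma character_sum_eq_count:
  fixes g :: "int \<Rightarrow> int"
  shows "(\<Sum>x\<in>{0..<int p}. Legendre (g x) (int p)) =
    2 * int (card {x\<in>{0..<int p}. Legendre (g x) (int p) = 1}) + int (card {x\<in>{0..<int p}. int p dvd g x}) - int p"
proof -
  let ?L = "\<lambda>x. Legendre (g x) (int p)"
  have "?L x = 2 * (if ?L x = 1 then 1 else 0) + (if int p dvd g x then 1 else 0) - 1" for x
    using Legendre_cases[of "g x" "int p"] Legendre_eq_0_iff[of "g x" p] by auto
  hence "(\<Sum>x\<in>{0..<int p}. ?L x) = (\<Sum>x\<in>{0..<int p}. 2 * (if ?L x = 1 then 1 else 0) + (if int p dvd g x then 1 else 0) - 1)"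
    by (rule sum.cong[OF refl])
  thus ?thesis
    by (simp add: sum.distrib sum_subtractf sum_distrib_left[symmetric] sum.If_cases Int_def conj_commute)
qed

text \<open>
  The substitution \<open>x = 1 / y - b\<close> turns \<open>x + t i\<close> into \<open>(1 + (t i - b) * y) / y\<close>. The number of factors
  is even, so the power of \<open>y\<close> does not change the character; the factors with \<open>t i = b\<close> become trivial, and
  an odd number of linear factors with constant term \<open>1\<close> is left, as Stepanov's bound requires. Only an upper
  bound on the number of points with character \<open>1\<close> enters, because the sum is bounded only from above.
\<close>
lemma character_sum_odd_multiplicity:
  assumes p: "prime p" "p > 2" and t: "\<And>i. i < n \<Longrightarrow> t i \<in> {1..B}" and B: "B < p"
    and n: "even n" and odd: "odd (card {i. i < n \<and> t i = b})"
  shows "real_of_int (\<Sum>x\<in>{0..<int p}. Legendre (\<Prod>i<n. x + int (t i)) (int p)) \<le> 9 * real n * sqrt (real p)"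
proof -
  define I where "I = {i. i < n \<and> t i \<noteq> b}"
  define c where "c = (\<lambda>i. int (t i) - int b)"
  have fin: "finite I" by (simp add: I_def)
  have split: "{..<n} = I \<union> {i. i < n \<and> t i = b}" by (auto simp: I_def)
  have "card {..<n} = card I + card {i. i < n \<and> t i = b}"
    unfolding split by (rule card_Un_disjoint) (auto simp: I_def)
  hence "n = card I + card {i. i < n \<and> t i = b}" by simp
  hence cardI: "odd (card I)" "card I \<le> n" using n odd even_add[of "card I" "card {i. i < n \<and> t i = b}"] by simp_all
  have "{i. i < n \<and> t i = b} \<noteq> {}" using odd by (metis card.empty even_zero)
  hence b: "b \<in> {1..B}" using t by auto
  have cI: "\<not> int p dvd c i" if "i \<in> I" for i
  proof
    assume dvd: "int p dvd c i"
    have "t i \<in> {1..B}" "t i \<noteq> b" using that t by (auto simp: I_def)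
    hence "c i \<noteq> 0" "\<bar>c i\<bar> < int p" using b B by (auto simp: c_def)
    thus False using dvd zdvd_imp_le[of "int p" "\<bar>c i\<bar>"] by auto
  qed
  define A where "A = {x\<in>{0..<int p}. Legendre (\<Prod>i<n. x + int (t i)) (int p) = 1}"
  define A' where "A' = {y\<in>{0..<int p}. Legendre (\<Prod>i\<in>I. 1 + c i * y) (int p) = 1}"
  have ex: "\<exists>y. y \<in> {0..<int p} \<and> [(x + int b) * y = 1] (mod int p)" if "x \<in> A" for x
  proof -
    obtain j where j: "j < n" "t j = b" using \<open>{i. i < n \<and> t i = b} \<noteq> {}\<close> by auto
    have "\<not> int p dvd (\<Prod>i<n. x + int (t i))" using that Legendre_eq_0_iff[of "\<Prod>i<n. x + int (t i)" p] by (auto simp: A_def)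
    hence "\<not> int p dvd x + int b" using j dvd_prod[of "{..<n}" j "\<lambda>i. x + int (t i)"] by (auto intro: dvd_trans)
    hence "coprime (x + int b) (int p)" using p by (simp add: coprime_commute prime_imp_coprime)
    then obtain y where y: "[(x + int b) * y = 1] (mod int p)" using cong_solve_coprime_int by blast
    have "[(x + int b) * (y mod int p) = (x + int b) * y] (mod int p)" by (intro cong_mult) auto
    thus ?thesis using y p by (intro exI[of _ "y mod int p"]) (auto intro: cong_trans)
  qed
  define y where "y = (\<lambda>x. SOME y. y \<in> {0..<int p} \<and> [(x + int b) * y = 1] (mod int p))"
  have y: "y x \<in> {0..<int p}" "[(x + int b) * y x = 1] (mod int p)" if "x \<in> A" for x
    using someI_ex[OF ex[OF that]] by (simp_all add: y_def)
  have "card A \<le> card A'"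
  proof (rule card_inj_on_le[of y])
    show "inj_on y A"
    proof (rule inj_onI)
      fix u v assume uv: "u \<in> A" "v \<in> A" "y u = y v"
      have "[(u + int b) * ((v + int b) * y v) = (u + int b) * 1] (mod int p)"
        using y(2)[OF uv(2)] by (intro cong_mult) auto
      moreover have "[(v + int b) * ((u + int b) * y u) = (v + int b) * 1] (mod int p)"
        using y(2)[OF uv(1)] by (intro cong_mult) auto
      ultimately have "[u + int b = v + int b] (mod int p)"
        using uv(3) by (metis cong_sym cong_trans mult.left_commute mult_1_right)
      hence "[u = v] (mod int p)" by (simp add: cong_add_rcancel)
      thus "u = v" using uv by (auto simp: A_def unique_euclidean_semiring_class.cong_def)
    qed
    show "y ` A \<subseteq> A'"
    proof (rule image_subsetI)
      fix x assume x: "x \<in> A"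
      have ndvd: "\<not> int p dvd y x"
      proof
        assume "int p dvd y x"
        hence "int p dvd (x + int b) * y x" by simp
        hence "int p dvd 1" using y(2)[OF x] cong_dvd_iff by blast
        thus False using p by simp
      qed
      have "[(\<Prod>i<n. y x * (x + int (t i))) = (\<Prod>i<n. 1 + c i * y x)] (mod int p)"
      proof (intro cong_prod)
        fix i
        have "[(x + int b) * y x + c i * y x = 1 + c i * y x] (mod int p)"
          using y(2)[OF x] by (intro cong_add) auto
        thus "[y x * (x + int (t i)) = 1 + c i * y x] (mod int p)" by (simp add: c_def algebra_simps)
      qed
      also have "(\<Prod>i<n. 1 + c i * y x) = (\<Prod>i\<in>I. 1 + c i * y x)"
        by (rule prod.mono_neutral_right) (auto simp: I_def c_def)
      finally have "Legendre (\<Prod>i\<in>I. 1 + c i * y x) (int p) = Legendre (\<Prod>i<n. y x * (x + int (t i))) (int p)"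
        using Legendre_cong by metis
      also have "\<dots> = Legendre (y x) (int p) ^ n * Legendre (\<Prod>i<n. x + int (t i)) (int p)"
        unfolding Legendre_prod[OF p] Legendre_mult[OF p] prod.distrib by simp
      also have "\<dots> = 1"
      proof -
        have "Legendre (y x) (int p) \<in> {-1, 1}"
          using Legendre_cases[of "y x" "int p"] Legendre_eq_0_iff[of "y x" p] ndvd by auto
        thus ?thesis using n x by (auto simp: A_def)
      qed
      finally show "y x \<in> A'" using y(1)[OF x] by (simp add: A'_def)
    qed
    have "A' \<subseteq> {0..<int p}" by (auto simp: A'_def)
    thus "finite A'" by (rule finite_subset) simp
  qed
  moreover have "real (card A') \<le> real p / 2 + 4 * real (card I) * sqrt (real p)"
    using weil_bound_linear_product[OF p(1)] p prime_odd_nat[OF p(1)] fin cardI cI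
    unfolding weil_bound_for_linear_products_def A'_def by blast
  ultimately have "real (card A) \<le> real p / 2 + 4 * real (card I) * sqrt (real p)" by linarith
  moreover have "4 * real (card I) * sqrt (real p) \<le> 4 * real n * sqrt (real p)"
    using cardI by (intro mult_right_mono) auto
  moreover define Z where "Z = {x\<in>{0..<int p}. int p dvd (\<Prod>i<n. x + int (t i))}"
  have "card Z \<le> card {..<n}"
    unfolding Z_def
  proof (rule card_roots_prod_le)
    fix i x y assume xy: "x \<in> {0..<int p}" "y \<in> {0..<int p}" "int p dvd x + int (t i)" "int p dvd y + int (t i)"
    have "int p dvd (x + int (t i)) - (y + int (t i))" using xy(3,4) by (rule dvd_diff)
    hence "[x = y] (mod int p)" by (simp add: cong_iff_dvd_diff)
    thus "x = y" using xy by (auto simp: unique_euclidean_semiring_class.cong_def)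
  qed (use p in auto)
  hence "real (card Z) \<le> real n" by simp
  moreover have "real n * 1 \<le> real n * sqrt (real p)" using p by (intro mult_left_mono) auto
  moreover have "real_of_int (\<Sum>x\<in>{0..<int p}. Legendre (\<Prod>i<n. x + int (t i)) (int p))
      = 2 * real (card A) + real (card Z) - real p"
    using character_sum_eq_count[of "\<lambda>x. \<Prod>i<n. x + int (t i)" p, folded A_def Z_def] by linarith
  ultimately show ?thesis by linarith
qed

text \<open>
  Such a tuple factors through a map \<open>{..<n} \<rightarrow> {..<r}\<close>.
\<close>
lemma card_few_values_le:
  assumes "n > 0"
  shows "card {t \<in> PiE {..<n} (\<lambda>_. {1..B}). card (t ` {..<n}) \<le> r} \<le> B ^ r * r ^ n"
proof -
  define m where "m = (\<lambda>(v, s). \<lambda>i\<in>{..<n}. v (s i :: nat) :: nat)"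
  have "{t \<in> PiE {..<n} (\<lambda>_. {1..B}). card (t ` {..<n}) \<le> r} \<subseteq> m ` (PiE {..<r} (\<lambda>_. {1..B}) \<times> PiE {..<n} (\<lambda>_. {..<r}))"
  proof
    fix t assume t: "t \<in> {t \<in> PiE {..<n} (\<lambda>_. {1..B}). card (t ` {..<n}) \<le> r}"
    define V where "V = t ` {..<n}"
    have V: "finite V" "V \<noteq> {}" "card V \<le> r" using t assms by (auto simp: V_def)
    obtain e where e: "bij_betw e {0..<card V} V" using ex_bij_betw_nat_finite[OF V(1)] by blast
    define v where "v = (\<lambda>k\<in>{..<r}. if k < card V then e k else e 0)"
    have VB: "V \<subseteq> {1..B}" using t by (auto simp: V_def PiE_iff)
    have card0: "card V > 0" using V by (simp add: card_gt_0_iff)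
    have eV: "e k \<in> V" if "k < card V" for k using e that by (auto simp: bij_betw_def)
    have v: "v \<in> PiE {..<r} (\<lambda>_. {1..B})" using VB eV card0 by (auto simp: v_def)
    have ex: "\<exists>k. k < r \<and> v k = t i" if "i < n" for i
    proof -
      have "t i \<in> V" using that by (simp add: V_def)
      hence "t i \<in> e ` {0..<card V}" using e by (simp add: bij_betw_def)
      then obtain k where "k < card V" "e k = t i" by auto
      thus ?thesis using V(3) by (intro exI[of _ k]) (auto simp: v_def)
    qed
    define s where "s = (\<lambda>i. SOME k. k < r \<and> v k = t i)"
    have s: "s i < r" "v (s i) = t i" if "i < n" for i
      using someI_ex[OF ex[OF that]] by (simp_all add: s_def)
    have "t = m (v, \<lambda>i\<in>{..<n}. s i)"
      using t s by (auto simp: m_def PiE_iff extensional_def fun_eq_iff)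
    moreover have "(\<lambda>i\<in>{..<n}. s i) \<in> PiE {..<n} (\<lambda>_. {..<r})" using s by auto
    ultimately show "t \<in> m ` (PiE {..<r} (\<lambda>_. {1..B}) \<times> PiE {..<n} (\<lambda>_. {..<r}))" using v by blast
  qed
  hence "card {t \<in> PiE {..<n} (\<lambda>_. {1..B}). card (t ` {..<n}) \<le> r} \<le> card (PiE {..<r} (\<lambda>_. {1..B}) \<times> PiE {..<n} (\<lambda>_. {..<r}))"
    by (intro surj_card_le finite_cartesian_product finite_PiE) auto
  also have "\<dots> = B ^ r * r ^ n" by (simp add: card_cartesian_product card_PiE)
  finally show ?thesis .
qed

text \<open>
  Expand the power into a sum over tuples. If every value of a tuple occurs an even number of times, then
  the tuple has at most \<open>r\<close> values; these tuples are few and contribute at most \<open>p\<close> each. All others are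
  covered by Weil's bound.
\<close>
lemma character_moment_bound:
  assumes p: "prime p" "p > 2" and B: "B < p" and r: "r \<ge> 1"
  shows "real_of_int (\<Sum>x\<in>{0..<int p}. (\<Sum>b\<in>{1..B}. Legendre (x + int b) (int p)) ^ (2 * r))
    \<le> real r ^ (2 * r) * real B ^ r * real p + 18 * real r * real B ^ (2 * r) * sqrt (real p)"
proof -
  define T where "T = PiE {..<2*r} (\<lambda>_. {1..B})"
  define P where "P = (\<lambda>t :: nat \<Rightarrow> nat. \<Sum>x\<in>{0..<int p}. Legendre (\<Prod>i<2*r. x + int (t i)) (int p))"
  define Few where "Few = {t \<in> T. card (t ` {..<2*r}) \<le> r}"
  have finT: "finite T" unfolding T_def by (intro finite_PiE) auto
  have cardT: "card T = B ^ (2 * r)" unfolding T_def by (simp add: card_PiE)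
  have "(\<Sum>x\<in>{0..<int p}. (\<Sum>b\<in>{1..B}. Legendre (x + int b) (int p)) ^ (2 * r))
     = (\<Sum>x\<in>{0..<int p}. \<Sum>t\<in>T. Legendre (\<Prod>i<2*r. x + int (t i)) (int p))"
  proof (intro sum.cong refl)
    fix x :: int
    have "(\<Sum>b\<in>{1..B}. Legendre (x + int b) (int p)) ^ (2 * r) = (\<Prod>i<2*r. \<Sum>b\<in>{1..B}. Legendre (x + int b) (int p))"
      by simp
    also have "\<dots> = (\<Sum>t\<in>T. \<Prod>i<2*r. Legendre (x + int (t i)) (int p))"
      unfolding T_def by (rule prod_sum_PiE) auto
    finally show "(\<Sum>b\<in>{1..B}. Legendre (x + int b) (int p)) ^ (2 * r) = (\<Sum>t\<in>T. Legendre (\<Prod>i<2*r. x + int (t i)) (int p))"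
      by (simp only: Legendre_prod[OF p])
  qed
  also have "\<dots> = (\<Sum>t\<in>T. P t)" unfolding P_def by (rule sum.swap)
  also have "T = Few \<union> (T - Few)" by (auto simp: Few_def)
  also have "(\<Sum>t\<in>\<dots>. P t) = (\<Sum>t\<in>Few. P t) + (\<Sum>t\<in>T - Few. P t)"
    using finT by (intro sum.union_disjoint) (auto simp: Few_def)
  finally have eq: "(\<Sum>x\<in>{0..<int p}. (\<Sum>b\<in>{1..B}. Legendre (x + int b) (int p)) ^ (2 * r))
     = (\<Sum>t\<in>Few. P t) + (\<Sum>t\<in>T - Few. P t)" .
  have "P t \<le> int p" for t
  proof -
    have "P t \<le> (\<Sum>x\<in>{0..<int p}. 1)"
      unfolding P_def
    proof (intro sum_mono)
      fix x show "Legendre (\<Prod>i<2*r. x + int (t i)) (int p) \<le> 1"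
        using Legendre_cases[of "\<Prod>i<2*r. x + int (t i)" "int p"] by auto
    qed
    thus ?thesis by simp
  qed
  hence "real_of_int (\<Sum>t\<in>Few. P t) \<le> (\<Sum>t\<in>Few. real p)"
    unfolding of_int_sum by (intro sum_mono) (metis of_int_le_iff of_int_of_nat_eq)
  also have "\<dots> = real (card Few) * real p" by simp
  also have "card Few \<le> B ^ r * r ^ (2 * r)"
    unfolding Few_def T_def using r by (intro card_few_values_le) auto
  finally have few: "real_of_int (\<Sum>t\<in>Few. P t) \<le> real (B ^ r * r ^ (2 * r)) * real p"
    by (simp add: mult_right_mono)
  have "real_of_int (P t) \<le> 9 * real (2 * r) * sqrt (real p)" if t: "t \<in> T - Few" for t
  proof -
    have "\<exists>b. odd (card {i. i < 2 * r \<and> t i = b})"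
    proof (rule ccontr)
      assume ev: "\<nexists>b. odd (card {i. i < 2 * r \<and> t i = b})"
      define V where "V = t ` {..<2*r}"
      have ge: "card {i. i < 2 * r \<and> t i = b} \<ge> 2" if "b \<in> V" for b
      proof -
        have "{i. i < 2 * r \<and> t i = b} \<noteq> {}" using that by (auto simp: V_def)
        hence "card {i. i < 2 * r \<and> t i = b} \<noteq> 0" by (simp add: card_eq_0_iff)
        moreover have "even (card {i. i < 2 * r \<and> t i = b})" using ev by blast
        ultimately show ?thesis by presburger
      qed
      have "2 * card V \<le> (\<Sum>b\<in>V. card {i. i < 2 * r \<and> t i = b})"
        using sum_mono[OF ge, of V "\<lambda>b. b"] by simp
      also have "\<dots> = card (\<Union>b\<in>V. {i. i < 2 * r \<and> t i = b})"
        by (rule card_UN_disjoint[symmetric]) (auto simp: V_def)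
      also have "(\<Union>b\<in>V. {i. i < 2 * r \<and> t i = b}) = {..<2 * r}" by (auto simp: V_def)
      finally show False using t by (simp add: Few_def V_def)
    qed
    then obtain b where b: "odd (card {i. i < 2 * r \<and> t i = b})" by blast
    show ?thesis unfolding P_def
      by (rule character_sum_odd_multiplicity[OF p _ B _ b]) (use t in \<open>auto simp: T_def PiE_iff\<close>)
  qed
  hence "real_of_int (\<Sum>t\<in>T - Few. P t) \<le> (\<Sum>t\<in>T - Few. 9 * real (2 * r) * sqrt (real p))"
    unfolding of_int_sum by (intro sum_mono)
  also have "\<dots> = real (card (T - Few)) * (9 * real (2 * r) * sqrt (real p))" by simp
  also have "\<dots> \<le> real (B ^ (2 * r)) * (9 * real (2 * r) * sqrt (real p))"
    using card_mono[OF finT, of "T - Few"] cardT by (intro mult_right_mono) auto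
  finally show ?thesis using few unfolding eq by (simp add: algebra_simps)
qed

section \<open>Burgess' estimate\<close>
lemma shifted_sum_diff_le:
  fixes g :: "nat \<Rightarrow> int"
  assumes "\<And>n. \<bar>g n\<bar> \<le> 1"
  shows "\<bar>(\<Sum>n\<in>{1..H}. g n) - (\<Sum>n\<in>{1..H}. g (n + k))\<bar> \<le> 2 * int k"
proof (induction k)
  case (Suc k)
  have "(\<Sum>n\<in>{1..H}. g (Suc n + k) - g (n + k)) = g (Suc H + k) - g (1 + k)"
    using sum_Suc_diff[of 1 H "\<lambda>n. g (n + k)"] by simp
  hence "(\<Sum>n\<in>{1..H}. g (n + Suc k)) - (\<Sum>n\<in>{1..H}. g (n + k)) = g (Suc H + k) - g (1 + k)"
    by (simp add: sum_subtractf)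
  moreover have "\<bar>x - z\<bar> \<le> K + 2" if "z - y = c - d" "\<bar>x - y\<bar> \<le> K" "\<bar>c\<bar> \<le> 1" "\<bar>d\<bar> \<le> 1"
    for x y z c d K :: int using that by linarith
  ultimately have "\<bar>(\<Sum>n\<in>{1..H}. g n) - (\<Sum>n\<in>{1..H}. g (n + Suc k))\<bar> \<le> 2 * int k + 2"
    using Suc.IH assms by blast
  thus ?case by simp
qed auto

text \<open>
  Shifting the range of summation by \<open>a * b\<close> changes the sum by at most \<open>2 * a * b\<close>. Since
  \<open>n + a * b = a * (x a n + b)\<close> modulo \<open>p\<close>, the average over all shifts consists of sums of length \<open>B\<close> that start
  at the points \<open>x a n = n / a\<close>, which are spread over all residue classes.
\<close>
lemma burgess_shift:
  assumes p: "prime p" "p > 2" and A: "A < p"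
    and x: "\<And>a n. a \<in> {1..A} \<Longrightarrow> [int a * x a n = int n] (mod int p)"
  shows "int (A * B) * \<bar>\<Sum>n\<in>{1..H}. Legendre (int n) (int p)\<bar>
     \<le> (\<Sum>(a, n)\<in>{1..A} \<times> {1..H}. \<bar>\<Sum>b\<in>{1..B}. Legendre (x a n + int b) (int p)\<bar>) + 2 * int (A * B) * int (A * B)"
proof -
  let ?L = "\<lambda>n. Legendre n (int p)"
  define S where "S = (\<Sum>n\<in>{1..H}. ?L (int n))"
  have L1: "\<bar>?L n\<bar> \<le> 1" for n using Legendre_cases[of n "int p"] by auto
  have shift: "\<bar>S - (\<Sum>n\<in>{1..H}. ?L (int (n + a * b)))\<bar> \<le> 2 * int (A * B)" if "a \<in> {1..A}" "b \<in> {1..B}" for a b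
  proof -
    have "\<bar>S - (\<Sum>n\<in>{1..H}. ?L (int (n + a * b)))\<bar> \<le> 2 * int (a * b)"
      unfolding S_def by (rule shifted_sum_diff_le) (rule L1)
    also have "a * b \<le> A * B" using that by (intro mult_mono) auto
    finally show ?thesis by simp
  qed
  have "int (A * B) * S - (\<Sum>(a, b)\<in>{1..A} \<times> {1..B}. \<Sum>n\<in>{1..H}. ?L (int (n + a * b)))
     = (\<Sum>(a, b)\<in>{1..A} \<times> {1..B}. S - (\<Sum>n\<in>{1..H}. ?L (int (n + a * b))))"
    by (simp add: case_prod_unfold sum_subtractf card_cartesian_product)
  also have "\<bar>\<dots>\<bar> \<le> (\<Sum>(a, b)\<in>{1..A} \<times> {1..B}. 2 * int (A * B))"
    using shift by (intro order.trans[OF sum_abs] sum_mono) (auto simp: case_prod_unfold)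
  also have "\<dots> = 2 * int (A * B) * int (A * B)" by (simp add: card_cartesian_product)
  finally have 1: "\<bar>int (A * B) * S - (\<Sum>(a, b)\<in>{1..A} \<times> {1..B}. \<Sum>n\<in>{1..H}. ?L (int (n + a * b)))\<bar>
     \<le> 2 * int (A * B) * int (A * B)" .
  have "(\<Sum>(a, b)\<in>{1..A} \<times> {1..B}. \<Sum>n\<in>{1..H}. ?L (int (n + a * b)))
     = (\<Sum>a\<in>{1..A}. \<Sum>b\<in>{1..B}. \<Sum>n\<in>{1..H}. ?L (int (n + a * b)))"
    by (rule sum.cartesian_product[symmetric])
  also have "\<dots> = (\<Sum>a\<in>{1..A}. \<Sum>n\<in>{1..H}. \<Sum>b\<in>{1..B}. ?L (int (n + a * b)))"
    by (intro sum.cong refl sum.swap)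
  also have "\<dots> = (\<Sum>a\<in>{1..A}. \<Sum>n\<in>{1..H}. ?L (int a) * (\<Sum>b\<in>{1..B}. ?L (x a n + int b)))"
  proof (intro sum.cong refl)
    fix a n assume a: "a \<in> {1..A}"
    have "?L (int (n + a * b)) = ?L (int a) * ?L (x a n + int b)" for b
    proof -
      have "[int a * x a n + int a * int b = int n + int a * int b] (mod int p)"
        using x[OF a] by (intro cong_add) auto
      hence "[int a * (x a n + int b) = int (n + a * b)] (mod int p)" by (simp add: algebra_simps)
      thus ?thesis using Legendre_cong Legendre_mult[OF p] by metis
    qed
    thus "(\<Sum>b\<in>{1..B}. ?L (int (n + a * b))) = ?L (int a) * (\<Sum>b\<in>{1..B}. ?L (x a n + int b))"
      by (simp add: sum_distrib_left)
  qed
  also have "\<bar>\<dots>\<bar> \<le> (\<Sum>a\<in>{1..A}. \<Sum>n\<in>{1..H}. \<bar>\<Sum>b\<in>{1..B}. ?L (x a n + int b)\<bar>)"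
  proof (intro order.trans[OF sum_abs] sum_mono)
    fix a n
    have "\<bar>?L (int a)\<bar> * \<bar>\<Sum>b\<in>{1..B}. ?L (x a n + int b)\<bar> \<le> 1 * \<bar>\<Sum>b\<in>{1..B}. ?L (x a n + int b)\<bar>"
      using L1 by (intro mult_right_mono) auto
    thus "\<bar>?L (int a) * (\<Sum>b\<in>{1..B}. ?L (x a n + int b))\<bar> \<le> \<bar>\<Sum>b\<in>{1..B}. ?L (x a n + int b)\<bar>"
      by (simp add: abs_mult)
  qed
  also have "\<dots> = (\<Sum>(a, n)\<in>{1..A} \<times> {1..H}. \<bar>\<Sum>b\<in>{1..B}. ?L (x a n + int b)\<bar>)"
    by (rule sum.cartesian_product)
  finally have 2: "\<bar>\<Sum>(a, b)\<in>{1..A} \<times> {1..B}. \<Sum>n\<in>{1..H}. ?L (int (n + a * b))\<bar>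
    \<le> (\<Sum>(a, n)\<in>{1..A} \<times> {1..H}. \<bar>\<Sum>b\<in>{1..B}. ?L (x a n + int b)\<bar>)" .
  have "int (A * B) * \<bar>S\<bar> = \<bar>int (A * B) * S\<bar>" by (simp add: abs_mult)
  thus ?thesis using 1 2 unfolding S_def[symmetric] by linarith
qed

text \<open>
  In a solution of \<open>a' * n = a * n'\<close> write \<open>a = g * u\<close> and \<open>a' = g * v\<close> with coprime \<open>u\<close> and \<open>v\<close>; then
  \<open>n = u * t\<close> and \<open>n' = v * t\<close>. For given \<open>u\<close> and \<open>v\<close> there are at most \<open>A / u\<close> values of \<open>g\<close> and \<open>H / v\<close>
  values of \<open>t\<close>.
\<close>
lemma card_proportional_pairs_le:
  fixes A H :: nat
  shows "real (card {((a, n), (a', n')) \<in> ({1..A} \<times> {1..H}) \<times> ({1..A} \<times> {1..H}). a' * n = a * n'})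
     \<le> real A * real H * (harm A)\<^sup>2"
proof -
  define W where "W = {((a, n), (a', n')) \<in> ({1..A} \<times> {1..H}) \<times> ({1..A} \<times> {1..H}). a' * n = a * n'}"
  define U where "U = (SIGMA w:{1..A} \<times> {1..A}. {1..A div fst w} \<times> {1..H div snd w})"
  define m where "m = (\<lambda>((u, v), (g, t)). ((g * u, u * t), (g * v, v * t)) :: (nat \<times> nat) \<times> (nat \<times> nat))"
  have "W \<subseteq> m ` U"
  proof
    fix w assume "w \<in> W"
    then obtain a n a' n' where w: "w = ((a, n), (a', n'))" and an: "a \<in> {1..A}" "n \<in> {1..H}" "a' \<in> {1..A}" "n' \<in> {1..H}"
      and eq: "a' * n = a * n'" by (auto simp: W_def)
    define g where "g = gcd a a'"
    define u where "u = a div g"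
    define v where "v = a' div g"
    have g0: "g > 0" using an by (simp add: g_def)
    have a: "a = g * u" "a' = g * v" by (simp_all add: g_def u_def v_def)
    have uv: "u > 0" "v > 0" using a an by (auto intro: Nat.gr0I)
    have cop: "coprime u v" unfolding u_def v_def g_def using an by (intro div_gcd_coprime) auto
    have eq': "v * n = u * n'" using eq g0 unfolding a by (simp add: mult.assoc)
    hence "u dvd v * n" by simp
    hence "u dvd n" using cop by (simp add: coprime_dvd_mult_right_iff)
    then obtain t where t: "n = u * t" by (elim dvdE)
    have n': "n' = v * t" using eq' uv t by simp
    have t0: "t > 0" using t an by (auto intro: Nat.gr0I)
    have "u \<le> g * u" "v \<le> g * v" using g0 by auto
    moreover have "g * u \<le> A" "g * v \<le> A" using a an by simp_all
    ultimately have uvA: "u \<le> A" "v \<le> A" by (blast intro: order.trans)+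
    have "g * u \<le> A" "t * v \<le> H" using a an n' by (auto simp: mult.commute)
    hence "g \<le> A div u" "t \<le> H div v" using uv by (simp_all add: less_eq_div_iff_mult_less_eq)
    hence "((u, v), (g, t)) \<in> U" using uv uvA g0 t0 by (auto simp: U_def)
    moreover have "w = m ((u, v), (g, t))" by (simp add: m_def w a t n')
    ultimately show "w \<in> m ` U" by blast
  qed
  moreover have finU: "finite U" unfolding U_def by auto
  ultimately have "card W \<le> card U" by (rule surj_card_le[rotated])
  also have "card U = (\<Sum>w\<in>{1..A} \<times> {1..A}. (A div fst w) * (H div snd w))"
    unfolding U_def by (subst card_SigmaI) (auto simp: card_cartesian_product)
  finally have "real (card W) \<le> real (\<Sum>w\<in>{1..A} \<times> {1..A}. (A div fst w) * (H div snd w))" by (simp only: of_nat_le_iff)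
  also have "\<dots> = (\<Sum>w\<in>{1..A} \<times> {1..A}. real (A div fst w) * real (H div snd w))" by simp
  also have "\<dots> \<le> (\<Sum>w\<in>{1..A} \<times> {1..A}. (real A / real (fst w)) * (real H / real (snd w)))"
    by (intro sum_mono mult_mono) (auto simp: of_nat_div_le_of_nat)
  also have "\<dots> = (\<Sum>u\<in>{1..A}. \<Sum>v\<in>{1..A}. (real A / real u) * (real H / real v))"
    by (simp add: sum.cartesian_product case_prod_unfold)
  also have "\<dots> = (\<Sum>u\<in>{1..A}. real A / real u) * (\<Sum>v\<in>{1..A}. real H / real v)"
    by (rule sum_product[symmetric])
  also have "\<dots> = real A * real H * (harm A)\<^sup>2"
    by (simp add: harm_def power2_eq_square divide_inverse sum_distrib_left[symmetric])
  finally show ?thesis by (simp add: W_def)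
qed

lemma sum_card_fibres_squared:
  assumes "finite P"
  shows "(\<Sum>x\<in>g ` P. (card {w \<in> P. g w = x})\<^sup>2) = card {(v, w) \<in> P \<times> P. g v = g w}"
proof -
  have "{(v, w) \<in> P \<times> P. g v = g w} = (\<Union>x\<in>g ` P. {w \<in> P. g w = x} \<times> {w \<in> P. g w = x})" by auto
  also have "card \<dots> = (\<Sum>x\<in>g ` P. card ({w \<in> P. g w = x} \<times> {w \<in> P. g w = x}))"
    using assms by (intro card_UN_disjoint) auto
  finally show ?thesis by (simp add: card_cartesian_product power2_eq_square)
qed

text \<open>
  The Cauchy--Schwarz inequality for the sizes of the fibres over \<open>Z\<close>.
\<close>
lemma card_preimage_le_sqrt:
  assumes fin: "finite P" "finite Z"
  shows "real (card {w \<in> P. g w \<in> Z}) \<le> sqrt (real (card Z) * real (card {(v, w) \<in> P \<times> P. g v = g w}))"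
proof -
  define c where "c = (\<lambda>x. card {w \<in> P. g w = x})"
  have "{w \<in> P. g w \<in> Z} = (\<Union>x\<in>g ` P \<inter> Z. {w \<in> P. g w = x})" by auto
  also have "card \<dots> = (\<Sum>x\<in>g ` P \<inter> Z. c x)"
    unfolding c_def using fin by (intro card_UN_disjoint) auto
  finally have "(real (card {w \<in> P. g w \<in> Z}))\<^sup>2 = (\<Sum>x\<in>g ` P \<inter> Z. real (c x) * 1)\<^sup>2" by simp
  also have "\<dots> \<le> (\<Sum>x\<in>g ` P \<inter> Z. (real (c x))\<^sup>2) * (\<Sum>x\<in>g ` P \<inter> Z. 1\<^sup>2)"
    by (rule Cauchy_Schwarz_ineq_sum)
  also have "(\<Sum>x\<in>g ` P \<inter> Z. (real (c x))\<^sup>2) \<le> (\<Sum>x\<in>g ` P. (real (c x))\<^sup>2)"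
    using fin by (intro sum_mono2) auto
  also have "\<dots> = real (\<Sum>x\<in>g ` P. (c x)\<^sup>2)" by simp
  also have "(\<Sum>x\<in>g ` P. (c x)\<^sup>2) = card {(v, w) \<in> P \<times> P. g v = g w}"
    unfolding c_def by (rule sum_card_fibres_squared[OF fin(1)])
  also have "(\<Sum>x\<in>g ` P \<inter> Z. 1\<^sup>2) \<le> real (card Z)"
    using fin by (auto intro!: card_mono)
  finally have "(real (card {w \<in> P. g w \<in> Z}))\<^sup>2 \<le> real (card {(v, w) \<in> P \<times> P. g v = g w}) * real (card Z)"
    by (simp add: mult_left_mono mult_right_mono)
  thus ?thesis by (intro real_le_rsqrt) (simp add: mult.commute)
qed

text \<open>
  Markov's inequality for the \<open>2 * r\<close>-th moment. The lower bound on \<open>B\<close> balances the two terms of the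
  moment bound, so that only about \<open>sqrt p\<close> starting points are exceptional.
\<close>
lemma card_large_character_sums:
  fixes \<theta> :: real
  assumes p: "prime p" "p > 2" and B: "B \<ge> 1" "B < p" "real p \<le> (2 * real B) ^ (2 * r)" and r: "r \<ge> 1" and \<theta>: "\<theta> > 0"
  shows "real (card {x\<in>{0..<int p}. \<theta> * real B < \<bar>real_of_int (\<Sum>b\<in>{1..B}. Legendre (x + int b) (int p))\<bar>})
     \<le> (2 ^ r * real r ^ (2 * r) + 18 * real r) / \<theta> ^ (2 * r) * sqrt (real p)"
proof -
  define T where "T = (\<lambda>x. \<Sum>b\<in>{1..B}. Legendre (x + int b) (int p))"
  define Z where "Z = {x\<in>{0..<int p}. \<theta> * real B < \<bar>real_of_int (T x)\<bar>}"
  have "real (card Z) * (\<theta> * real B) ^ (2 * r) = (\<Sum>x\<in>Z. (\<theta> * real B) ^ (2 * r))" by simp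
  also have "\<dots> \<le> (\<Sum>x\<in>Z. real_of_int (T x) ^ (2 * r))"
  proof (intro sum_mono)
    fix x assume "x \<in> Z"
    hence "(\<theta> * real B) ^ (2 * r) \<le> \<bar>real_of_int (T x)\<bar> ^ (2 * r)"
      using \<theta> by (intro power_mono) (auto simp: Z_def)
    thus "(\<theta> * real B) ^ (2 * r) \<le> real_of_int (T x) ^ (2 * r)" by (simp add: power_mult)
  qed
  also have "\<dots> \<le> (\<Sum>x\<in>{0..<int p}. real_of_int (T x) ^ (2 * r))"
    by (intro sum_mono2) (auto simp: Z_def power_mult)
  also have "\<dots> = real_of_int (\<Sum>x\<in>{0..<int p}. T x ^ (2 * r))" by simp
  also have "\<dots> \<le> real r ^ (2 * r) * real B ^ r * real p + 18 * real r * real B ^ (2 * r) * sqrt (real p)"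
    unfolding T_def by (rule character_moment_bound[OF p B(2) r])
  also have "real p = sqrt (real p) * sqrt (real p)" by simp
  also have "real r ^ (2 * r) * real B ^ r * (sqrt (real p) * sqrt (real p)) \<le> real r ^ (2 * r) * real B ^ r * ((2 * real B) ^ r * sqrt (real p))"
  proof -
    have "sqrt (real p) \<le> sqrt (((2 * real B) ^ r)\<^sup>2)"
      using B(3) by (intro real_sqrt_le_mono) (simp only: power_mult[symmetric] mult.commute)
    hence "sqrt (real p) \<le> (2 * real B) ^ r" by (simp only: real_sqrt_abs) simp
    thus ?thesis by (intro mult_left_mono mult_right_mono) auto
  qed
  finally have *: "real (card Z) * (\<theta> * real B) ^ (2 * r)
     \<le> real r ^ (2 * r) * real B ^ r * ((2 * real B) ^ r * sqrt (real p)) + 18 * real r * real B ^ (2 * r) * sqrt (real p)"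
    by simp
  have "real r ^ (2 * r) * real B ^ r * ((2 * real B) ^ r * sqrt (real p)) = 2 ^ r * real r ^ (2 * r) * sqrt (real p) * real B ^ (2 * r)"
    unfolding power_mult_distrib[of 2 "real B"] mult_2[of r] power_add[of "real B"] by (simp only: mult_ac)
  with * have "real (card Z) * (\<theta> * real B) ^ (2 * r)
     \<le> (2 ^ r * real r ^ (2 * r) + 18 * real r) * sqrt (real p) * real B ^ (2 * r)"
    by (simp only: distrib_right) (simp only: mult_ac)
  hence "real (card Z) * \<theta> ^ (2 * r) * real B ^ (2 * r)
     \<le> (2 ^ r * real r ^ (2 * r) + 18 * real r) * sqrt (real p) * real B ^ (2 * r)"
    by (simp add: power_mult_distrib mult.assoc)
  hence "real (card Z) * \<theta> ^ (2 * r) \<le> (2 ^ r * real r ^ (2 * r) + 18 * real r) * sqrt (real p)"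
    using B(1) by (simp add: mult_le_cancel_right)
  thus ?thesis using \<theta> by (simp add: Z_def T_def field_simps)
qed

text \<open>
  At the starting points outside the small exceptional set \<open>Z\<close>, the sums of length \<open>B\<close> are at most
  \<open>\<theta> * B\<close>. The points \<open>n / a\<close> cannot hit \<open>Z\<close> often: two of them coincide only if
  \<open>a' * n = a * n'\<close> modulo \<open>p\<close>, and this is an equation between integers because \<open>A * H < p\<close>. Hence
  there are few coincidences, and the Cauchy--Schwarz inequality applies.
\<close>
lemma burgess_inequality:
  fixes \<theta> :: real
  assumes p: "prime p" "p > 2" and A: "A \<ge> 1" "A * H < p" and H: "H \<ge> 1"
    and B: "B \<ge> 1" "B < p" "real p \<le> (2 * real B) ^ (2 * r)" and r: "r \<ge> 1" and \<theta>: "\<theta> > 0"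
    and small: "(2 ^ r * real r ^ (2 * r) + 18 * real r) / \<theta> ^ (2 * r) * sqrt (real p) * (harm A)\<^sup>2 \<le> \<theta>\<^sup>2 * (real A * real H)"
  shows "\<bar>real_of_int (\<Sum>n\<in>{1..H}. Legendre (int n) (int p))\<bar> \<le> 2 * \<theta> * real H + 2 * (real A * real B)"
proof -
  define T where "T = (\<lambda>x. \<Sum>b\<in>{1..B}. Legendre (x + int b) (int p))"
  define Z where "Z = {x\<in>{0..<int p}. \<theta> * real B < \<bar>real_of_int (T x)\<bar>}"
  define S where "S = (\<Sum>n\<in>{1..H}. Legendre (int n) (int p))"
  define P where "P = {1..A} \<times> {1..H}"
  have "A * 1 \<le> A * H" using H by (intro mult_left_mono) auto
  hence Ap: "A < p" using A by linarith
  have ex: "\<exists>y. [int a * y = 1] (mod int p)" if "a \<in> {1..A}" for a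
  proof -
    have "\<not> p dvd a" using that Ap by (auto dest: dvd_imp_le)
    hence "coprime (int a) (int p)"
      using p(1) prime_imp_coprime coprime_commute by (metis coprime_int_iff)
    thus ?thesis by (rule cong_solve_coprime_int)
  qed
  define iv where "iv = (\<lambda>a. SOME y. [int a * y = 1] (mod int p))"
  have iv: "[int a * iv a = 1] (mod int p)" if "a \<in> {1..A}" for a
    using someI_ex[OF ex[OF that]] by (simp add: iv_def)
  define x where "x = (\<lambda>a n. (iv a * int n) mod int p)"
  have x: "[int a * x a n = int n] (mod int p)" if "a \<in> {1..A}" for a n
  proof -
    have "[int a * x a n = int a * (iv a * int n)] (mod int p)" unfolding x_def by (intro cong_mult) auto
    moreover have "[int a * iv a * int n = 1 * int n] (mod int p)" using iv[OF that] by (intro cong_mult) auto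
    ultimately show ?thesis by (auto intro: cong_trans simp: mult.assoc)
  qed
  have xr: "x a n \<in> {0..<int p}" for a n using p by (simp add: x_def)
  define g where "g = (\<lambda>w. x (fst w) (snd w))"
  have finP: "finite P" and cardP: "card P = A * H" by (simp_all add: P_def card_cartesian_product)
  have finZ: "finite Z" by (rule finite_subset[of _ "{0..<int p}"]) (auto simp: Z_def)
  have "{(v, w) \<in> P \<times> P. g v = g w} \<subseteq> {((a, n), (a', n')) \<in> P \<times> P. a' * n = a * n'}"
  proof
    fix z assume "z \<in> {(v, w) \<in> P \<times> P. g v = g w}"
    then obtain a n a' n' where z: "z = ((a, n), (a', n'))" and P: "(a, n) \<in> P" "(a', n') \<in> P"
      and eq: "g (a, n) = g (a', n')" by auto
    hence a: "a \<in> {1..A}" "n \<in> {1..H}" "a' \<in> {1..A}" "n' \<in> {1..H}" by (auto simp: P_def)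
    have "[int a' * int n = int a' * (int a * x a n)] (mod int p)"
      using x[OF a(1)] by (intro cong_mult) (auto simp: cong_sym)
    moreover have "[int a * (int a' * x a' n') = int a * int n'] (mod int p)"
      using x[OF a(3)] by (intro cong_mult) auto
    ultimately have "[int a' * int n = int a * int n'] (mod int p)"
      using eq by (auto simp: g_def mult.left_commute intro: cong_trans)
    hence "[a' * n = a * n'] (mod p)" by (metis cong_int_iff of_nat_mult)
    moreover have "a' * n \<le> A * H" "a * n' \<le> A * H" using a by (auto intro: mult_mono)
    hence "a' * n < p" "a * n' < p" using A(2) by linarith+
    ultimately have "a' * n = a * n'" by (rule cong_less_modulus_unique_nat)
    thus "z \<in> {((a, n), (a', n')) \<in> P \<times> P. a' * n = a * n'}" using z P by simp
  qed
  moreover have "finite {((a, n), (a', n')) \<in> P \<times> P. a' * n = a * n'}"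
    by (rule finite_subset[of _ "P \<times> P"]) (auto simp: finP)
  ultimately have "card {(v, w) \<in> P \<times> P. g v = g w} \<le> card {((a, n), (a', n')) \<in> P \<times> P. a' * n = a * n'}"
    by (intro card_mono)
  hence "real (card {(v, w) \<in> P \<times> P. g v = g w}) \<le> real (card {((a, n), (a', n')) \<in> P \<times> P. a' * n = a * n'})"
    by simp
  also have "\<dots> \<le> real A * real H * (harm A)\<^sup>2"
    unfolding P_def by (rule card_proportional_pairs_le)
  finally have energy: "real (card {(v, w) \<in> P \<times> P. g v = g w}) \<le> real A * real H * (harm A)\<^sup>2" .
  define K where "K = (2 ^ r * real r ^ (2 * r) + 18 * real r) / \<theta> ^ (2 * r)"
  have cardZ: "real (card Z) \<le> K * sqrt (real p)"
    unfolding Z_def T_def K_def by (rule card_large_character_sums[OF p B r \<theta>])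
  have "real (card {w \<in> P. g w \<in> Z}) \<le> sqrt (real (card Z) * real (card {(v, w) \<in> P \<times> P. g v = g w}))"
    by (rule card_preimage_le_sqrt[OF finP finZ])
  also have "\<dots> \<le> sqrt ((K * sqrt (real p)) * (real A * real H * (harm A)\<^sup>2))"
    using cardZ energy by (intro real_sqrt_le_mono mult_mono) (auto intro: order.trans[OF _ cardZ])
  also have "\<dots> = sqrt ((K * sqrt (real p) * (harm A)\<^sup>2) * (real A * real H))" by (simp add: mult_ac)
  also have "\<dots> \<le> sqrt ((\<theta>\<^sup>2 * (real A * real H)) * (real A * real H))"
    using small unfolding K_def by (intro real_sqrt_le_mono mult_right_mono) auto
  also have "\<dots> = sqrt ((\<theta> * (real A * real H))\<^sup>2)" by (simp add: power2_eq_square mult_ac)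
  also have "\<dots> = \<theta> * (real A * real H)" using \<theta> by (intro real_sqrt_unique) auto
  finally have exc: "real (card {w \<in> P. g w \<in> Z}) \<le> \<theta> * (real A * real H)" .
  have TB: "\<bar>real_of_int (T y)\<bar> \<le> real B" for y
  proof -
    have "\<bar>T y\<bar> \<le> (\<Sum>b\<in>{1..B}. 1)"
      unfolding T_def
    proof (intro order.trans[OF sum_abs] sum_mono)
      fix b show "\<bar>Legendre (y + int b) (int p)\<bar> \<le> 1"
        using Legendre_cases[of "y + int b" "int p"] by auto
    qed
    hence "\<bar>T y\<bar> \<le> int B" by simp
    thus ?thesis by linarith
  qed
  have "(\<Sum>w\<in>P. \<bar>real_of_int (T (g w))\<bar>) \<le> (\<Sum>w\<in>P. \<theta> * real B + (if g w \<in> Z then real B else 0))"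
  proof (intro sum_mono)
    fix w show "\<bar>real_of_int (T (g w))\<bar> \<le> \<theta> * real B + (if g w \<in> Z then real B else 0)"
    proof (cases "g w \<in> Z")
      case True
      have "0 \<le> \<theta> * real B" using \<theta> by simp
      thus ?thesis using True TB[of "g w"] by simp
    next
      case False
      moreover have "g w \<in> {0..<int p}" unfolding g_def by (rule xr)
      ultimately have "\<bar>real_of_int (T (g w))\<bar> \<le> \<theta> * real B" unfolding Z_def by force
      thus ?thesis using False by simp
    qed
  qed
  also have "\<dots> = \<theta> * real B * (real A * real H) + real B * real (card {w \<in> P. g w \<in> Z})"
    using finP by (simp add: sum.distrib cardP sum.If_cases Int_def mult_ac)
  also have "real B * real (card {w \<in> P. g w \<in> Z}) \<le> real B * (\<theta> * (real A * real H))"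
    using exc by (rule mult_left_mono) simp
  finally have main: "(\<Sum>w\<in>P. \<bar>real_of_int (T (g w))\<bar>) \<le> (real A * real B) * (2 * \<theta> * real H)"
    by (simp add: algebra_simps)
  have "int (A * B) * \<bar>S\<bar> \<le> (\<Sum>(a, n)\<in>P. \<bar>T (x a n)\<bar>) + 2 * int (A * B) * int (A * B)"
    unfolding S_def T_def P_def by (rule burgess_shift[OF p Ap x])
  hence "real_of_int (int (A * B) * \<bar>S\<bar>) \<le> real_of_int ((\<Sum>(a, n)\<in>P. \<bar>T (x a n)\<bar>) + 2 * int (A * B) * int (A * B))"
    by (simp only: of_int_le_iff)
  hence "(real A * real B) * \<bar>real_of_int S\<bar> \<le> (\<Sum>w\<in>P. \<bar>real_of_int (T (g w))\<bar>) + 2 * (real A * real B) * (real A * real B)"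
    by (simp add: case_prod_unfold g_def)
  also have "\<dots> \<le> (real A * real B) * (2 * \<theta> * real H + 2 * (real A * real B))"
    using main by (simp add: algebra_simps)
  finally show ?thesis
    using A(1) B(1) unfolding S_def by (simp add: mult_le_cancel_left_pos)
qed

text \<open>
  Take \<open>B = p powr (1 / (2 * r))\<close> with \<open>1 / (2 * r) \<le> \<eta>\<close>, and \<open>A = \<theta> * H / B\<close>. Then \<open>A * H\<close> is larger
  than \<open>sqrt p\<close> by a power of \<open>p\<close>, which absorbs the constants and the logarithms.
\<close>
theorem burgess_character_sum:
  fixes \<eta> \<delta> :: real
  assumes \<eta>: "\<eta> > 0" and \<delta>: "\<delta> > 0"
  shows "\<exists>p0. \<forall>p H. prime p \<longrightarrow> p \<ge> p0 \<longrightarrow> real p powr (1/4 + \<eta>) \<le> real H \<longrightarrow> H * H \<le> p \<longrightarrow>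
    \<bar>real_of_int (\<Sum>n\<in>{1..H}. Legendre (int n) (int p))\<bar> \<le> \<delta> * real H"
proof -
  define r where "r = nat \<lceil>1 / (2 * \<eta>)\<rceil>"
  have "1 / (2 * \<eta>) > 0" using \<eta> by simp
  hence r: "r \<ge> 1" "1 / (2 * \<eta>) \<le> real r" unfolding r_def by linarith+
  define s where "s = 1 / (2 * real r)"
  have s: "0 < s" "s \<le> \<eta>" "s \<le> 1/2" using r \<eta> by (auto simp: s_def field_simps)
  define \<theta> where "\<theta> = min (\<delta> / 4) (1 / 2)"
  have \<theta>: "\<theta> > 0" "\<theta> \<le> 1/2" "4 * \<theta> \<le> \<delta>" using \<delta> by (auto simp: \<theta>_def)
  define K where "K = (2 ^ r * real r ^ (2 * r) + 18 * real r) / \<theta> ^ (2 * r)"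
  have K: "K \<ge> 0" using \<theta> by (simp add: K_def)
  have "eventually (\<lambda>x::real. K * (1 + ln x)\<^sup>2 \<le> \<theta> ^ 3 / 2 * x powr \<eta>) at_top"
    using \<eta> \<theta> K by real_asymp
  moreover have "eventually (\<lambda>x::real. 1 / \<theta> \<le> x powr (1/4)) at_top" by real_asymp
  ultimately have "eventually (\<lambda>x::real. K * (1 + ln x)\<^sup>2 \<le> \<theta> ^ 3 / 2 * x powr \<eta> \<and> 1 / \<theta> \<le> x powr (1/4)) at_top"
    by (rule eventually_conj)
  then obtain x0 where x0: "\<And>x. x \<ge> x0 \<Longrightarrow> K * (1 + ln x)\<^sup>2 \<le> \<theta> ^ 3 / 2 * x powr \<eta> \<and> 1 / \<theta> \<le> x powr (1/4)"
    unfolding eventually_at_top_linorder by blast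
  show ?thesis
  proof (intro exI[of _ "nat \<lceil>x0\<rceil> + 3"] allI impI)
    fix p H :: nat
    assume p: "prime p" "p \<ge> nat \<lceil>x0\<rceil> + 3" and H: "real p powr (1/4 + \<eta>) \<le> real H" "H * H \<le> p"
    have p3: "p \<ge> 3" "real p \<ge> x0" using p(2) by linarith+
    note big = x0[OF p3(2)]
    \<comment> \<open>\<open>s \<le> \<eta>\<close> keeps \<open>B\<close> below \<open>p powr \<eta>\<close>, so that \<open>A\<close> is still a positive power of \<open>p\<close>.\<close>
    define B where "B = nat \<lfloor>real p powr s\<rfloor>"
    define A where "A = nat \<lfloor>\<theta> * real H / real B\<rfloor>"
    have ps1: "real p powr s \<ge> 1" using p3 s by (intro ge_one_powr_ge_zero) auto
    have "real p powr s < real B + 1" unfolding B_def by linarith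
    moreover have "B \<ge> 1" "real B \<le> real p powr s" using ps1 unfolding B_def by linarith+
    ultimately have B: "B \<ge> 1" "real B \<le> real p powr s" "real p powr s \<le> 2 * real B" by linarith+
    have "real B \<le> real p powr (1/2)"
      using B(2) s p3 by (auto intro: order.trans powr_mono)
    also have "\<dots> < real p powr 1" using p3 by (intro powr_less_mono) auto
    finally have Bp: "B < p" using p3 by simp
    have "real p = (real p powr s) powr real (2 * r)" using p3 r by (simp add: powr_powr s_def)
    also have "\<dots> = (real p powr s) ^ (2 * r)" using p3 by (intro powr_realpow) auto
    also have "\<dots> \<le> (2 * real B) ^ (2 * r)" using B by (intro power_mono) auto
    finally have pB: "real p \<le> (2 * real B) ^ (2 * r)" .
    have "1 / \<theta> * real B \<le> real p powr (1/4) * real p powr s"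
      using big B \<theta> by (intro mult_mono) auto
    also have "\<dots> = real p powr (1/4 + s)" by (simp add: powr_add)
    also have "\<dots> \<le> real p powr (1/4 + \<eta>)" using s p3 by (intro powr_mono) auto
    also note H(1)
    finally have HB: "1 \<le> \<theta> * real H / real B" using B \<theta> by (simp add: field_simps)
    have "\<theta> * real H / real B < real A + 1" unfolding A_def by linarith
    moreover have "A \<ge> 1" "real A \<le> \<theta> * real H / real B" using HB unfolding A_def by linarith+
    ultimately have A: "A \<ge> 1" "real A \<le> \<theta> * real H / real B" "\<theta> * real H / real B \<le> 2 * real A" by linarith+
    have H1: "H \<ge> 1" using HB by (cases H) auto
    have AB: "real A * real B \<le> \<theta> * real H" using A(2) B by (simp add: field_simps)
    have "\<theta> * real H / real B \<le> (1/2) * real H / 1"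
      using \<theta> B by (intro frac_le mult_right_mono) auto
    hence "real A \<le> real H / 2" using A(2) by linarith
    hence "A < H" using H1 by linarith
    hence "A * H < H * H" using H1 by simp
    hence AH: "A * H < p" using H(2) by linarith
    have "A * 1 \<le> A * H" using H1 by (intro mult_left_mono) auto
    hence Ap: "A \<le> p" using AH by linarith
    have harm: "harm A \<le> 1 + ln (real p)"
    proof -
      have "harm A \<le> ln (real A) + 1" using A(1) euler_mascheroni_sequence_decreasing[of 1 A] by (simp add: harm_expand)
      also have "ln (real A) \<le> ln (real p)" using A(1) Ap by simp
      finally show ?thesis by simp
    qed
    have "(harm A)\<^sup>2 \<le> (1 + ln (real p))\<^sup>2"
      using harm harm_nonneg[of A, where ?'a = real] by (intro power_mono) auto
    hence "K * (harm A)\<^sup>2 \<le> K * (1 + ln (real p))\<^sup>2" using K by (intro mult_left_mono)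
    also have "\<dots> \<le> \<theta> ^ 3 / 2 * real p powr \<eta>" using big by simp
    finally have "K * (harm A)\<^sup>2 * sqrt (real p) \<le> \<theta> ^ 3 / 2 * real p powr \<eta> * sqrt (real p)"
      by (intro mult_right_mono) auto
    also have "\<dots> = \<theta>\<^sup>2 * (\<theta> / 2 * real p powr (1/2 + \<eta>))"
      by (simp add: powr_add powr_half_sqrt power2_eq_square power3_eq_cube)
    also have "\<dots> \<le> \<theta>\<^sup>2 * (real A * real H)"
    proof (intro mult_left_mono)
      have "real p powr (1/2 + \<eta>) * real B \<le> real p powr (1/2 + \<eta>) * real p powr \<eta>"
        using B(2) s p3 by (intro mult_left_mono) (auto intro: order.trans powr_mono)
      also have "\<dots> = real p powr (1/4 + \<eta>) * real p powr (1/4 + \<eta>)"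
        by (simp add: powr_add[symmetric] add.commute)
      also have "\<dots> \<le> real H * real H" using H(1) by (intro mult_mono) auto
      finally have "\<theta> / 2 * real p powr (1/2 + \<eta>) \<le> (\<theta> * real H / real B / 2) * real H"
        using B \<theta> by (simp add: field_simps)
      also have "\<dots> \<le> real A * real H" using A(3) by (intro mult_right_mono) auto
      finally show "\<theta> / 2 * real p powr (1/2 + \<eta>) \<le> real A * real H" .
    qed simp
    finally have small: "K * sqrt (real p) * (harm A)\<^sup>2 \<le> \<theta>\<^sup>2 * (real A * real H)" by (simp add: mult_ac)
    have "\<bar>real_of_int (\<Sum>n\<in>{1..H}. Legendre (int n) (int p))\<bar> \<le> 2 * \<theta> * real H + 2 * (real A * real B)"
      using p3 small unfolding K_def
      by (intro burgess_inequality[OF p(1) _ A(1) AH H1 B(1) Bp pB r(1) \<theta>(1)]) auto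
    also have "\<dots> \<le> 4 * \<theta> * real H" using AB by simp
    also have "\<dots> \<le> \<delta> * real H" using \<theta> by (intro mult_right_mono) auto
    finally show "\<bar>real_of_int (\<Sum>n\<in>{1..H}. Legendre (int n) (int p))\<bar> \<le> \<delta> * real H" .
  qed
qed

section \<open>Mertens' theorems\<close>
abbreviation \<Lambda> :: "nat \<Rightarrow> real" where "\<Lambda> \<equiv> mangoldt"

lemma card_multiples:
  fixes d n :: nat
  assumes "d > 0"
  shows "card {m \<in> {1..n}. d dvd m} = n div d"
proof -
  have "{m \<in> {1..n}. d dvd m} = (\<lambda>k. d * k) ` {1..n div d}"
  proof (intro equalityI subsetI)
    fix m assume "m \<in> {m \<in> {1..n}. d dvd m}"
    then obtain k where k: "m = d * k" "1 \<le> d * k" "d * k \<le> n" by auto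
    hence "k \<ge> 1" by (cases k) auto
    moreover have "k \<le> n div d" using k assms by (simp add: less_eq_div_iff_mult_less_eq mult.commute)
    ultimately show "m \<in> (\<lambda>k. d * k) ` {1..n div d}" using k by auto
  next
    fix m assume "m \<in> (\<lambda>k. d * k) ` {1..n div d}"
    then obtain k where k: "m = d * k" "k \<ge> 1" "k \<le> n div d" using atLeastAtMost_iff by blast
    hence "d * k \<le> n" using assms by (simp add: less_eq_div_iff_mult_less_eq mult.commute)
    thus "m \<in> {m \<in> {1..n}. d dvd m}" using k assms by auto
  qed
  moreover have "inj_on (\<lambda>k. d * k) {1..n div d}" using assms by (auto simp: inj_on_def)
  ultimately show ?thesis by (simp add: card_image)
qed

lemma ln_fact_eq_sum_mangoldt:
  assumes "n \<le> N"
  shows "ln (fact n) = (\<Sum>d\<in>{1..N}. \<Lambda> d * real (n div d))"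
proof -
  have "ln (fact n) = (\<Sum>m\<in>{1..n}. ln (real m))"
    unfolding fact_prod of_nat_prod by (rule ln_prod) auto
  also have "\<dots> = (\<Sum>m\<in>{1..n}. \<Sum>d | d dvd m. \<Lambda> d)"
    by (intro sum.cong refl) (simp add: mangoldt_sum)
  also have "\<dots> = (\<Sum>m\<in>{1..n}. \<Sum>d\<in>{1..N}. if d dvd m then \<Lambda> d else 0)"
  proof (rule sum.cong[OF refl])
    fix m assume "m \<in> {1..n}"
    hence "{d. d dvd m} = {d \<in> {1..N}. d dvd m}"
      using assms by (auto intro: Nat.gr0I dest: dvd_imp_le)
    thus "(\<Sum>d | d dvd m. \<Lambda> d) = (\<Sum>d\<in>{1..N}. if d dvd m then \<Lambda> d else 0)"
      by (simp only: sum.inter_filter finite_atLeastAtMost)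
  qed
  also have "\<dots> = (\<Sum>d\<in>{1..N}. \<Sum>m\<in>{1..n}. if d dvd m then \<Lambda> d else 0)" by (rule sum.swap)
  also have "\<dots> = (\<Sum>d\<in>{1..N}. \<Lambda> d * real (n div d))"
  proof (intro sum.cong refl)
    fix d assume "d \<in> {1..N}"
    hence "card {m \<in> {1..n}. d dvd m} = n div d" by (intro card_multiples) auto
    thus "(\<Sum>m\<in>{1..n}. if d dvd m then \<Lambda> d else 0) = \<Lambda> d * real (n div d)"
      by (simp add: sum.inter_filter[symmetric])
  qed
  finally show ?thesis .
qed

text \<open>
  Chebyshev's argument: the sum is at most the logarithm of the central binomial coefficient.
\<close>
lemma psi_double_le: "(\<Sum>d\<in>{n<..2*n}. \<Lambda> d) \<le> 2 * real n * ln 2"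
proof -
  have "(\<Sum>d\<in>{n<..2*n}. \<Lambda> d) = (\<Sum>d\<in>{n<..2*n}. \<Lambda> d * (real (2 * n div d) - 2 * real (n div d)))"
  proof (intro sum.cong refl)
    fix d assume d: "d \<in> {n<..2*n}"
    hence "2 * n div d = 1" by (intro div_nat_eqI) auto
    moreover have "n div d = 0" using d by simp
    ultimately show "\<Lambda> d = \<Lambda> d * (real (2 * n div d) - 2 * real (n div d))" by simp
  qed
  also have "\<dots> \<le> (\<Sum>d\<in>{1..2*n}. \<Lambda> d * (real (2 * n div d) - 2 * real (n div d)))"
  proof (intro sum_mono2)
    fix d
    have "2 * (n div d) \<le> 2 * n div d"
      by (cases "d = 0") (simp_all add: less_eq_div_iff_mult_less_eq)
    hence "2 * real (n div d) \<le> real (2 * n div d)" by linarith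
    thus "0 \<le> \<Lambda> d * (real (2 * n div d) - 2 * real (n div d))"
      by (intro mult_nonneg_nonneg mangoldt_nonneg) simp
  qed auto
  also have "\<dots> = ln (fact (2 * n)) - 2 * ln (fact n)"
    by (simp add: ln_fact_eq_sum_mangoldt[of _ "2 * n"] right_diff_distrib sum_subtractf sum_distrib_left mult.left_commute)
  also have "\<dots> = ln (real ((2 * n) choose n))"
  proof -
    have "real ((2 * n) choose n) = fact (2 * n) / (fact n * fact n)"
      by (subst binomial_fact) (simp_all add: mult_2)
    thus ?thesis by (simp add: ln_div ln_mult)
  qed
  also have "\<dots> \<le> ln (2 ^ (2 * n))"
  proof -
    have "(2 * n) choose n \<le> (\<Sum>k\<le>2*n. (2 * n) choose k)" by (rule member_le_sum) auto
    hence "(2 * n) choose n \<le> 2 ^ (2 * n)" by (simp only: choose_row_sum)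
    hence "real ((2 * n) choose n) \<le> real (2 ^ (2 * n))" by (simp only: of_nat_le_iff)
    thus ?thesis by (intro ln_mono) (simp_all add: zero_less_binomial)
  qed
  also have "\<dots> = 2 * real n * ln 2" by (simp add: ln_realpow)
  finally show ?thesis .
qed

lemma psi_le: "(\<Sum>d\<in>{1..n}. \<Lambda> d) \<le> 4 * real n"
proof (induction n rule: less_induct)
  case (less n)
  have ln2: "ln 2 \<le> (1::real)" using ln_2_less_1 by simp
  show ?case
  proof (cases "n = 0")
    case False
    define m where "m = n div 2"
    have m: "m < n" using False by (simp add: m_def)
    have n: "n = 2 * m \<or> n = Suc (2 * m)" unfolding m_def by presburger
    have "(\<Sum>d\<in>{1..2*m}. \<Lambda> d) = (\<Sum>d\<in>{1..m}. \<Lambda> d) + (\<Sum>d\<in>{m<..2*m}. \<Lambda> d)"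
      by (subst sum.union_disjoint[symmetric]) (auto intro!: sum.cong)
    also have "\<dots> \<le> 4 * real m + 2 * real m * ln 2" using less.IH[OF m] psi_double_le[of m] by linarith
    also have "2 * real m * ln 2 \<le> 2 * real m * 1" using ln2 by (intro mult_left_mono) auto
    finally have *: "(\<Sum>d\<in>{1..2*m}. \<Lambda> d) \<le> 6 * real m" by simp
    show ?thesis
    proof (cases "n = 2 * m")
      case True thus ?thesis using * by simp
    next
      case False
      hence n': "n = Suc (2 * m)" using n by simp
      have "\<Lambda> n \<le> ln (real n)" using n' by (intro mangoldt_le) simp
      also have "\<dots> \<le> real n - 1" using n' by (intro ln_le_minus_one) simp
      finally have "\<Lambda> n \<le> 2 * real m" using n' by simp
      thus ?thesis using * by (simp add: n')
    qed
  qed simp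
qed

text \<open>
  Compare \<open>ln (fact n)\<close>, which is \<open>n * ln n\<close> up to \<open>n\<close>, with its expansion in the von Mangoldt function.
\<close>
lemma mertens_first_upper: "n \<ge> 1 \<Longrightarrow> (\<Sum>d\<in>{1..n}. \<Lambda> d / real d) \<le> ln (real n) + 4"
  and mertens_first_lower: "n \<ge> 1 \<Longrightarrow> ln (real n) - 1 \<le> (\<Sum>d\<in>{1..n}. \<Lambda> d / real d)"
proof -
  assume n: "n \<ge> 1"
  have f: "ln (fact n) = (\<Sum>d\<in>{1..n}. \<Lambda> d * real (n div d))" by (rule ln_fact_eq_sum_mangoldt) simp
  have S: "real n * (\<Sum>d\<in>{1..n}. \<Lambda> d / real d) = (\<Sum>d\<in>{1..n}. \<Lambda> d * (real n / real d))"
    by (simp add: sum_distrib_left mult_ac)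
  have "(\<Sum>d\<in>{1..n}. \<Lambda> d * (real n / real d)) \<le> (\<Sum>d\<in>{1..n}. \<Lambda> d * (real (n div d) + 1))"
  proof (intro sum_mono mult_left_mono mangoldt_nonneg)
    fix d assume "d \<in> {1..n}"
    hence "n < (n div d + 1) * d" by (metis Suc_eq_plus1 atLeastAtMost_iff dividend_less_times_div less_eq_Suc_le mult.commute mult_Suc_right One_nat_def add.commute)
    hence "real n \<le> (real (n div d) + 1) * real d" by (metis less_imp_le of_nat_1 of_nat_add of_nat_le_iff of_nat_mult)
    thus "real n / real d \<le> real (n div d) + 1" using \<open>d \<in> {1..n}\<close> by (simp add: divide_le_eq)
  qed
  also have "\<dots> = ln (fact n) + (\<Sum>d\<in>{1..n}. \<Lambda> d)" by (simp add: f distrib_left sum.distrib)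
  also have "ln (fact n :: real) \<le> real n * ln (real n)"
  proof -
    have "(fact n :: real) \<le> real n ^ n" using fact_le_power[of n, where ?'a = real] by simp
    hence "ln (fact n :: real) \<le> ln (real n ^ n)" using n by (intro ln_mono) auto
    thus ?thesis using n by (simp add: ln_realpow)
  qed
  also have "(\<Sum>d\<in>{1..n}. \<Lambda> d) \<le> 4 * real n" by (rule psi_le)
  finally have "real n * (\<Sum>d\<in>{1..n}. \<Lambda> d / real d) \<le> real n * (ln (real n) + 4)"
    unfolding S by (simp add: algebra_simps)
  thus "(\<Sum>d\<in>{1..n}. \<Lambda> d / real d) \<le> ln (real n) + 4" using n by (simp add: mult_le_cancel_left_pos)
  have "real n * ln (real n) - real n \<le> ln (fact n)" if "n \<ge> 1" for n
    using that
  proof (induction n rule: nat_induct_at_least)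
    case (Suc n)
    have "ln (1 + 1 / real n) \<le> 1 / real n" using Suc by (intro ln_add_one_self_le_self) auto
    moreover have "ln (real (Suc n)) = ln (real n) + ln (1 + 1 / real n)"
    proof -
      have "real (Suc n) = real n * (1 + 1 / real n)" using Suc by (simp add: field_simps)
      thus ?thesis using Suc by (simp only: ln_mult_pos zero_less_divide_iff) (subst ln_mult_pos, auto simp: add_pos_nonneg)
    qed
    ultimately have "real n * ln (real (Suc n)) \<le> real n * (ln (real n) + 1 / real n)"
      by (intro mult_left_mono) auto
    also have "\<dots> = real n * ln (real n) + 1" using Suc by (simp add: field_simps)
    finally have "real n * ln (real (Suc n)) \<le> real n * ln (real n) + 1" .
    moreover have "ln (fact (Suc n)) = ln (real (Suc n)) + ln (fact n)"
      by (simp only: fact_Suc of_nat_mult) (subst ln_mult, auto)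
    ultimately show ?case using Suc.IH by (simp add: algebra_simps del: fact_Suc)
  qed simp
  hence "real n * ln (real n) - real n \<le> ln (fact n)" using n by blast
  also have "\<dots> \<le> real n * (\<Sum>d\<in>{1..n}. \<Lambda> d / real d)"
    unfolding f S by (intro sum_mono mult_left_mono mangoldt_nonneg of_nat_div_le_of_nat)
  finally have "real n * (ln (real n) - 1) \<le> real n * (\<Sum>d\<in>{1..n}. \<Lambda> d / real d)" by (simp add: algebra_simps)
  thus "ln (real n) - 1 \<le> (\<Sum>d\<in>{1..n}. \<Lambda> d / real d)" using n by (simp add: mult_le_cancel_left_pos)
qed

text \<open>
  Partial summation, as an induction on \<open>H\<close>. The term \<open>(E H - 4) / ln H\<close> in the induction is what makes
  the step work: \<open>E \<le> 4\<close> by the first theorem, so replacing \<open>ln n\<close> by \<open>ln (n + 1)\<close> in this term only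
  increases it.
\<close>
lemma mertens_second_upper:
  assumes z: "z \<ge> 2" and H: "H \<ge> z"
  shows "(\<Sum>n\<in>{z<..H}. \<Lambda> n / (real n * ln (real n))) \<le> ln (ln (real H) / ln (real z)) + 5 / ln (real z)"
proof -
  define E where "E = (\<lambda>n. (\<Sum>d\<in>{1..n}. \<Lambda> d / real d) - ln (real n))"
  have E: "E n \<le> 4" "- 1 \<le> E n" if "n \<ge> 1" for n
    using mertens_first_upper[OF that] mertens_first_lower[OF that] by (auto simp: E_def)
  have "(\<Sum>n\<in>{z<..H}. \<Lambda> n / (real n * ln (real n))) \<le> ln (ln (real H) / ln (real z)) + (E H - 4) / ln (real H) + 5 / ln (real z)"
    using H
  proof (induction H rule: dec_induct)
    case base
    have "0 \<le> (E z + 1) / ln (real z)" using E(2)[of z] z by (intro divide_nonneg_pos) auto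
    thus ?case using z by (simp add: diff_divide_distrib add_divide_distrib)
  next
    case (step n)
    define u v where "u = ln (real (Suc n))" and "v = ln (real n)"
    have n: "n \<ge> 2" using step z by simp
    have uv: "0 < v" "v < u" using n by (auto simp: u_def v_def)
    define w where "w = ln (real z)"
    have w: "w > 0" using z by (simp add: w_def)
    have "\<Lambda> (Suc n) / real (Suc n) = u - v + (E (Suc n) - E n)"
      by (simp add: E_def u_def v_def)
    hence "\<Lambda> (Suc n) / (real (Suc n) * u) = (u - v + (E (Suc n) - E n)) / u"
      by (metis divide_divide_eq_left)
    hence t: "\<Lambda> (Suc n) / (real (Suc n) * u) = (1 - v / u) + E (Suc n) / u - E n / u"
      using uv by (simp only: diff_divide_distrib add_divide_distrib) simp
    have "ln (v / u) \<le> v / u - 1" using uv by (intro ln_le_minus_one) simp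
    hence "1 - v / u \<le> ln u - ln v" using uv by (simp add: ln_div)
    moreover have "(E n - 4) / v \<le> (E n - 4) / u"
      using E(1)[of n] n uv by (intro divide_left_mono_neg) auto
    moreover have "ln (u / w) = ln u - ln w" "ln (v / w) = ln v - ln w" using uv w by (simp_all add: ln_div)
    moreover have "(\<Sum>n\<in>{z<..Suc n}. \<Lambda> n / (real n * ln (real n))) = (\<Sum>n\<in>{z<..n}. \<Lambda> n / (real n * ln (real n))) + \<Lambda> (Suc n) / (real (Suc n) * u)"
    proof -
      have "{z<..Suc n} = insert (Suc n) {z<..n}" using step by auto
      thus ?thesis by (simp add: u_def)
    qed
    ultimately show ?case using step.IH t unfolding u_def[symmetric] v_def[symmetric] w_def[symmetric]
      by (simp add: diff_divide_distrib)
  qed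
  moreover have "(E H - 4) / ln (real H) \<le> 0"
    using E(1)[of H] z H by (intro divide_nonpos_pos) auto
  ultimately show ?thesis by linarith
qed

lemma sum_prime_reciprocals_le:
  assumes z: "z \<ge> 2" and H: "H \<ge> z"
  shows "(\<Sum>q | prime q \<and> z < q \<and> q \<le> H. 1 / real q) \<le> ln (ln (real H) / ln (real z)) + 5 / ln (real z)"
proof -
  have "(\<Sum>q | prime q \<and> z < q \<and> q \<le> H. 1 / real q) = (\<Sum>q | prime q \<and> z < q \<and> q \<le> H. \<Lambda> q / (real q * ln (real q)))"
    by (intro sum.cong refl) (use z in auto)
  also have "\<dots> \<le> (\<Sum>n\<in>{z<..H}. \<Lambda> n / (real n * ln (real n)))"
    using z by (intro sum_mono2) (auto intro!: divide_nonneg_nonneg mult_nonneg_nonneg mangoldt_nonneg)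
  also note mertens_second_upper[OF z H]
  finally show ?thesis .
qed

section \<open>Completely multiplicative signs at two scales\<close>
definition sign_multiplicative :: "(nat \<Rightarrow> int) \<Rightarrow> bool" where
  "sign_multiplicative f \<longleftrightarrow> (\<forall>n>0. f n = 1 \<or> f n = -1) \<and> (\<forall>m>0. \<forall>n>0. f (m * n) = f m * f n)"

text \<open>
  Any base with \<open>ln base \<ge> 6\<close> would do: Mertens' theorem has an error of \<open>5\<close>, and the windows must have a mass of
  at least \<open>1\<close>.
\<close>
abbreviation base :: nat where "base \<equiv> 729"

definition window :: "nat \<Rightarrow> nat set" where "window i = {base ^ i<..base ^ Suc i}"

lemma finite_window [simp]: "finite (window i)" by (simp add: window_def)

lemma window_disjoint: "a \<in> window i \<Longrightarrow> a \<in> window j \<Longrightarrow> i = j"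
proof (induction i j rule: linorder_wlog)
  case (le i j)
  show ?case
  proof (rule ccontr)
    assume "i \<noteq> j"
    hence "base ^ Suc i \<le> base ^ j" using le by (intro power_increasing) auto
    thus False using le unfolding window_def by auto
  qed
qed auto

lemma window_pos: "a \<in> window i \<Longrightarrow> a > 0" by (auto simp: window_def)

lemma window_product_bounds:
  assumes "a \<in> window i" "b \<in> window j" "c \<in> window k"
  shows "base ^ (i + j + k) \<le> a * b * c" "a * b * c \<le> base ^ (i + j + k + 3)"
proof -
  have "base ^ i * base ^ j * base ^ k \<le> a * b * c" using assms by (intro mult_le_mono) (auto simp: window_def)
  thus "base ^ (i + j + k) \<le> a * b * c" by (simp add: power_add)
  have "a * b * c \<le> base ^ Suc i * base ^ Suc j * base ^ Suc k" using assms by (intro mult_le_mono) (auto simp: window_def)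
  also have "\<dots> = base ^ (i + j + k + 3)" by (simp add: power_add)
  finally show "a * b * c \<le> base ^ (i + j + k + 3)" .
qed

text \<open>
  The upper bound is \<open>ln 729 \<le> 728\<close> plus the error \<open>5\<close> of Mertens' theorem; it is crude, but independent of \<open>i\<close>.
\<close>
lemma mangoldt_mass_window:
  "1 \<le> (\<Sum>a\<in>window i. \<Lambda> a / real a)" "(\<Sum>a\<in>window i. \<Lambda> a / real a) \<le> 733"
proof -
  let ?M = "\<lambda>n. \<Sum>d\<in>{1..n}. \<Lambda> d / real d"
  have le: "base ^ i \<le> base ^ Suc i" by simp
  have "{1..base ^ Suc i} = {1..base ^ i} \<union> window i" unfolding window_def using le ivl_disj_un_two(8)[of 1 "base ^ i" "base ^ Suc i"] by fastforce
  hence split: "?M (base ^ Suc i) = ?M (base ^ i) + (\<Sum>a\<in>window i. \<Lambda> a / real a)"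
    by (simp only:) (subst sum.union_disjoint, auto simp: window_def)
  have ge1: "base ^ n \<ge> 1" for n by simp
  have ln: "ln (real (base ^ Suc i)) = ln (real (base ^ i)) + ln 729"
    by (simp add: ln_mult)
  have "exp 6 = (exp 1 :: real) ^ 6" by (simp add: exp_of_nat_mult[symmetric])
  also have "\<dots> \<le> 3 ^ 6" using exp_le by (intro power_mono) auto
  finally have "exp 6 \<le> (729::real)" by simp
  hence l: "6 \<le> ln (729::real)" by (simp add: ln_ge_iff)
  have u: "ln (729::real) \<le> 728" using ln_le_minus_one[of "729::real"] by simp
  show "1 \<le> (\<Sum>a\<in>window i. \<Lambda> a / real a)"
    using mertens_first_lower[OF ge1, of "Suc i"] mertens_first_upper[OF ge1, of i] split ln l by linarith
  show "(\<Sum>a\<in>window i. \<Lambda> a / real a) \<le> 733"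
    using mertens_first_lower[OF ge1, of i] mertens_first_upper[OF ge1, of "Suc i"] split ln u by linarith
qed

lemma harmonic_mass_window:
  "1 / 2 \<le> (\<Sum>c\<in>window k. 1 / real c)" "(\<Sum>c\<in>window k. 1 / real c) \<le> 733"
proof -
  have card: "real (card (window k)) = 728 * 729 ^ k" by (simp add: window_def of_nat_diff)
  have "(\<Sum>c\<in>window k. 1 / (729 * 729 ^ k)) \<le> (\<Sum>c\<in>window k. 1 / real c)"
  proof (intro sum_mono divide_left_mono)
    fix c assume c: "c \<in> window k"
    hence "c \<le> 729 * 729 ^ k" by (simp add: window_def)
    hence "real c \<le> real (729 * 729 ^ k)" by (simp only: of_nat_le_iff)
    thus "real c \<le> 729 * 729 ^ k" by simp
    show "0 < 729 * 729 ^ k * real c" using window_pos[OF c] by simp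
  qed auto
  moreover have "(\<Sum>c\<in>window k. 1 / (729 * 729 ^ k :: real)) = 728 / 729" using card by simp
  ultimately show "1 / 2 \<le> (\<Sum>c\<in>window k. 1 / real c)" by simp
  have "(\<Sum>c\<in>window k. 1 / real c) \<le> (\<Sum>c\<in>window k. 1 / (729 ^ k))"
  proof (intro sum_mono divide_left_mono)
    fix c assume c: "c \<in> window k"
    hence "729 ^ k \<le> c" by (simp add: window_def)
    hence "real (729 ^ k) \<le> real c" by (simp only: of_nat_le_iff)
    thus "729 ^ k \<le> real c" by simp
    show "0 < real c * 729 ^ k" using window_pos[OF c] by simp
  qed auto
  also have "\<dots> = 728" using card by simp
  finally show "(\<Sum>c\<in>window k. 1 / real c) \<le> 733" by simp
qed

text \<open>
  The weights \<open>\<Lambda> a / a\<close>, \<open>\<Lambda> b / b\<close> and \<open>1 / c\<close> multiply to \<open>\<Lambda> a * \<Lambda> b / n\<close> for \<open>n = a * b * c\<close>, and the sum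
  of \<open>\<Lambda>\<close> over the divisors of \<open>n\<close> is \<open>ln n\<close>. So a set \<open>E\<close> of density \<open>\<delta>\<close> catches at most about
  \<open>\<delta> * (ln N)\<^sup>2\<close> of the total weight of all triples. Two factors determine the windows, hence each triple is
  counted once.
\<close>
lemma window_triples_le:
  assumes R: "finite R" and inj: "inj_on (\<lambda>r. (u r, v r)) R"
    and E: "finite E" "\<And>n. n \<in> E \<Longrightarrow> 0 < n \<and> n \<le> N" and Z: "Z > 0"
    and ge: "\<And>r a b c. r \<in> R \<Longrightarrow> a \<in> window (u r) \<Longrightarrow> b \<in> window (v r) \<Longrightarrow> c \<in> window (w r) \<Longrightarrow> Z \<le> real (a * b * c)"
  shows "(\<Sum>r\<in>R. \<Sum>(a, b, c)\<in>window (u r) \<times> window (v r) \<times> window (w r).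
      \<Lambda> a / real a * (\<Lambda> b / real b * (1 / real c * (if a * b * c \<in> E then 1 else 0))))
     \<le> real (card E) * (ln (real N))\<^sup>2 / Z"
proof -
  define D where "D = (SIGMA r:R. window (u r) \<times> window (v r) \<times> window (w r))"
  define D' where "D' = {(r, a, b, c) \<in> D. a * b * c \<in> E}"
  define g where "g = (\<lambda>(r :: 'a, a, b, c :: nat). \<Lambda> a * \<Lambda> b)"
  define \<phi> where "\<phi> = (\<lambda>(r :: 'a, a, b, c). (a * b * c, a, b) :: nat \<times> nat \<times> nat)"
  have finD: "finite D" using R by (auto simp: D_def)
  have "(\<Sum>r\<in>R. \<Sum>(a, b, c)\<in>window (u r) \<times> window (v r) \<times> window (w r).
      \<Lambda> a / real a * (\<Lambda> b / real b * (1 / real c * (if a * b * c \<in> E then 1 else 0))))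
    = (\<Sum>(r, a, b, c)\<in>D. \<Lambda> a / real a * (\<Lambda> b / real b * (1 / real c * (if a * b * c \<in> E then 1 else 0))))"
    unfolding D_def using R by (subst sum.Sigma) auto
  also have "\<dots> = (\<Sum>(r, a, b, c)\<in>D'. \<Lambda> a * \<Lambda> b / real (a * b * c))"
    unfolding D'_def using finD
    by (intro sum.mono_neutral_cong_right) (auto split: if_splits)
  also have "\<dots> \<le> (\<Sum>x\<in>D'. g x / Z)"
  proof (intro sum_mono)
    fix x assume "x \<in> D'"
    then obtain r a b c where x: "x = (r, a, b, c)" "(r, a, b, c) \<in> D" by (auto simp: D'_def)
    hence "Z \<le> real (a * b * c)" using ge by (auto simp: D_def)
    thus "(case x of (r, a, b, c) \<Rightarrow> \<Lambda> a * \<Lambda> b / real (a * b * c)) \<le> g x / Z"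
      using Z unfolding x g_def prod.case
      by (intro divide_left_mono mult_nonneg_nonneg mangoldt_nonneg mult_pos_pos) (auto intro: less_le_trans)
  qed
  also have "\<dots> = (\<Sum>x\<in>D'. g x) / Z" by (simp add: sum_divide_distrib)
  also have "(\<Sum>x\<in>D'. g x) = (\<Sum>(n, a, b)\<in>\<phi> ` D'. \<Lambda> a * \<Lambda> b)"
  proof -
    have "inj_on \<phi> D'"
    proof (rule inj_onI)
      fix x x' assume xx: "x \<in> D'" "x' \<in> D'" "\<phi> x = \<phi> x'"
      obtain r a b c where x1: "x = (r, a, b, c)" by (cases x) auto
      obtain r' a' b' c' where x2: "x' = (r', a', b', c')" by (cases x') auto
      have eq: "a * b * c = a' * b' * c'" "a = a'" "b = b'" using xx(3) unfolding \<phi>_def x1 x2 prod.case prod.inject by blast+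
      have x: "x = (r, a, b, c)" "x' = (r', a, b, c')" using x1 x2 eq by simp_all
      have "a \<in> window (u r)" "b \<in> window (v r)" "a \<in> window (u r')" "b \<in> window (v r')" "r \<in> R" "r' \<in> R"
        using xx x by (auto simp: D'_def D_def)
      hence "u r = u r'" "v r = v r'" "a > 0" "b > 0" using window_disjoint window_pos by blast+
      thus "x = x'" using x eq inj \<open>r \<in> R\<close> \<open>r' \<in> R\<close> by (auto simp: inj_on_def)
    qed
    thus ?thesis by (subst sum.reindex) (auto simp: \<phi>_def g_def intro!: sum.cong)
  qed
  also have "\<dots> \<le> (\<Sum>(n, a, b)\<in>(SIGMA n:E. {a. a dvd n} \<times> {b. b dvd n}). \<Lambda> a * \<Lambda> b)"
  proof (rule sum_mono2)
    show "finite (SIGMA n:E. {a. a dvd n} \<times> {b. b dvd n})" using E by (auto intro!: finite_SigmaI)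
    show "\<phi> ` D' \<subseteq> (SIGMA n:E. {a. a dvd n} \<times> {b. b dvd n})"
      by (auto simp: \<phi>_def D'_def)
  qed (auto intro!: mult_nonneg_nonneg mangoldt_nonneg)
  also have "\<dots> = (\<Sum>n\<in>E. \<Sum>a | a dvd n. \<Sum>b | b dvd n. \<Lambda> a * \<Lambda> b)"
    using E by (subst sum.Sigma[symmetric]) (auto simp: sum.cartesian_product)
  also have "\<dots> = (\<Sum>n\<in>E. (ln (real n))\<^sup>2)"
  proof (rule sum.cong[OF refl])
    fix n assume "n \<in> E"
    hence n0: "n \<noteq> 0" using E by fastforce
    have "(\<Sum>a | a dvd n. \<Sum>b | b dvd n. \<Lambda> a * \<Lambda> b) = (\<Sum>a | a dvd n. \<Lambda> a) * (\<Sum>b | b dvd n. \<Lambda> b)"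
      by (rule sum_product[symmetric])
    also have "\<dots> = (ln (real n))\<^sup>2" using n0 by (simp add: mangoldt_sum power2_eq_square)
    finally show "(\<Sum>a | a dvd n. \<Sum>b | b dvd n. \<Lambda> a * \<Lambda> b) = (ln (real n))\<^sup>2" .
  qed
  also have "\<dots> \<le> (\<Sum>n\<in>E. (ln (real N))\<^sup>2)"
  proof (intro sum_mono power_mono)
    fix n assume "n \<in> E"
    hence n: "0 < n" "n \<le> N" using E by auto
    thus "ln (real n) \<le> ln (real N)" by simp
    show "0 \<le> ln (real n)" using n by simp
  qed
  finally show ?thesis using Z by (simp add: divide_right_mono)
qed

lemma sum_product3:
  fixes p q s :: "'a \<Rightarrow> real"
  shows "(\<Sum>(a, b, c)\<in>A \<times> B \<times> C. p a * (q b * s c)) = (\<Sum>a\<in>A. p a) * ((\<Sum>b\<in>B. q b) * (\<Sum>c\<in>C. s c))"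
proof -
  have inner: "(\<Sum>(b, c)\<in>B \<times> C. q b * s c) = (\<Sum>b\<in>B. q b) * (\<Sum>c\<in>C. s c)"
    by (simp add: sum_product sum.cartesian_product)
  have "(\<Sum>(a, b, c)\<in>A \<times> B \<times> C. p a * (q b * s c)) = (\<Sum>a\<in>A. \<Sum>y\<in>B \<times> C. p a * (case y of (b, c) \<Rightarrow> q b * s c))"
    by (subst sum.cartesian_product) (simp add: case_prod_unfold)
  thus ?thesis by (simp only: sum_distrib_left[symmetric] inner sum_distrib_right[symmetric])
qed

lemma sum_split_product:
  fixes w :: "'t \<Rightarrow> real"
  assumes bij: "bij_betw \<sigma> T (U \<times> V)" and w: "\<And>t. t \<in> T \<Longrightarrow> w t = p (fst (\<sigma> t)) * q (snd (\<sigma> t))"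
  shows "(\<Sum>t\<in>T. w t) = (\<Sum>u\<in>U. p u) * (\<Sum>v\<in>V. q v)"
proof -
  have "(\<Sum>t\<in>T. w t) = (\<Sum>t\<in>T. p (fst (\<sigma> t)) * q (snd (\<sigma> t)))" by (rule sum.cong[OF refl w])
  also have "\<dots> = (\<Sum>x\<in>U \<times> V. p (fst x) * q (snd x))" by (rule sum.reindex_bij_betw[OF bij])
  also have "\<dots> = (\<Sum>u\<in>U. \<Sum>v\<in>V. p u * q v)" by (simp add: sum.cartesian_product case_prod_unfold)
  finally show ?thesis by (simp only: sum_product)
qed

text \<open>
  The four products are the vertices of a complete graph whose edges are the six numbers, so each number
  occurs twice.
\<close>
lemma sign_product_K4:
  assumes f: "sign_multiplicative f" and pos: "a > 0" "b > 0" "c > 0" "d > 0" "e > 0" "g > 0"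
  shows "f (a * b * c) * f (a * e * d) * f (b * g * d) * f (g * e * c) = 1"
proof -
  have "f x * f x = 1" if "x > 0" for x
  proof -
    have "f x = 1 \<or> f x = -1" using f that unfolding sign_multiplicative_def by blast
    thus ?thesis by auto
  qed
  moreover have m: "f (x * y) = f x * f y" if "x > 0" "y > 0" for x y
    using f that by (auto simp: sign_multiplicative_def)
  have "f (a * b * c) * f (a * e * d) * f (b * g * d) * f (g * e * c)
     = (f a * f a) * (f b * f b) * (f c * f c) * (f d * f d) * (f e * f e) * (f g * f g)"
    using pos by (simp add: m)
  ultimately show ?thesis using pos by simp
qed

text \<open>
  Every tuple has a bad vertex. After integrating out the three edges that do not touch it, each vertex
  contributes a sum over triples. The edges \<open>c\<close> and \<open>d\<close> form a perfect matching and carry the weight \<open>1 / n\<close>,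
  the other four carry \<open>\<Lambda> n / n\<close>; so every vertex has exactly one edge that runs through all integers, and its
  products have bounded multiplicity on average.
\<close>
lemma window_tuple_bound:
  fixes i j k l m n :: nat and p1 p2 p3 p4 :: "nat \<Rightarrow> real"
  assumes p: "\<And>x. p1 x \<ge> 0" "\<And>x. p2 x \<ge> 0"
    and bad: "\<And>a b c d e g. a \<in> window i \<Longrightarrow> b \<in> window j \<Longrightarrow> c \<in> window k \<Longrightarrow> d \<in> window l \<Longrightarrow> e \<in> window m \<Longrightarrow> g \<in> window n \<Longrightarrow>
       1 \<le> p1 (a * b * c) + p2 (a * e * d) + p2 (b * g * d) + p2 (g * e * c)"
  shows "1 / 4 \<le> 733 ^ 3 * (
      (\<Sum>(a, b, c)\<in>window i \<times> window j \<times> window k. \<Lambda> a / real a * (\<Lambda> b / real b * (1 / real c * p1 (a * b * c))))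
    + (\<Sum>(a, b, c)\<in>window i \<times> window m \<times> window l. \<Lambda> a / real a * (\<Lambda> b / real b * (1 / real c * p2 (a * b * c))))
    + (\<Sum>(a, b, c)\<in>window j \<times> window n \<times> window l. \<Lambda> a / real a * (\<Lambda> b / real b * (1 / real c * p2 (a * b * c))))
    + (\<Sum>(a, b, c)\<in>window n \<times> window m \<times> window k. \<Lambda> a / real a * (\<Lambda> b / real b * (1 / real c * p2 (a * b * c)))))"
proof -
  define P where "P = (\<lambda>a. \<Lambda> a / real a)"
  define Q where "Q = (\<lambda>a. 1 / real a)"
  have P0: "P a \<ge> 0" for a by (simp add: P_def mangoldt_nonneg)
  have Q0: "Q a \<ge> 0" for a by (simp add: Q_def)
  have Ple: "(\<Sum>a\<in>window i. P a) \<le> 733" "1 \<le> (\<Sum>a\<in>window i. P a)" for i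
    unfolding P_def by (rule mangoldt_mass_window)+
  have Qle: "(\<Sum>a\<in>window i. Q a) \<le> 733" "1 / 2 \<le> (\<Sum>a\<in>window i. Q a)" for i
    unfolding Q_def by (rule harmonic_mass_window)+
  have sP: "0 \<le> (\<Sum>a\<in>window i. P a)" and sQ: "0 \<le> (\<Sum>a\<in>window i. Q a)" for i by (intro sum_nonneg P0 Q0)+
  define T where "T = (window i \<times> window j \<times> window k) \<times> (window l \<times> window m \<times> window n)"
  define wt where "wt = (\<lambda>((a, b, c), (d, e, g)). (P a * (P b * Q c)) * (Q d * (P e * P g)))"
  define v1 :: "(nat \<times> nat \<times> nat) \<times> (nat \<times> nat \<times> nat) \<Rightarrow> real" where "v1 = (\<lambda>((a, b, c), (d, e, g)). p1 (a * b * c))"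
  define v2 :: "(nat \<times> nat \<times> nat) \<times> (nat \<times> nat \<times> nat) \<Rightarrow> real" where "v2 = (\<lambda>((a, b, c), (d, e, g)). p2 (a * e * d))"
  define v3 :: "(nat \<times> nat \<times> nat) \<times> (nat \<times> nat \<times> nat) \<Rightarrow> real" where "v3 = (\<lambda>((a, b, c), (d, e, g)). p2 (b * g * d))"
  define v4 :: "(nat \<times> nat \<times> nat) \<times> (nat \<times> nat \<times> nat) \<Rightarrow> real" where "v4 = (\<lambda>((a, b, c), (d, e, g)). p2 (g * e * c))"
  define G where "G = (\<lambda>p i j k. \<Sum>(a, b, c)\<in>window i \<times> window j \<times> window k. P a * (P b * (Q c * p (a * b * c))))"
  have G0: "0 \<le> G p i j k" if "\<And>x. p x \<ge> (0::real)" for p i j k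
    unfolding G_def using that by (auto intro!: sum_nonneg mult_nonneg_nonneg P0 Q0)
  have low: "1 / 4 \<le> sum wt T"
  proof -
    have "sum wt T = ((\<Sum>(a, b, c)\<in>window i \<times> window j \<times> window k. P a * (P b * Q c))) * (\<Sum>(d, e, g)\<in>window l \<times> window m \<times> window n. Q d * (P e * P g))"
      unfolding T_def by (rule sum_split_product[where \<sigma> = id]) (auto simp: wt_def)
    also have "\<dots> = (sum P (window i) * (sum P (window j) * sum Q (window k))) * (sum Q (window l) * (sum P (window m) * sum P (window n)))"
      by (simp only: sum_product3)
    finally have eq: "sum wt T = (sum P (window i) * (sum P (window j) * sum Q (window k))) * (sum Q (window l) * (sum P (window m) * sum P (window n)))" .
    have "(1 * (1 * (1/2))) * ((1/2) * (1 * 1)) \<le> sum wt T"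
      unfolding eq by (intro mult_mono Ple Qle mult_nonneg_nonneg sP sQ) auto
    thus ?thesis by simp
  qed
  have u: "x * (y * z) * g \<le> 733 ^ 3 * g" if "x \<le> 733" "y \<le> 733" "z \<le> 733" "0 \<le> x" "0 \<le> y" "0 \<le> z" "0 \<le> g" for x y z g :: real
  proof (intro mult_right_mono that)
    have "x * (y * z) \<le> 733 * (733 * 733)" using that by (intro mult_mono mult_nonneg_nonneg) auto
    thus "x * (y * z) \<le> 733 ^ 3" by simp
  qed
  have 1: "(\<Sum>t\<in>T. wt t * v1 t) \<le> 733 ^ 3 * G p1 i j k"
  proof -
    have "(\<Sum>t\<in>T. wt t * v1 t)
      = (\<Sum>(d, e, g)\<in>window l \<times> window m \<times> window n. Q d * (P e * P g)) * G p1 i j k"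
      unfolding T_def G_def
      by (rule sum_split_product[where \<sigma> = "\<lambda>((a, b, c), (d, e, g)). ((d, e, g), (a, b, c))"])
         (auto simp: wt_def v1_def intro!: bij_betwI[where g = "\<lambda>((d, e, g), (a, b, c)). ((a, b, c), (d, e, g))"])
    thus ?thesis using u[OF Qle(1) Ple(1) Ple(1) sQ sP sP G0] p by (simp only: sum_product3)
  qed
  have 2: "(\<Sum>t\<in>T. wt t * v2 t) \<le> 733 ^ 3 * G p2 i m l"
  proof -
    have "(\<Sum>t\<in>T. wt t * v2 t)
      = (\<Sum>(c, b, g)\<in>window k \<times> window j \<times> window n. Q c * (P b * P g)) * G p2 i m l"
      unfolding T_def G_def
      by (rule sum_split_product[where \<sigma> = "\<lambda>((a, b, c), (d, e, g)). ((c, b, g), (a, e, d))"])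
         (auto simp: wt_def v2_def intro!: bij_betwI[where g = "\<lambda>((c, b, g), (a, e, d)). ((a, b, c), (d, e, g))"])
    thus ?thesis using u[OF Qle(1) Ple(1) Ple(1) sQ sP sP G0] p by (simp only: sum_product3)
  qed
  have 3: "(\<Sum>t\<in>T. wt t * v3 t) \<le> 733 ^ 3 * G p2 j n l"
  proof -
    have "(\<Sum>t\<in>T. wt t * v3 t)
      = (\<Sum>(c, a, e)\<in>window k \<times> window i \<times> window m. Q c * (P a * P e)) * G p2 j n l"
      unfolding T_def G_def
      by (rule sum_split_product[where \<sigma> = "\<lambda>((a, b, c), (d, e, g)). ((c, a, e), (b, g, d))"])
         (auto simp: wt_def v3_def intro!: bij_betwI[where g = "\<lambda>((c, a, e), (b, g, d)). ((a, b, c), (d, e, g))"])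
    thus ?thesis using u[OF Qle(1) Ple(1) Ple(1) sQ sP sP G0] p by (simp only: sum_product3)
  qed
  have 4: "(\<Sum>t\<in>T. wt t * v4 t) \<le> 733 ^ 3 * G p2 n m k"
  proof -
    have "(\<Sum>t\<in>T. wt t * v4 t)
      = (\<Sum>(d, a, b)\<in>window l \<times> window i \<times> window j. Q d * (P a * P b)) * G p2 n m k"
      unfolding T_def G_def
      by (rule sum_split_product[where \<sigma> = "\<lambda>((a, b, c), (d, e, g)). ((d, a, b), (g, e, c))"])
         (auto simp: wt_def v4_def intro!: bij_betwI[where g = "\<lambda>((d, a, b), (g, e, c)). ((a, b, c), (d, e, g))"])
    thus ?thesis using u[OF Qle(1) Ple(1) Ple(1) sQ sP sP G0] p by (simp only: sum_product3)
  qed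
  have "sum wt T \<le> (\<Sum>t\<in>T. wt t * v1 t + wt t * v2 t + wt t * v3 t + wt t * v4 t)"
  proof (intro sum_mono)
    fix t assume "t \<in> T"
    then obtain a b c d e g where t: "t = ((a, b, c), (d, e, g))"
      and *: "a \<in> window i" "b \<in> window j" "c \<in> window k" "d \<in> window l" "e \<in> window m" "g \<in> window n" by (auto simp: T_def)
    have "0 \<le> wt t" unfolding t wt_def prod.case by (intro mult_nonneg_nonneg P0 Q0)
    hence "wt t * 1 \<le> wt t * (p1 (a * b * c) + p2 (a * e * d) + p2 (b * g * d) + p2 (g * e * c))"
      by (intro mult_left_mono bad *)
    thus "wt t \<le> wt t * v1 t + wt t * v2 t + wt t * v3 t + wt t * v4 t"
      unfolding t v1_def v2_def v3_def v4_def prod.case by (simp only: distrib_left mult_1_right)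
  qed
  hence "1 / 4 \<le> 733 ^ 3 * (G p1 i j k + G p2 i m l + G p2 j n l + G p2 n m k)"
    using low 1 2 3 4 by (simp only: sum.distrib distrib_left)
  thus ?thesis unfolding G_def P_def Q_def .
qed

text \<open>
  Suppose that both exceptional sets are small: \<open>SX\<close>, where \<open>f\<close> is \<open>-1\<close> up to \<open>X\<close>, and \<open>SY\<close>, where \<open>f\<close> is
  \<open>1\<close> up to \<open>Y\<close>. The sizes of the edges, in powers of the base, are \<open>i\<close> and \<open>j\<close> for \<open>a\<close> and \<open>b\<close>, both free;
  the requirement that \<open>a * b * c\<close> is of size \<open>Y\<close> and that the other three vertices are of size \<open>X\<close> fixes the
  remaining four. As \<open>i\<close> and \<open>j\<close> vary, any two edges at a vertex vary independently, so each exceptional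
  set catches only a small part of the tuples. A tuple that avoids both contradicts \<open>sign_product_K4\<close>.
\<close>
lemma plus_values_at_lower_scale:
  fixes A :: real
  assumes A: "A \<ge> 1"
  shows "\<exists>c>0. \<forall>f X Y. sign_multiplicative f \<longrightarrow> base ^ 4 \<le> Y \<longrightarrow> Y \<le> X \<longrightarrow> ln (real X) \<le> A * ln (real Y) \<longrightarrow>
    real (card {n \<in> {1..X}. f n = -1}) \<le> c * real X \<longrightarrow> c * real Y \<le> real (card {n \<in> {1..Y}. f n = 1})"
proof -
  \<comment> \<open>With this constant the four vertices together cover at most half of the total weight;
    \<open>5824 = 8 * 728\<close> comes from \<open>ln Y \<le> 5824 * t\<close> below.\<close>
  define c where "c = 1 / (32 * 733 ^ 3 * 729 ^ 5 * A\<^sup>2 * 5824\<^sup>2)"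
  have c0: "c > 0" using A by (simp add: c_def)
  show ?thesis
  proof (intro exI[of _ c] conjI allI impI c0, rule ccontr)
    fix f :: "nat \<Rightarrow> int" and X Y :: nat
    assume f: "sign_multiplicative f" and Y: "base ^ 4 \<le> Y" "Y \<le> X" and lnX: "ln (real X) \<le> A * ln (real Y)"
      and SX: "real (card {n \<in> {1..X}. f n = -1}) \<le> c * real X"
      and "\<not> c * real Y \<le> real (card {n \<in> {1..Y}. f n = 1})"
    hence SY: "real (card {n \<in> {1..Y}. f n = 1}) \<le> c * real Y" by simp
    define SX where "SX = {n \<in> {1..X}. f n = -1}"
    define SY where "SY = {n \<in> {1..Y}. f n = 1}"
    have Y1: "Y \<ge> 1" using Y by simp
    hence X1: "X \<ge> 1" using Y by simp
    obtain x where x: "base ^ x \<le> X" "X < base ^ (x + 1)" using ex_power_ivl1[of base X] X1 by auto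
    obtain y where y: "base ^ y \<le> Y" "Y < base ^ (y + 1)" using ex_power_ivl1[of base Y] Y1 by auto
    have "base ^ y < base ^ (x + 1)" using y x Y by linarith
    hence yx: "y \<le> x" by (subst (asm) power_strict_increasing_iff) auto
    have "base ^ 4 < base ^ (y + 1)" using y Y by linarith
    hence y4: "y \<ge> 4" by (subst (asm) power_strict_increasing_iff) auto
    \<comment> \<open>With \<open>i, j < t\<close> none of the exponents below is truncated by the subtraction.\<close>
    define t where "t = y div 4"
    have t: "t \<ge> 1" "4 * t \<le> y" "y \<le> 4 * t + 3" using y4 by (auto simp: t_def)
    \<comment> \<open>The edges \<open>e\<close> and \<open>g\<close> exceed \<open>b\<close> and \<open>a\<close> by half of the gap between the two scales;
      rounding down costs one window at the vertex \<open>g * e * c\<close>.\<close>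
    define s where "s = (x - y) div 2"
    have s: "2 * s \<le> x - y" "x - y \<le> 2 * s + 1" by (auto simp: s_def)
    define R where "R = {..<t} \<times> {..<t}"
    \<comment> \<open>Three windows of exponents \<open>u\<close>, \<open>v\<close>, \<open>w\<close> have products up to \<open>base ^ (u + v + w + 3)\<close>.\<close>
    define k where "k = (\<lambda>(i, j). y - 3 - i - j)"
    define l where "l = (\<lambda>(i, j). x - 3 - i - (j + s))"
    define i where "i = (fst :: nat \<times> nat \<Rightarrow> nat)"
    define j where "j = (snd :: nat \<times> nat \<Rightarrow> nat)"
    define m where "m = (\<lambda>r. j r + s)"
    define n where "n = (\<lambda>r. i r + s)"
    note defs = i_def j_def k_def l_def m_def n_def
    have idx: "i r + j r + k r = y - 3" "i r + m r + l r = x - 3" "j r + n r + l r = x - 3"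
      "n r + m r + k r \<le> x - 3" "x - 4 \<le> n r + m r + k r" if "r \<in> R" for r
      using that t s y4 yx by (auto simp: R_def defs case_prod_unfold)
    define ZY where "ZY = real Y / 729 ^ 5"
    define ZX where "ZX = real X / 729 ^ 5"
    have Z0: "ZY > 0" "ZX > 0" using Y1 X1 by (simp_all add: ZY_def ZX_def)
    have win: "a * b * d \<le> N \<and> real N / 729 ^ 5 \<le> real (a * b * d)"
      if "a \<in> window u" "b \<in> window v" "d \<in> window w" and N: "base ^ e \<le> N" "N < base ^ (e + 1)" and e: "u + v + w \<le> e - 3" "e - 4 \<le> u + v + w" "e \<ge> 4"
      for a b d u v w N e
    proof
      have "a * b * d \<le> base ^ (u + v + w + 3)" using that by (intro window_product_bounds)
      also have "\<dots> \<le> base ^ e" using e by (intro power_increasing) auto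
      finally show "a * b * d \<le> N" using N by linarith
      have "base ^ (e - 4) \<le> base ^ (u + v + w)" using e by (intro power_increasing) auto
      also have "\<dots> \<le> a * b * d" using that by (intro window_product_bounds)
      finally have "base ^ (e - 4) * base ^ 5 \<le> a * b * d * base ^ 5" by (rule mult_le_mono1)
      moreover have "e - 4 + 5 = e + 1" using e by simp
      hence "base ^ (e - 4) * base ^ 5 = base ^ (e + 1)" by (simp only: power_add[symmetric])
      ultimately have "N \<le> a * b * d * base ^ 5" using N by linarith
      hence "real N \<le> real (a * b * d * base ^ 5)" by (simp only: of_nat_le_iff)
      thus "real N / 729 ^ 5 \<le> real (a * b * d)" by (simp add: divide_le_eq)
    qed
    have winY: "a * b * d \<le> Y \<and> ZY \<le> real (a * b * d)"
      if "r \<in> R" "a \<in> window (i r)" "b \<in> window (j r)" "d \<in> window (k r)" for r a b d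
      unfolding ZY_def using idx[OF that(1)] y4 by (intro win[OF that(2-4) y]) auto
    have winX1: "a * b * d \<le> X \<and> ZX \<le> real (a * b * d)"
      if "r \<in> R" "a \<in> window (i r)" "b \<in> window (m r)" "d \<in> window (l r)" for r a b d
      unfolding ZX_def using idx[OF that(1)] y4 yx by (intro win[OF that(2-4) x]) auto
    have winX2: "a * b * d \<le> X \<and> ZX \<le> real (a * b * d)"
      if "r \<in> R" "a \<in> window (j r)" "b \<in> window (n r)" "d \<in> window (l r)" for r a b d
      unfolding ZX_def using idx[OF that(1)] y4 yx by (intro win[OF that(2-4) x]) auto
    have winX3: "a * b * d \<le> X \<and> ZX \<le> real (a * b * d)"
      if "r \<in> R" "a \<in> window (n r)" "b \<in> window (m r)" "d \<in> window (k r)" for r a b d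
      unfolding ZX_def using idx[OF that(1)] y4 yx by (intro win[OF that(2-4) x]) auto
    define p1 where "p1 = (\<lambda>a. if a \<in> SY then 1 else 0 :: real)"
    define p2 where "p2 = (\<lambda>a. if a \<in> SX then 1 else 0 :: real)"
    define G where "G = (\<lambda>p u v w. \<Sum>(a, b, c)\<in>window u \<times> window v \<times> window w. \<Lambda> a / real a * (\<Lambda> b / real b * (1 / real c * (p (a * b * c) :: real))))"
    have each: "1 / 4 \<le> 733 ^ 3 * (G p1 (i r) (j r) (k r) + G p2 (i r) (m r) (l r) + G p2 (j r) (n r) (l r) + G p2 (n r) (m r) (k r))"
      if r: "r \<in> R" for r
      unfolding G_def
    proof (rule window_tuple_bound)
      fix a b c d e g assume *: "a \<in> window (i r)" "b \<in> window (j r)" "c \<in> window (k r)" "d \<in> window (l r)" "e \<in> window (m r)" "g \<in> window (n r)"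
      note pos = *[THEN window_pos]
      show "1 \<le> p1 (a * b * c) + p2 (a * e * d) + p2 (b * g * d) + p2 (g * e * c)"
      proof (rule ccontr)
        assume "\<not> ?thesis"
        hence no: "a * b * c \<notin> SY" "a * e * d \<notin> SX" "b * g * d \<notin> SX" "g * e * c \<notin> SX"
          by (auto simp: p1_def p2_def split: if_splits)
        have sgn: "f z = 1 \<or> f z = -1" if "z > 0" for z using f that unfolding sign_multiplicative_def by blast
        have "f (a * b * c) = -1"
          using no(1) sgn[of "a * b * c"] winY[OF r *(1,2,3)] pos by (auto simp: SY_def)
        moreover have "f (a * e * d) = 1"
          using no(2) sgn[of "a * e * d"] winX1[OF r *(1,5,4)] pos by (auto simp: SX_def)
        moreover have "f (b * g * d) = 1"
          using no(3) sgn[of "b * g * d"] winX2[OF r *(2,6,4)] pos by (auto simp: SX_def)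
        moreover have "f (g * e * c) = 1"
          using no(4) sgn[of "g * e * c"] winX3[OF r *(6,5,3)] pos by (auto simp: SX_def)
        ultimately show False using sign_product_K4[OF f pos(1,2,3,4,5,6)] by simp
      qed
    qed (auto simp: p1_def p2_def)
    have finR: "finite R" and cardR: "card R = t * t" by (simp_all add: R_def)
    have finE: "finite SX" "finite SY" by (simp_all add: SX_def SY_def)
    have boundX: "z \<in> SX \<Longrightarrow> 0 < z \<and> z \<le> X" and boundY: "z \<in> SY \<Longrightarrow> 0 < z \<and> z \<le> Y" for z
      by (auto simp: SX_def SY_def)
    have inj: "inj_on (\<lambda>r. (i r, j r)) R" "inj_on (\<lambda>r. (i r, m r)) R" "inj_on (\<lambda>r. (j r, n r)) R" "inj_on (\<lambda>r. (n r, m r)) R"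
      by (auto simp: inj_on_def defs)
    have g1: "(\<Sum>r\<in>R. G p1 (i r) (j r) (k r)) \<le> real (card SY) * (ln (real Y))\<^sup>2 / ZY"
      unfolding G_def p1_def using winY by (intro window_triples_le[OF finR inj(1) finE(2) boundY Z0(1)]) auto
    have g2: "(\<Sum>r\<in>R. G p2 (i r) (m r) (l r)) \<le> real (card SX) * (ln (real X))\<^sup>2 / ZX"
      unfolding G_def p2_def using winX1 by (intro window_triples_le[OF finR inj(2) finE(1) boundX Z0(2)]) auto
    have g3: "(\<Sum>r\<in>R. G p2 (j r) (n r) (l r)) \<le> real (card SX) * (ln (real X))\<^sup>2 / ZX"
      unfolding G_def p2_def using winX2 by (intro window_triples_le[OF finR inj(3) finE(1) boundX Z0(2)]) auto
    have g4: "(\<Sum>r\<in>R. G p2 (n r) (m r) (k r)) \<le> real (card SX) * (ln (real X))\<^sup>2 / ZX"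
      unfolding G_def p2_def using winX3 by (intro window_triples_le[OF finR inj(4) finE(1) boundX Z0(2)]) auto
    define L where "L = A\<^sup>2 * (ln (real Y))\<^sup>2"
    have lnX2: "(ln (real X))\<^sup>2 \<le> L"
      unfolding L_def power_mult_distrib[symmetric] using lnX X1 by (intro power_mono) auto
    have "1\<^sup>2 \<le> A\<^sup>2" using A by (intro power_mono) auto
    hence lnY2: "(ln (real Y))\<^sup>2 \<le> L"
      using mult_right_mono[of 1 "A\<^sup>2" "(ln (real Y))\<^sup>2"] by (simp add: L_def)
    have L0: "L \<ge> 0" by (simp add: L_def)
    have hX: "real (card SX) * (ln (real X))\<^sup>2 / ZX \<le> c * 729 ^ 5 * L"
    proof -
      have "real (card SX) * (ln (real X))\<^sup>2 \<le> (c * real X) * L"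
        using SX lnX2 c0 unfolding SX_def by (intro mult_mono) auto
      also have "\<dots> = (c * 729 ^ 5 * L) * ZX" by (simp add: ZX_def)
      finally show ?thesis using Z0 by (simp only: pos_divide_le_eq)
    qed
    have hY: "real (card SY) * (ln (real Y))\<^sup>2 / ZY \<le> c * 729 ^ 5 * L"
    proof -
      have "real (card SY) * (ln (real Y))\<^sup>2 \<le> (c * real Y) * L"
        using SY lnY2 c0 unfolding SY_def by (intro mult_mono) auto
      also have "\<dots> = (c * 729 ^ 5 * L) * ZY" by (simp add: ZY_def)
      finally show ?thesis using Z0 by (simp only: pos_divide_le_eq)
    qed
    have "(\<Sum>r\<in>R. 1 / 4) \<le> (\<Sum>r\<in>R. 733 ^ 3 * (G p1 (i r) (j r) (k r) + G p2 (i r) (m r) (l r) + G p2 (j r) (n r) (l r) + G p2 (n r) (m r) (k r)))"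
      by (intro sum_mono each)
    also have "\<dots> = 733 ^ 3 * ((\<Sum>r\<in>R. G p1 (i r) (j r) (k r)) + (\<Sum>r\<in>R. G p2 (i r) (m r) (l r))
      + (\<Sum>r\<in>R. G p2 (j r) (n r) (l r)) + (\<Sum>r\<in>R. G p2 (n r) (m r) (k r)))"
      by (simp only: sum_distrib_left[symmetric] sum.distrib)
    also have "\<dots> \<le> 733 ^ 3 * (4 * (c * 729 ^ 5 * L))"
    proof (rule mult_left_mono)
      show "(\<Sum>r\<in>R. G p1 (i r) (j r) (k r)) + (\<Sum>r\<in>R. G p2 (i r) (m r) (l r))
        + (\<Sum>r\<in>R. G p2 (j r) (n r) (l r)) + (\<Sum>r\<in>R. G p2 (n r) (m r) (k r)) \<le> 4 * (c * 729 ^ 5 * L)"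
      proof -
        have "a + b + d + e \<le> 4 * B" if "a \<le> B" "b \<le> B" "d \<le> B" "e \<le> B" for a b d e B :: real
          using that by linarith
        thus ?thesis by this (rule order.trans[OF g1 hY] order.trans[OF g2 hX] order.trans[OF g3 hX] order.trans[OF g4 hX])+
      qed
    qed simp
    finally have main: "real (t * t) / 4 \<le> 733 ^ 3 * (4 * (c * 729 ^ 5 * L))" by (simp add: cardR)
    have "ln (real Y) \<le> ln (real (base ^ (y + 1)))" using y Y1 by (simp del: of_nat_power)
    also have "\<dots> = real (y + 1) * ln 729" by (simp add: ln_mult ln_realpow algebra_simps)
    also have "\<dots> \<le> (8 * real t) * 728"
      using t ln_le_minus_one[of "729::real"] by (intro mult_mono) auto
    finally have "(ln (real Y))\<^sup>2 \<le> (5824 * real t)\<^sup>2" using Y1 by (intro power_mono) auto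
    hence "L \<le> A\<^sup>2 * (5824 * real t)\<^sup>2" unfolding L_def by (intro mult_left_mono) auto
    hence "733 ^ 3 * (4 * (c * 729 ^ 5 * L)) \<le> 733 ^ 3 * (4 * (c * 729 ^ 5 * (A\<^sup>2 * (5824 * real t)\<^sup>2)))"
      using c0 by (intro mult_left_mono) auto
    also have "\<dots> = real t * real t / 8" using A by (simp add: c_def power2_eq_square)
    finally have "real t * real t / 4 \<le> real t * real t / 8" using main by simp
    moreover have "real t * real t > 0" using t by simp
    ultimately show False by linarith
  qed
qed

section \<open>Vinogradov's argument and positive density\<close>

text \<open>
  An integer with sign \<open>-1\<close> has a prime factor with sign \<open>-1\<close>.
\<close>
lemma minus_values_le_prime_sum:
  assumes f: "sign_multiplicative f"
  shows "real (card {n \<in> {1..H}. f n = -1}) \<le> real H * (\<Sum>q | prime q \<and> f q = -1 \<and> q \<le> H. 1 / real q)"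
proof -
  define Q where "Q = {q. prime q \<and> f q = -1 \<and> q \<le> H}"
  have finQ: "finite Q" by (rule finite_subset[of _ "{..H}"]) (auto simp: Q_def)
  have mult: "f (m * n) = f m * f n" if "m > 0" "n > 0" for m n
    using f that unfolding sign_multiplicative_def by blast
  have sgn: "f n = 1 \<or> f n = -1" if "n > 0" for n
    using f that unfolding sign_multiplicative_def by blast
  have ex: "\<exists>q. prime q \<and> q dvd n \<and> f q = -1" if "n > 0" "f n = -1" for n
    using that
  proof (induction n rule: less_induct)
    case (less n)
    have "f 1 = f 1 * f 1" using mult[of 1 1] by simp
    hence "f 1 = 1" using sgn[of 1] by auto
    hence "n \<noteq> 1" using less.prems by auto
    then obtain q where q: "prime q" "q dvd n" using prime_factor_nat by blast
    then obtain k where k: "n = q * k" by (elim dvdE)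
    have k0: "k > 0" using k less.prems by (intro Nat.gr0I) auto
    have q1: "q > 1" using q prime_gt_1_nat by blast
    show ?case
    proof (cases "f q = -1")
      case False
      hence "f q = 1" using sgn[of q] q1 by auto
      hence "f k = -1" using mult[of q k] k k0 q1 less.prems by simp
      moreover have "k < n" using k k0 q1 by simp
      ultimately obtain q' where "prime q'" "q' dvd k" "f q' = -1" using less.IH k0 by blast
      thus ?thesis using k by auto
    qed (use q in blast)
  qed
  have "{n \<in> {1..H}. f n = -1} \<subseteq> (\<Union>q\<in>Q. {n \<in> {1..H}. q dvd n})"
  proof
    fix n assume n: "n \<in> {n \<in> {1..H}. f n = -1}"
    then obtain q where q: "prime q" "q dvd n" "f q = -1" using ex[of n] by auto
    moreover have "q \<le> H" using q n dvd_imp_le[of q n] by auto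
    ultimately show "n \<in> (\<Union>q\<in>Q. {n \<in> {1..H}. q dvd n})" using n by (auto simp: Q_def)
  qed
  hence "card {n \<in> {1..H}. f n = -1} \<le> card (\<Union>q\<in>Q. {n \<in> {1..H}. q dvd n})"
    using finQ by (intro card_mono) auto
  also have "\<dots> \<le> (\<Sum>q\<in>Q. card {n \<in> {1..H}. q dvd n})" using finQ by (rule card_UN_le)
  also have "\<dots> = (\<Sum>q\<in>Q. H div q)"
    by (intro sum.cong refl card_multiples) (auto simp: Q_def prime_gt_0_nat)
  finally have "real (card {n \<in> {1..H}. f n = -1}) \<le> (\<Sum>q\<in>Q. real (H div q))" by (simp only: of_nat_le_iff of_nat_sum[symmetric])
  also have "\<dots> \<le> (\<Sum>q\<in>Q. real H * (1 / real q))"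
    by (intro sum_mono) (use of_nat_div_le_of_nat[of H] in simp)
  finally show ?thesis by (simp add: Q_def sum_distrib_left)
qed

lemma prime_divisor_second_moment:
  assumes Q: "finite Q" "\<And>q. q \<in> Q \<Longrightarrow> prime q"
  shows "(\<Sum>n\<in>{1..X}. (real (card {q \<in> Q. q dvd n}))\<^sup>2) \<le> real X * ((\<Sum>q\<in>Q. 1 / real q)\<^sup>2 + (\<Sum>q\<in>Q. 1 / real q))"
proof -
  define I where "I = (\<lambda>q n :: nat. if q dvd n then 1 else 0 :: real)"
  have card: "real (card {q \<in> Q. q dvd n}) = (\<Sum>q\<in>Q. I q n)" for n
    using Q(1) by (simp add: I_def sum.If_cases Int_def)
  have pair: "(\<Sum>n\<in>{1..X}. I q n * I q' n) \<le> real X * (1 / real q * (1 / real q') + (if q = q' then 1 / real q else 0))"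
    if q: "q \<in> Q" "q' \<in> Q" for q q'
  proof -
    have pos: "q > 0" "q' > 0" using Q(2) q prime_gt_0_nat by blast+
    define m where "m = (if q = q' then q else q * q')"
    have m0: "m > 0" using pos by (simp add: m_def)
    have iff: "q dvd n \<and> q' dvd n \<longleftrightarrow> m dvd n" for n
    proof (cases "q = q'")
      case False
      hence "coprime q q'" using Q(2) q primes_coprime by blast
      thus ?thesis using False by (auto simp: m_def intro: divides_mult dvd_mult_left dvd_mult_right)
    qed (simp add: m_def)
    have "(\<Sum>n\<in>{1..X}. I q n * I q' n) = (\<Sum>n\<in>{1..X}. if m dvd n then 1 else 0)"
      using iff by (intro sum.cong refl) (auto simp: I_def)
    also have "\<dots> = real (card {n \<in> {1..X}. m dvd n})" by (simp add: sum.If_cases Int_def)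
    also have "\<dots> = real (X div m)" using card_multiples[OF m0, of X] by simp
    also have "\<dots> \<le> real X / real m" by (rule of_nat_div_le_of_nat)
    also have "\<dots> \<le> real X * (1 / real q * (1 / real q') + (if q = q' then 1 / real q else 0))"
      using pos by (auto simp: m_def field_simps)
    finally show ?thesis .
  qed
  have "(\<Sum>n\<in>{1..X}. (real (card {q \<in> Q. q dvd n}))\<^sup>2) = (\<Sum>n\<in>{1..X}. \<Sum>q\<in>Q. \<Sum>q'\<in>Q. I q n * I q' n)"
    by (simp only: card power2_eq_square sum_product)
  also have "\<dots> = (\<Sum>q\<in>Q. \<Sum>n\<in>{1..X}. \<Sum>q'\<in>Q. I q n * I q' n)" by (rule sum.swap)
  also have "\<dots> = (\<Sum>q\<in>Q. \<Sum>q'\<in>Q. \<Sum>n\<in>{1..X}. I q n * I q' n)" by (rule sum.cong[OF refl sum.swap])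
  also have "\<dots> \<le> (\<Sum>q\<in>Q. \<Sum>q'\<in>Q. real X * (1 / real q * (1 / real q') + (if q = q' then 1 / real q else 0)))"
    by (intro sum_mono pair)
  also have "\<dots> = real X * (\<Sum>q\<in>Q. \<Sum>q'\<in>Q. 1 / real q * (1 / real q') + (if q = q' then 1 / real q else 0))"
    by (simp only: sum_distrib_left)
  also have "(\<Sum>q\<in>Q. \<Sum>q'\<in>Q. 1 / real q * (1 / real q') + (if q = q' then 1 / real q else 0))
    = (\<Sum>q\<in>Q. 1 / real q)\<^sup>2 + (\<Sum>q\<in>Q. 1 / real q)"
    using Q(1) by (simp only: sum.distrib power2_eq_square sum_product) simp
  finally show ?thesis .
qed

text \<open>
  If \<open>f m = 1\<close> and \<open>q \<in> Q\<close> then \<open>f (q * m) = -1\<close>. There are at least \<open>c * X\<close> times the sum of \<open>1 / q\<close> such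
  products; each value \<open>n\<close> arises at most once for every prime in \<open>Q\<close> that divides it, and the Cauchy--Schwarz inequality
  with the second moment of this number bounds the loss.
\<close>
lemma minus_values_lower_bound:
  assumes f: "sign_multiplicative f" and Q: "finite Q" "\<And>q. q \<in> Q \<Longrightarrow> prime q \<and> f q = -1"
    and c: "c \<ge> 0" and plus: "\<And>q. q \<in> Q \<Longrightarrow> c * real X / real q \<le> real (card {n \<in> {1..X div q}. f n = 1})"
    and \<kappa>: "0 < \<kappa>" "\<kappa> \<le> (\<Sum>q\<in>Q. 1 / real q)"
  shows "c\<^sup>2 * (\<kappa> / (\<kappa> + 1)) * real X \<le> real (card {n \<in> {1..X}. f n = -1})"
proof (cases "X = 0")
  case False
  define S where "S = (\<Sum>q\<in>Q. 1 / real q)"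
  define N where "N = {n \<in> {1..X}. f n = -1}"
  define \<omega> where "\<omega> = (\<lambda>n. real (card {q \<in> Q. q dvd n}))"
  have S: "0 < S" "\<kappa> \<le> S" using \<kappa> by (simp_all add: S_def)
  have finN: "finite N" by (simp add: N_def)
  have mult: "f (m * n) = f m * f n" if "m > 0" "n > 0" for m n
    using f that unfolding sign_multiplicative_def by blast
  have "c * real X * S = (\<Sum>q\<in>Q. c * real X / real q)" by (simp add: S_def sum_distrib_left)
  also have "\<dots> \<le> (\<Sum>q\<in>Q. real (card {n \<in> N. q dvd n}))"
  proof (intro sum_mono)
    fix q assume q: "q \<in> Q"
    hence q0: "q > 0" using Q prime_gt_0_nat by blast
    have "card {n \<in> {1..X div q}. f n = 1} \<le> card {n \<in> N. q dvd n}"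
    proof (rule card_inj_on_le[where f = "\<lambda>m. q * m"])
      show "inj_on (\<lambda>m. q * m) {n \<in> {1..X div q}. f n = 1}" using q0 by (auto simp: inj_on_def)
      show "(\<lambda>m. q * m) ` {n \<in> {1..X div q}. f n = 1} \<subseteq> {n \<in> N. q dvd n}"
      proof (rule image_subsetI)
        fix m assume m: "m \<in> {n \<in> {1..X div q}. f n = 1}"
        hence "m * q \<le> X" using q0 by (simp add: less_eq_div_iff_mult_less_eq)
        thus "q * m \<in> {n \<in> N. q dvd n}"
          using m q0 mult[of q m] Q(2)[OF q] by (auto simp: N_def mult.commute Suc_le_eq)
      qed
    qed (use finN in simp)
    hence "real (card {n \<in> {1..X div q}. f n = 1}) \<le> real (card {n \<in> N. q dvd n})" by simp
    with plus[OF q] show "c * real X / real q \<le> real (card {n \<in> N. q dvd n})" by linarith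
  qed
  also have "\<dots> = (\<Sum>q\<in>Q. \<Sum>n\<in>N. if q dvd n then 1 else 0)"
    using finN by (intro sum.cong refl) (simp add: sum.If_cases Int_def)
  also have "\<dots> = (\<Sum>n\<in>N. \<Sum>q\<in>Q. if q dvd n then 1 else 0)" by (rule sum.swap)
  also have "\<dots> = (\<Sum>n\<in>N. \<omega> n * 1)"
    using Q(1) by (intro sum.cong refl) (simp add: \<omega>_def sum.If_cases Int_def)
  finally have "(c * real X * S)\<^sup>2 \<le> (\<Sum>n\<in>N. \<omega> n * 1)\<^sup>2"
    using c S by (intro power_mono) auto
  also have "\<dots> \<le> (\<Sum>n\<in>N. (\<omega> n)\<^sup>2) * (\<Sum>n\<in>N. 1\<^sup>2)" by (rule Cauchy_Schwarz_ineq_sum)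
  also have "(\<Sum>n\<in>N. (\<omega> n)\<^sup>2) \<le> (\<Sum>n\<in>{1..X}. (\<omega> n)\<^sup>2)" by (intro sum_mono2) (auto simp: N_def)
  also have "(\<Sum>n\<in>{1..X}. (\<omega> n)\<^sup>2) \<le> real X * (S\<^sup>2 + S)"
    unfolding \<omega>_def S_def using Q by (intro prime_divisor_second_moment) auto
  finally have "(c * real X * S)\<^sup>2 \<le> real X * (S\<^sup>2 + S) * real (card N)"
    by (simp add: mult_right_mono)
  hence "(real X * S) * (c\<^sup>2 * real X * S) \<le> (real X * S) * ((S + 1) * real (card N))"
    by (simp add: power2_eq_square algebra_simps)
  hence "c\<^sup>2 * real X * S \<le> (S + 1) * real (card N)"
    using S False by (simp only: mult_le_cancel_left_pos mult_pos_pos of_nat_0_less_iff neq0_conv)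
  hence "c\<^sup>2 * real X * (S / (S + 1)) \<le> real (card N)" using S by (simp add: field_simps)
  moreover have "\<kappa> / (\<kappa> + 1) \<le> S / (S + 1)" using S \<kappa> by (simp add: field_simps)
  hence "c\<^sup>2 * real X * (\<kappa> / (\<kappa> + 1)) \<le> c\<^sup>2 * real X * (S / (S + 1))" by (intro mult_left_mono) auto
  ultimately show ?thesis unfolding N_def by (simp add: mult_ac)
qed auto

text \<open>
  Choose \<open>\<theta>'\<close> strictly between \<open>1 / sqrt (exp 1)\<close> and \<open>\<theta>\<close>. The primes between \<open>z = H powr \<theta>'\<close> and \<open>H\<close> account
  for at most \<open>1 / 2 - \<kappa>\<close> of \<open>{1..H}\<close>, so the primes up to \<open>z\<close> with sign \<open>-1\<close> have a reciprocal sum of at least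
  \<open>\<kappa> / 2\<close>. For these primes \<open>X / q\<close> is at least a fixed power of \<open>X\<close>, because \<open>\<theta>' < \<theta>\<close>, and this is the
  range in which \<open>plus_values_at_lower_scale\<close> applies.
\<close>
theorem positive_proportion_of_minus_values:
  fixes \<theta> :: real
  assumes \<theta>: "\<theta> > 1 / sqrt (exp 1)"
  shows "\<exists>c \<delta> H0. c > 0 \<and> \<delta> > 0 \<and> (\<forall>f H X. sign_multiplicative f \<longrightarrow> H \<ge> H0 \<longrightarrow>
     (1 - \<delta>) / 2 * real H \<le> real (card {n \<in> {1..H}. f n = -1}) \<longrightarrow> real H powr \<theta> \<le> real X \<longrightarrow>
     c * real X \<le> real (card {n \<in> {1..X}. f n = -1}))"
proof -
  define e where "e = 1 / sqrt (exp (1::real))"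
  have se: "sqrt (exp 1) = exp (1/2 :: real)" by (simp add: exp_half_le2 real_sqrt_unique power2_eq_square exp_add[symmetric] del: exp_add)
  have e: "0 < e" "e < 1" "ln e = -1/2" by (simp_all add: e_def se ln_div)
  define \<theta>1 where "\<theta>1 = min \<theta> 1"
  define \<theta>' where "\<theta>' = (e + \<theta>1) / 2"
  have th: "e < \<theta>1" "\<theta>1 \<le> 1" "\<theta>1 \<le> \<theta>" "e < \<theta>'" "\<theta>' < \<theta>1" "0 < \<theta>'" "0 < \<theta>1" "\<theta>' < 1"
    using \<theta> e unfolding \<theta>'_def \<theta>1_def e_def[symmetric] by (auto simp: min_def)
  define \<eta> where "\<eta> = 1 - \<theta>' / \<theta>1"
  have \<eta>: "0 < \<eta>" using th by (simp add: \<eta>_def)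
  define \<kappa> where "\<kappa> = (1/2 + ln \<theta>') / 2"
  have "ln e < ln \<theta>'" by (subst ln_less_cancel_iff) (use e th in auto)
  hence \<kappa>: "\<kappa> > 0" using e by (simp add: \<kappa>_def)
  have "1 \<le> max 1 (2 / \<eta>)" by simp
  then obtain c0 where c0: "c0 > 0" and lower: "\<And>f X Y. sign_multiplicative f \<Longrightarrow> base ^ 4 \<le> Y \<Longrightarrow> Y \<le> X \<Longrightarrow>
     ln (real X) \<le> max 1 (2 / \<eta>) * ln (real Y) \<Longrightarrow> real (card {n \<in> {1..X}. f n = -1}) \<le> c0 * real X \<Longrightarrow>
     c0 * real Y \<le> real (card {n \<in> {1..Y}. f n = 1})"
    using plus_values_at_lower_scale by blast
  have "((\<lambda>h::real. ln (ln h / (\<theta>' * ln h - ln 2)) + 5 / (\<theta>' * ln h - ln 2)) \<longlongrightarrow> ln (inverse \<theta>')) at_top"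
    using th by real_asymp
  moreover have "ln (inverse \<theta>') < 1/2 - \<kappa>" 
  proof -
    have "ln \<theta>' = 2 * \<kappa> - 1/2" by (simp add: \<kappa>_def field_simps)
    thus ?thesis using \<kappa> th by (simp add: ln_inverse)
  qed
  ultimately have "eventually (\<lambda>h. ln (ln h / (\<theta>' * ln h - ln 2)) + 5 / (\<theta>' * ln h - ln 2) < 1/2 - \<kappa>) at_top"
    by (rule order_tendstoD(2))
  moreover have "eventually (\<lambda>h::real. h powr \<theta>' \<ge> 4) at_top" using th by real_asymp
  moreover have "eventually (\<lambda>h::real. h powr (\<theta>1 * \<eta>) \<ge> 2 * 729 ^ 4) at_top" using th \<eta> by real_asymp
  ultimately have "eventually (\<lambda>h. ln (ln h / (\<theta>' * ln h - ln 2)) + 5 / (\<theta>' * ln h - ln 2) < 1/2 - \<kappa>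
     \<and> h powr \<theta>' \<ge> 4 \<and> h powr (\<theta>1 * \<eta>) \<ge> 2 * 729 ^ 4) at_top"
    by (intro eventually_conj)
  then obtain h0 where h0: "\<And>h. h \<ge> h0 \<Longrightarrow> ln (ln h / (\<theta>' * ln h - ln 2)) + 5 / (\<theta>' * ln h - ln 2) < 1/2 - \<kappa>
     \<and> h powr \<theta>' \<ge> 4 \<and> h powr (\<theta>1 * \<eta>) \<ge> 2 * 729 ^ 4"
    unfolding eventually_at_top_linorder by blast
  define c where "c = min c0 ((c0 / 2)\<^sup>2 * ((\<kappa> / 2) / (\<kappa> / 2 + 1)))"
  show ?thesis
  proof (rule exI[of _ c], rule exI[of _ \<kappa>], rule exI[of _ "nat \<lceil>h0\<rceil> + 1"], intro conjI allI impI)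
    show "c > 0" using c0 \<kappa> by (simp add: c_def)
    show "\<kappa> > 0" by (rule \<kappa>)
    fix f :: "nat \<Rightarrow> int" and H X :: nat
    assume f: "sign_multiplicative f" and H: "nat \<lceil>h0\<rceil> + 1 \<le> H"
      and half: "(1 - \<kappa>) / 2 * real H \<le> real (card {n \<in> {1..H}. f n = -1})" and X: "real H powr \<theta> \<le> real X"
    have H1: "H \<ge> 1" "real H \<ge> h0" using H by linarith+
    note big = h0[OF H1(2)]
    show "c * real X \<le> real (card {n \<in> {1..X}. f n = -1})"
    proof (cases "real (card {n \<in> {1..X}. f n = -1}) \<le> c0 * real X")
      case False
      have "c * real X \<le> c0 * real X" by (intro mult_right_mono) (auto simp: c_def)
      thus ?thesis using False by linarith
    next
      case True
      define z where "z = nat \<lfloor>real H powr \<theta>'\<rfloor>"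
      have z: "real z \<le> real H powr \<theta>'" "real H powr \<theta>' < real z + 1" unfolding z_def using big by linarith+
      have z2: "z \<ge> 2" "real H powr \<theta>' / 2 \<le> real z" using z big by linarith+
      have "real H powr \<theta>' \<le> real H powr 1" using th H1 by (intro powr_mono) auto
      hence zH: "z \<le> H" using z H1 by simp
      have lnz: "\<theta>' * ln (real H) - ln 2 \<le> ln (real z)"
      proof -
        have "ln (real H powr \<theta>' / 2) \<le> ln (real z)" using z2 H1 by (intro ln_mono) auto
        thus ?thesis using H1 by (simp add: ln_div ln_powr)
      qed
      have "ln 4 \<le> ln (real H powr \<theta>')" using big by (intro ln_mono) auto
      hence "ln 4 \<le> \<theta>' * ln (real H)" using H1 by (simp add: ln_powr)
      moreover have "ln (4::real) = 2 * ln 2" using ln_realpow[of 2 2] by simp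
      moreover have "ln (2::real) > 0" by simp
      ultimately have den: "0 < \<theta>' * ln (real H) - ln 2" by linarith
      have lnH: "ln (real H) > 0"
      proof -
        have "0 < \<theta>' * ln (real H)" using den \<open>ln 2 > 0\<close> by linarith
        thus ?thesis using th by (simp add: zero_less_mult_iff)
      qed
      define Q where "Q = {q. prime q \<and> f q = -1 \<and> q \<le> z}"
      have finQ: "finite Q" by (rule finite_subset[of _ "{..z}"]) (auto simp: Q_def)
      have "(1 - \<kappa>) / 2 * real H \<le> real H * (\<Sum>q | prime q \<and> f q = -1 \<and> q \<le> H. 1 / real q)"
        using half minus_values_le_prime_sum[OF f] by (rule order.trans)
      hence "real H * ((1 - \<kappa>) / 2) \<le> real H * (\<Sum>q | prime q \<and> f q = -1 \<and> q \<le> H. 1 / real q)" by (simp only: mult.commute)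
      hence "(1 - \<kappa>) / 2 \<le> (\<Sum>q | prime q \<and> f q = -1 \<and> q \<le> H. 1 / real q)"
        using H1 by (simp only: mult_le_cancel_left_pos of_nat_0_less_iff)
      also have "\<dots> \<le> (\<Sum>q\<in>Q \<union> {q. prime q \<and> z < q \<and> q \<le> H}. 1 / real q)"
        using finQ by (intro sum_mono2) (auto simp: Q_def)
      also have "\<dots> = (\<Sum>q\<in>Q. 1 / real q) + (\<Sum>q | prime q \<and> z < q \<and> q \<le> H. 1 / real q)"
        using finQ by (intro sum.union_disjoint) (auto simp: Q_def)
      also have "(\<Sum>q | prime q \<and> z < q \<and> q \<le> H. 1 / real q) \<le> ln (ln (real H) / ln (real z)) + 5 / ln (real z)"
        by (rule sum_prime_reciprocals_le[OF z2(1) zH])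
      also have "\<dots> \<le> ln (ln (real H) / (\<theta>' * ln (real H) - ln 2)) + 5 / (\<theta>' * ln (real H) - ln 2)"
        using lnz den lnH by (intro add_mono ln_mono divide_left_mono) (auto intro!: divide_pos_pos mult_pos_pos)
      also have "\<dots> \<le> 1/2 - \<kappa>" using big by simp
      finally have S: "\<kappa> / 2 \<le> (\<Sum>q\<in>Q. 1 / real q)" by (simp add: field_simps)
      have X1: "real H powr \<theta>1 \<le> real X"
      proof -
        have "real H powr \<theta>1 \<le> real H powr \<theta>" using th H1 by (intro powr_mono) auto
        thus ?thesis using X by linarith
      qed
      have X0: "X > 0" using X1 H1 by (intro Nat.gr0I) auto
      have zX: "real z \<le> real X powr (1 - \<eta>)"
      proof -
        have "real H powr \<theta>' = (real H powr \<theta>1) powr (1 - \<eta>)" using th by (simp add: powr_powr \<eta>_def)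
        also have "\<dots> \<le> real X powr (1 - \<eta>)" using X1 th by (intro powr_mono2) (auto simp: \<eta>_def)
        finally show ?thesis using z by linarith
      qed
      have Xeta: "2 * 729 ^ 4 \<le> real X powr \<eta>"
      proof -
        have "real H powr (\<theta>1 * \<eta>) = (real H powr \<theta>1) powr \<eta>" by (simp add: powr_powr)
        also have "\<dots> \<le> real X powr \<eta>" using X1 \<eta> by (intro powr_mono2) auto
        finally show ?thesis using big by linarith
      qed
      have plus: "(c0 / 2) * real X / real q \<le> real (card {n \<in> {1..X div q}. f n = 1})" if q: "q \<in> Q" for q
      proof -
        have q0: "q > 0" "q \<le> z" using q prime_gt_0_nat by (auto simp: Q_def)
        define Y where "Y = X div q"
        have "real X powr \<eta> * real q \<le> real X powr \<eta> * real X powr (1 - \<eta>)"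
          using q0 zX by (intro mult_left_mono) auto
        also have "\<dots> = real X" using X0 by (simp add: powr_add[symmetric])
        finally have Xq: "real X powr \<eta> \<le> real X / real q" using q0 by (simp add: pos_le_divide_eq)
        have "X < (Y + 1) * q" using q0 dividend_less_times_div[of q X] unfolding Y_def by (simp add: algebra_simps)
        hence "real X < real ((Y + 1) * q)" by (simp only: of_nat_less_iff)
        hence "real X / real q < real Y + 1" using q0 by (simp add: pos_divide_less_eq algebra_simps)
        moreover have "2 \<le> real X powr \<eta>" using Xeta by simp
        ultimately have Yl: "real X / real q \<le> 2 * real Y" using Xq by linarith
        hence Y2: "real X powr \<eta> \<le> 2 * real Y" using Xq by linarith
        have "base ^ 4 \<le> Y" using Y2 Xeta by simp
        moreover have "Y \<le> X" by (simp add: Y_def)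
        moreover have "ln (real X) \<le> max 1 (2 / \<eta>) * ln (real Y)"
        proof -
          have "real X powr (\<eta> / 2) * real X powr (\<eta> / 2) = real X powr \<eta>" by (simp add: powr_add[symmetric])
          moreover have "2 \<le> real X powr (\<eta> / 2)"
          proof (rule ccontr)
            assume "\<not> ?thesis"
            hence "real X powr (\<eta> / 2) * real X powr (\<eta> / 2) \<le> 2 * 2" by (intro mult_mono) auto
            thus False using Xeta \<open>_ = real X powr \<eta>\<close> by simp
          qed
          hence "2 * real X powr (\<eta> / 2) \<le> real X powr (\<eta> / 2) * real X powr (\<eta> / 2)" by (intro mult_right_mono) auto
          ultimately have "real X powr (\<eta> / 2) \<le> real Y" using Y2 by linarith
          hence "ln (real X powr (\<eta> / 2)) \<le> ln (real Y)" using X0 by (intro ln_mono) auto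
          hence "\<eta> / 2 * ln (real X) \<le> ln (real Y)" using X0 by (simp add: ln_powr)
          hence "ln (real X) \<le> 2 / \<eta> * ln (real Y)" using \<eta> by (simp add: field_simps)
          also have "\<dots> \<le> max 1 (2 / \<eta>) * ln (real Y)"
            using \<open>base ^ 4 \<le> Y\<close> by (intro mult_right_mono) auto
          finally show ?thesis .
        qed
        ultimately have "c0 * real Y \<le> real (card {n \<in> {1..Y}. f n = 1})" using lower[OF f] True by blast
        moreover have "(c0 / 2) * (real X / real q) \<le> (c0 / 2) * (2 * real Y)"
          using Yl c0 by (intro mult_left_mono) auto
        ultimately show ?thesis unfolding Y_def by simp
      qed
      have "(c0 / 2)\<^sup>2 * ((\<kappa> / 2) / (\<kappa> / 2 + 1)) * real X \<le> real (card {n \<in> {1..X}. f n = -1})"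
        by (rule minus_values_lower_bound[OF f finQ _ _ plus _ S]) (use c0 \<kappa> in \<open>auto simp: Q_def\<close>)
      moreover have "c * real X \<le> (c0 / 2)\<^sup>2 * ((\<kappa> / 2) / (\<kappa> / 2 + 1)) * real X"
        by (intro mult_right_mono) (auto simp: c_def)
      ultimately show ?thesis by linarith
    qed
  qed
qed

section \<open>Density of quadratic nonresidues\<close>

text \<open>
  Removing all factors \<open>p\<close> makes the quadratic character nonzero without losing multiplicativity. The two
  functions differ only at the multiples of \<open>p\<close>.
\<close>
lemma sign_multiplicative_Legendre_extension:
  assumes p: "prime p" "p > 2"
  shows "sign_multiplicative (\<lambda>n. Legendre (int (n div p ^ multiplicity p n)) (int p))"
  unfolding sign_multiplicative_def
proof (intro conjI allI impI)
  fix n :: nat assume n: "n > 0"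
  have "\<not> p dvd n div p ^ multiplicity p n"
    using p n by (intro multiplicity_decompose) auto
  hence "Legendre (int (n div p ^ multiplicity p n)) (int p) \<noteq> 0" by (simp add: Legendre_eq_0_iff)
  thus "Legendre (int (n div p ^ multiplicity p n)) (int p) = 1 \<or> Legendre (int (n div p ^ multiplicity p n)) (int p) = -1"
    using Legendre_cases[of "int (n div p ^ multiplicity p n)" "int p"] by auto
next
  fix m n :: nat assume mn: "m > 0" "n > 0"
  have "multiplicity p (m * n) = multiplicity p m + multiplicity p n"
    using p mn by (intro prime_elem_multiplicity_mult_distrib) auto
  hence "(m * n) div p ^ multiplicity p (m * n) = (m div p ^ multiplicity p m) * (n div p ^ multiplicity p n)"
    by (simp add: power_add div_mult_div_if_dvd multiplicity_dvd)
  thus "Legendre (int ((m * n) div p ^ multiplicity p (m * n))) (int p)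
    = Legendre (int (m div p ^ multiplicity p m)) (int p) * Legendre (int (n div p ^ multiplicity p n)) (int p)"
    by (simp add: Legendre_mult[OF p])
qed

text \<open>
  Here \<open>H\<close> is about \<open>p powr (1 / 4 + \<eta>)\<close>. With \<open>\<theta> = 1 / sqrt (exp 1) + \<epsilon>\<close> and small \<open>\<eta>\<close> the exponent of
  \<open>H powr \<theta>\<close> is below \<open>1 / (4 * sqrt (exp 1)) + \<epsilon>\<close>. The multiples of \<open>p\<close> have density \<open>1 / p\<close>, which is
  negligible.
\<close>
theorem positive_proportion_of_nonresidues:
  fixes \<epsilon> :: real
  assumes "\<epsilon> > 0"
  shows "\<exists>c p0. c > 0 \<and> (\<forall>p X. prime p \<longrightarrow> p \<ge> p0 \<longrightarrow> real p powr (1 / (4 * sqrt (exp 1)) + \<epsilon>) \<le> real X \<longrightarrow>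
    c * real X \<le> real (card {n \<in> {1..X}. Legendre (int n) (int p) = -1}))"
proof -
  define e where "e = 1 / sqrt (exp (1::real))"
  have "sqrt (exp 1) > (1::real)" by simp
  hence e: "0 < e" "e < 1" by (simp_all add: e_def)
  define \<epsilon>1 where "\<epsilon>1 = min \<epsilon> 1"
  have eps: "0 < \<epsilon>1" "\<epsilon>1 \<le> 1" "\<epsilon>1 \<le> \<epsilon>" using assms by (auto simp: \<epsilon>1_def)
  define \<eta> where "\<eta> = \<epsilon>1 / 8"
  have \<eta>: "0 < \<eta>" "\<eta> \<le> 1/8" using eps by (simp_all add: \<eta>_def)
  define \<theta> where "\<theta> = e + \<epsilon>1"
  have \<theta>: "\<theta> > 1 / sqrt (exp 1)" "0 < \<theta>" "\<theta> \<le> 2" using eps e by (simp_all add: \<theta>_def e_def[symmetric])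
  obtain c \<delta> H0 where c: "c > 0" "\<delta> > 0" and dense: "\<And>f H X. sign_multiplicative f \<Longrightarrow> H \<ge> H0 \<Longrightarrow>
     (1 - \<delta>) / 2 * real H \<le> real (card {n \<in> {1..H}. f n = -1}) \<Longrightarrow> real H powr \<theta> \<le> real X \<Longrightarrow>
     c * real X \<le> real (card {n \<in> {1..X}. f n = -1})"
    using positive_proportion_of_minus_values[OF \<theta>(1)] by blast
  obtain p1 where burgess: "\<And>p H. prime p \<Longrightarrow> p \<ge> p1 \<Longrightarrow> real p powr (1/4 + \<eta>) \<le> real H \<Longrightarrow> H * H \<le> p \<Longrightarrow>
    \<bar>real_of_int (\<Sum>n\<in>{1..H}. Legendre (int n) (int p))\<bar> \<le> \<delta> * real H"
    using burgess_character_sum[OF \<eta>(1) c(2)] by blast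
  have "eventually (\<lambda>x::real. 4 * x powr (3/4) \<le> x) at_top" by real_asymp
  moreover have "eventually (\<lambda>x::real. 2 powr \<theta> \<le> x powr (\<epsilon>1 / 2)) at_top" using eps by real_asymp
  moreover have "eventually (\<lambda>x::real. real H0 \<le> x powr (1/4)) at_top" by real_asymp
  ultimately have "eventually (\<lambda>x. 4 * x powr (3/4) \<le> x \<and> 2 powr \<theta> \<le> x powr (\<epsilon>1 / 2) \<and> real H0 \<le> x powr (1/4)) at_top"
    by (intro eventually_conj)
  then obtain x0 where x0: "\<And>x. x \<ge> x0 \<Longrightarrow> 4 * x powr (3/4) \<le> x \<and> 2 powr \<theta> \<le> x powr (\<epsilon>1 / 2) \<and> real H0 \<le> x powr (1/4)"
    unfolding eventually_at_top_linorder by blast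
  show ?thesis
  proof (rule exI[of _ "c / 2"], rule exI[of _ "p1 + nat \<lceil>x0\<rceil> + nat \<lceil>2 / c\<rceil> + 3"], intro conjI allI impI)
    show "c / 2 > 0" using c by simp
    fix p X :: nat
    assume p: "prime p" "p1 + nat \<lceil>x0\<rceil> + nat \<lceil>2 / c\<rceil> + 3 \<le> p" and X: "real p powr (1 / (4 * sqrt (exp 1)) + \<epsilon>) \<le> real X"
    have pp: "p > 2" "p \<ge> p1" "real p \<ge> x0" "real p \<ge> 2 / c" using p(2) by linarith+
    note big = x0[OF pp(3)]
    define H where "H = nat \<lceil>real p powr (1/4 + \<eta>)\<rceil>"
    have one: "1 \<le> real p powr (1/4 + \<eta>)" using pp \<eta> by (intro ge_one_powr_ge_zero) auto
    have H: "real p powr (1/4 + \<eta>) \<le> real H" "real H \<le> 2 * real p powr (1/4 + \<eta>)"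
      using one unfolding H_def by linarith+
    have "real H * real H \<le> (2 * real p powr (1/4 + \<eta>)) * (2 * real p powr (1/4 + \<eta>))"
      using H by (intro mult_mono) auto
    also have "\<dots> = 4 * real p powr (1/2 + 2 * \<eta>)" by (simp add: powr_add[symmetric])
    also have "\<dots> \<le> 4 * real p powr (3/4)" using pp \<eta> by (intro mult_left_mono powr_mono) auto
    also have "\<dots> \<le> real p" using big by simp
    finally have "real (H * H) \<le> real p" by simp
    hence HH: "H * H \<le> p" by (simp only: of_nat_le_iff)
    have H1: "H \<ge> 1" using H one by linarith
    have "H < p"
    proof (rule ccontr)
      assume "\<not> H < p"
      hence "p * p \<le> H * H" by (intro mult_le_mono) auto
      hence "p * p \<le> p * 1" using HH by linarith
      hence "p \<le> 1" using pp by (simp only: mult_le_cancel1)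
      thus False using pp by simp
    qed
    define f where "f = (\<lambda>n. Legendre (int (n div p ^ multiplicity p n)) (int p))"
    have f: "sign_multiplicative f" unfolding f_def by (rule sign_multiplicative_Legendre_extension[OF p(1) pp(1)])
    have f_eq: "f n = Legendre (int n) (int p)" if "\<not> p dvd n" for n
      using that by (simp add: f_def not_dvd_imp_multiplicity_0)
    have ndvd: "\<not> p dvd n" if "n \<in> {1..H}" for n
      using that \<open>H < p\<close> by (auto dest: dvd_imp_le)
    define N where "N = {n \<in> {1..H}. f n = -1}"
    have "(\<Sum>n\<in>{1..H}. Legendre (int n) (int p)) = (\<Sum>n\<in>{1..H}. 1 - 2 * (if f n = -1 then 1 else 0))"
    proof (rule sum.cong[OF refl])
      fix n assume n: "n \<in> {1..H}"
      hence "f n = 1 \<or> f n = -1" using f unfolding sign_multiplicative_def by auto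
      thus "Legendre (int n) (int p) = 1 - 2 * (if f n = -1 then 1 else 0)" using f_eq[OF ndvd[OF n]] by auto
    qed
    also have "\<dots> = int H - 2 * int (card N)"
      by (simp add: sum_subtractf sum_distrib_left[symmetric] sum.If_cases N_def Int_def)
    finally have S: "(\<Sum>n\<in>{1..H}. Legendre (int n) (int p)) = int H - 2 * int (card N)" .
    have "\<bar>real H - 2 * real (card N)\<bar> \<le> \<delta> * real H"
      using burgess[OF p(1) pp(2) H(1) HH] unfolding S by simp
    hence "(1 - \<delta>) / 2 * real H \<le> real (card N)" by (simp add: field_simps abs_le_iff)
    moreover have "H0 \<le> H"
    proof -
      have "real p powr (1/4) \<le> real p powr (1/4 + \<eta>)" using pp \<eta> by (intro powr_mono) auto
      hence "real H0 \<le> real H" using big H by linarith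
      thus ?thesis by simp
    qed
    moreover have "real H powr \<theta> \<le> real X"
    proof -
      have "real H powr \<theta> \<le> (2 * real p powr (1/4 + \<eta>)) powr \<theta>" using H \<theta> by (intro powr_mono2) auto
      also have "\<dots> = 2 powr \<theta> * real p powr ((1/4 + \<eta>) * \<theta>)" by (simp add: powr_mult powr_powr)
      also have "\<dots> \<le> real p powr (\<epsilon>1 / 2) * real p powr (e / 4 + \<epsilon>1 / 2)"
      proof (intro mult_mono powr_mono)
        have "(1/4 + \<eta>) * \<theta> = e / 4 + \<epsilon>1 / 4 + \<eta> * \<theta>" by (simp add: \<theta>_def algebra_simps)
        also have "\<eta> * \<theta> \<le> \<eta> * 2" using \<theta> \<eta> by (intro mult_left_mono) auto
        finally show "(1/4 + \<eta>) * \<theta> \<le> e / 4 + \<epsilon>1 / 2" by (simp add: \<eta>_def)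
      qed (use big pp in auto)
      also have "\<dots> = real p powr (e / 4 + \<epsilon>1)" by (simp add: powr_add[symmetric] add.commute)
      also have "\<dots> \<le> real p powr (1 / (4 * sqrt (exp 1)) + \<epsilon>)"
        using pp eps by (intro powr_mono) (auto simp: e_def)
      also note X
      finally show ?thesis .
    qed
    ultimately have main: "c * real X \<le> real (card {n \<in> {1..X}. f n = -1})"
      unfolding N_def by (intro dense[OF f])
    have "{n \<in> {1..X}. f n = -1} \<subseteq> {n \<in> {1..X}. Legendre (int n) (int p) = -1} \<union> {n \<in> {1..X}. p dvd n}"
      using f_eq by auto
    hence "card {n \<in> {1..X}. f n = -1} \<le> card ({n \<in> {1..X}. Legendre (int n) (int p) = -1} \<union> {n \<in> {1..X}. p dvd n})"
      by (intro card_mono) auto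
    also have "\<dots> \<le> card {n \<in> {1..X}. Legendre (int n) (int p) = -1} + card {n \<in> {1..X}. p dvd n}"
      by (rule card_Un_le)
    also have "card {n \<in> {1..X}. p dvd n} = X div p" using pp by (intro card_multiples) auto
    finally have "real (card {n \<in> {1..X}. f n = -1}) \<le> real (card {n \<in> {1..X}. Legendre (int n) (int p) = -1} + X div p)"
      by (simp only: of_nat_le_iff)
    moreover have "real (X div p) \<le> c / 2 * real X"
    proof -
      have "real (X div p) \<le> real X / real p" by (rule of_nat_div_le_of_nat)
      also have "\<dots> \<le> real X / (2 / c)" using pp c by (intro divide_left_mono) auto
      finally show ?thesis by (simp add: mult.commute)
    qed
    ultimately show "c / 2 * real X \<le> real (card {n \<in> {1..X}. Legendre (int n) (int p) = -1})"
      using main by (simp add: field_simps)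
  qed
qed

section \<open>Matrices with a prescribed determinant\<close>
definition mat2 :: "int \<Rightarrow> int \<Rightarrow> int \<Rightarrow> int \<Rightarrow> int ^ 2 ^ 2" where
  "mat2 a b c d = (\<chi> i j. if i = 1 then (if j = 1 then a else b) else (if j = 1 then c else d))"

definition det2 :: "int ^ 2 ^ 2 \<Rightarrow> int" where
  "det2 A = A $ 1 $ 1 * A $ 2 $ 2 - A $ 1 $ 2 * A $ 2 $ 1"

lemma mat2_entries [simp]:
  "mat2 a b c d $ 1 $ 1 = a" "mat2 a b c d $ 1 $ 2 = b" "mat2 a b c d $ 2 $ 1 = c" "mat2 a b c d $ 2 $ 2 = d"
  by (simp_all add: mat2_def)

lemma mat2_eqI:
  fixes A B :: "int ^ 2 ^ 2"
  assumes "A $ 1 $ 1 = B $ 1 $ 1" "A $ 1 $ 2 = B $ 1 $ 2" "A $ 2 $ 1 = B $ 2 $ 1" "A $ 2 $ 2 = B $ 2 $ 2"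
  shows "A = B"
  using assms by (simp add: vec_eq_iff forall_2)

lemma mult_mat2_mod_entry:
  "(A \<otimes>\<^bsub>mat2_mod p\<^esub> B) $ i $ j = (A $ i $ 1 * B $ 1 $ j + A $ i $ 2 * B $ 2 $ j) mod int p"
  by (simp add: mat2_monoid_def residue_ring_def mod_simps)

lemma det2_mult_mat2_mod: "[det2 (A \<otimes>\<^bsub>mat2_mod p\<^esub> B) = det2 A * det2 B] (mod int p)"
proof -
  let ?e = "\<lambda>i j. A $ i $ 1 * B $ 1 $ j + A $ i $ 2 * B $ 2 $ j"
  have "[det2 (A \<otimes>\<^bsub>mat2_mod p\<^esub> B) = ?e 1 1 * ?e 2 2 - ?e 1 2 * ?e 2 1] (mod int p)"
    unfolding det2_def mult_mat2_mod_entry by (intro cong_diff cong_mult) auto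
  also have "?e 1 1 * ?e 2 2 - ?e 1 2 * ?e 2 1 = det2 A * det2 B"
    by (simp add: det2_def algebra_simps)
  finally show ?thesis .
qed

lemma one_mat2_mod_entry: "\<one>\<^bsub>mat2_mod p\<^esub> $ i $ j = (if i = j then 1 else 0)"
  by (simp add: mat2_monoid_def residue_ring_def)

lemma det2_square_mat2_mod: "[det2 (B [^]\<^bsub>mat2_mod p\<^esub> (2::nat)) = (det2 B)\<^sup>2] (mod int p)"
proof -
  have "B [^]\<^bsub>mat2_mod p\<^esub> (2::nat) = (\<one>\<^bsub>mat2_mod p\<^esub> \<otimes>\<^bsub>mat2_mod p\<^esub> B) \<otimes>\<^bsub>mat2_mod p\<^esub> B"
    by (simp add: nat_pow_def numeral_2_eq_2)
  also have "[det2 \<dots> = det2 (\<one>\<^bsub>mat2_mod p\<^esub> \<otimes>\<^bsub>mat2_mod p\<^esub> B) * det2 B] (mod int p)"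
    by (rule det2_mult_mat2_mod)
  also have "[det2 (\<one>\<^bsub>mat2_mod p\<^esub> \<otimes>\<^bsub>mat2_mod p\<^esub> B) * det2 B = det2 \<one>\<^bsub>mat2_mod p\<^esub> * det2 B * det2 B] (mod int p)"
    by (intro cong_mult det2_mult_mat2_mod) auto
  also have "det2 \<one>\<^bsub>mat2_mod p\<^esub> = 1" by (simp add: det2_def one_mat2_mod_entry)
  finally show ?thesis by (simp add: power2_eq_square)
qed

lemma mod_inner_products:
  fixes m :: int
  shows "(x * (y mod m) + z * (w mod m)) mod m = (x * y + z * w) mod m"
    and "((y mod m) * x + (w mod m) * z) mod m = (y * x + w * z) mod m"
proof -
  have "(x * (y mod m) + z * (w mod m)) mod m = (x * (y mod m) mod m + z * (w mod m) mod m) mod m"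
    by (rule mod_add_eq[symmetric])
  also have "\<dots> = (x * y mod m + z * w mod m) mod m" by (simp only: mod_mult_right_eq)
  also have "\<dots> = (x * y + z * w) mod m" by (rule mod_add_eq)
  finally show *: "(x * (y mod m) + z * (w mod m)) mod m = (x * y + z * w) mod m" .
  thus "((y mod m) * x + (w mod m) * z) mod m = (y * x + w * z) mod m" by (simp only: mult.commute)
qed

lemma mult_mat2_eq_one:
  fixes A B :: "int ^ 2 ^ 2"
  assumes "(A $ 1 $ 1 * B $ 1 $ 1 + A $ 1 $ 2 * B $ 2 $ 1) mod int p = 1"
    and "(A $ 1 $ 1 * B $ 1 $ 2 + A $ 1 $ 2 * B $ 2 $ 2) mod int p = 0"
    and "(A $ 2 $ 1 * B $ 1 $ 1 + A $ 2 $ 2 * B $ 2 $ 1) mod int p = 0"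
    and "(A $ 2 $ 1 * B $ 1 $ 2 + A $ 2 $ 2 * B $ 2 $ 2) mod int p = 1"
  shows "A \<otimes>\<^bsub>mat2_mod p\<^esub> B = \<one>\<^bsub>mat2_mod p\<^esub>"
  by (rule mat2_eqI) (simp_all only: mult_mat2_mod_entry one_mat2_mod_entry assms, simp_all)

lemma mat2_in_GL2:
  assumes p: "p > 1" and range: "{a, b, c, d} \<subseteq> {0..<int p}" and u: "[(a * d - b * c) * u = 1] (mod int p)"
  shows "mat2 a b c d \<in> GL2 p"
proof -
  define A where "A = mat2 a b c d"
  define B where "B = mat2 ((u * d) mod int p) ((- u * b) mod int p) ((- u * c) mod int p) ((u * a) mod int p)"
  have carrier: "C \<in> carrier (mat2_mod p) \<longleftrightarrow> (\<forall>i j. C $ i $ j \<in> {0..<int p})" for C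
    by (auto simp: mat2_monoid_def residue_ring_def)
  have A: "A \<in> carrier (mat2_mod p)" using range by (simp add: carrier A_def forall_2)
  have B: "B \<in> carrier (mat2_mod p)" using p by (simp add: carrier B_def forall_2)
  have "1 mod int p = 1" using p by (intro mod_pos_pos_trivial) auto
  with u[unfolded unique_euclidean_semiring_class.cong_def]
  have one: "((a * d - b * c) * u) mod int p = 1" by (rule trans)
  have "(a * (u * d) + b * (- u * c)) mod int p = 1" "(a * (- u * b) + b * (u * a)) mod int p = 0"
    "(c * (u * d) + d * (- u * c)) mod int p = 0" "(c * (- u * b) + d * (u * a)) mod int p = 1"
    using one by (simp_all add: algebra_simps)
  hence AB: "A \<otimes>\<^bsub>mat2_mod p\<^esub> B = \<one>\<^bsub>mat2_mod p\<^esub>"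
    by (intro mult_mat2_eq_one) (simp_all only: A_def B_def mat2_entries mod_inner_products)
  have "(u * d * a + - u * b * c) mod int p = 1" "(u * d * b + - u * b * d) mod int p = 0"
    "(- u * c * a + u * a * c) mod int p = 0" "(- u * c * b + u * a * d) mod int p = 1"
    using one by (simp_all add: algebra_simps)
  hence "B \<otimes>\<^bsub>mat2_mod p\<^esub> A = \<one>\<^bsub>mat2_mod p\<^esub>"
    by (intro mult_mat2_eq_one) (simp_all only: A_def B_def mat2_entries mod_inner_products)
  thus ?thesis using A B AB unfolding GL2_def Units_def A_def by blast
qed

text \<open>
  The determinant of a square is a square modulo \<open>p\<close>.
\<close>
lemma mat2_in_nonsquare_GL2:
  assumes p: "prime p" and range: "{a, b, c, d} \<subseteq> {0..<int p}"
    and L: "Legendre (a * d - b * c) (int p) = -1"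
  shows "mat2 a b c d \<in> nonsquare_GL2 p"
proof -
  have "\<not> [a * d - b * c = 0] (mod int p)" using L by (auto simp: Legendre_def)
  hence "\<not> int p dvd a * d - b * c" by (simp add: cong_0_iff)
  hence "coprime (a * d - b * c) (int p)" using p by (simp add: coprime_commute prime_imp_coprime)
  then obtain u where "[(a * d - b * c) * u = 1] (mod int p)" using cong_solve_coprime_int by blast
  hence "mat2 a b c d \<in> GL2 p" using mat2_in_GL2 range prime_gt_1_nat[OF p] by blast
  moreover have "mat2 a b c d \<noteq> B [^]\<^bsub>mat2_mod p\<^esub> (2::nat)" for B
  proof
    assume "mat2 a b c d = B [^]\<^bsub>mat2_mod p\<^esub> (2::nat)"
    hence "[a * d - b * c = (det2 B)\<^sup>2] (mod int p)"
      using det2_square_mat2_mod[of p B] by (metis det2_def mat2_entries)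
    hence "QuadRes (int p) (a * d - b * c)" unfolding QuadRes_def using cong_sym by blast
    thus False using L by (auto simp: Legendre_def split: if_splits)
  qed
  ultimately show ?thesis by (simp add: nonsquare_GL2_def)
qed

text \<open>
  The prime \<open>2\<close> contributes \<open>1 / 4\<close>. For odd \<open>q = 2 * k + 1\<close> the term is at most \<open>1 / (4 * k * (k + 1))\<close>, and
  these sum up to at most \<open>1 / 4\<close>.
\<close>
lemma sum_prime_reciprocal_squares_le: "(\<Sum>q | prime q \<and> q \<le> M. 1 / (real q)\<^sup>2) \<le> 1 / 2"
proof -
  have tele: "(\<Sum>k\<in>{1..n}. 1 / (4 * (real k * (real k + 1)))) \<le> 1 / 4 - 1 / (4 * (real n + 1))" for n
  proof (induction n)
    case (Suc n)
    have "1 / (4 * (real (Suc n) * (real (Suc n) + 1))) = 1 / (4 * (real n + 1)) - 1 / (4 * (real n + 2))"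
      by (simp add: divide_simps) (simp add: algebra_simps)
    moreover have "1 / (4 * (real (Suc n) + 1)) = 1 / (4 * (real n + 2))" by (simp add: add.commute)
    moreover have "(\<Sum>k\<in>{1..Suc n}. 1 / (4 * (real k * (real k + 1)))) =
      (\<Sum>k\<in>{1..n}. 1 / (4 * (real k * (real k + 1)))) + 1 / (4 * (real (Suc n) * (real (Suc n) + 1)))" by simp
    ultimately show ?case using Suc.IH by linarith
  qed simp
  have odd: "\<exists>k\<in>{1..M}. q = 2 * k + 1" if "prime q" "q \<le> M" "q \<noteq> 2" for q
  proof -
    have "odd q" "q \<ge> 2" using that prime_odd_nat[of q] prime_ge_2_nat[of q] by auto
    then obtain k where "q = 2 * k + 1" by (elim oddE)
    thus ?thesis using that \<open>q \<ge> 2\<close> by (intro bexI[of _ k]) auto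
  qed
  have "(\<Sum>q | prime q \<and> q \<le> M. 1 / (real q)\<^sup>2) \<le> (\<Sum>q\<in>insert 2 ((\<lambda>k. 2 * k + 1) ` {1..M}). 1 / (real q)\<^sup>2)"
  proof (rule sum_mono2)
    show "{q. prime q \<and> q \<le> M} \<subseteq> insert 2 ((\<lambda>k. 2 * k + 1) ` {1..M})"
    proof
      fix q assume "q \<in> {q. prime q \<and> q \<le> M}"
      thus "q \<in> insert 2 ((\<lambda>k. 2 * k + 1) ` {1..M})" using odd[of q] by (cases "q = 2") auto
    qed
  qed auto
  also have "\<dots> = 1 / 4 + (\<Sum>k\<in>{1..M}. 1 / (real (2 * k + 1))\<^sup>2)"
  proof -
    have "2 \<notin> (\<lambda>k::nat. 2 * k + 1) ` {1..M}" by auto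
    moreover have "inj_on (\<lambda>k::nat. 2 * k + 1) {1..M}" by (auto simp: inj_on_def)
    ultimately show ?thesis by (simp add: sum.reindex)
  qed
  also have "(\<Sum>k\<in>{1..M}. 1 / (real (2 * k + 1))\<^sup>2) \<le> (\<Sum>k\<in>{1..M}. 1 / (4 * (real k * (real k + 1))))"
    by (intro sum_mono divide_left_mono) (auto simp: power2_eq_square algebra_simps intro!: mult_pos_pos add_pos_nonneg)
  also have "\<dots> \<le> 1 / 4 - 1 / (4 * (real M + 1))" by (rule tele)
  also have "\<dots> \<le> 1 / 4" by simp
  finally show ?thesis by simp
qed

text \<open>
  Remove from all pairs those with a common prime factor \<open>q\<close>. The main term loses at most half by the
  previous lemma; the term with \<open>harm M\<close> comes from rounding the number of multiples of \<open>q\<close> in \<open>{M<..2*M}\<close>.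
\<close>
lemma card_coprime_pairs:
  shows "real M * real M / 2 - real M * harm M \<le> real (card {(a, b) \<in> {M<..2*M} \<times> {1..M}. coprime a b})"
proof -
  define P where "P = {M<..2*M} \<times> {1..M}"
  define Q where "Q = {q. prime q \<and> q \<le> M}"
  have finQ: "finite Q" by (rule finite_subset[of _ "{..M}"]) (auto simp: Q_def)
  have finP: "finite P" and cardP: "card P = M * M" by (simp_all add: P_def card_cartesian_product)
  define B where "B = (\<lambda>q. {a \<in> {M<..2*M}. q dvd a} \<times> {b \<in> {1..M}. q dvd b})"
  have cardB: "real (card (B q)) \<le> real M * real M * (1 / (real q)\<^sup>2) + real M * (1 / real q)" if "q \<in> Q" for q
  proof -
    have q: "q > 0" using that by (auto simp: Q_def prime_gt_0_nat)
    have c1: "card {b \<in> {1..M}. q dvd b} = M div q" by (rule card_multiples[OF q])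
    have "{a \<in> {1..2*M}. q dvd a} = {b \<in> {1..M}. q dvd b} \<union> {a \<in> {M<..2*M}. q dvd a}" by auto
    hence "card {a \<in> {1..2*M}. q dvd a} = card {b \<in> {1..M}. q dvd b} + card {a \<in> {M<..2*M}. q dvd a}"
      by (simp only:) (rule card_Un_disjoint, auto)
    hence c2: "card {a \<in> {M<..2*M}. q dvd a} + M div q = (2 * M) div q"
      using card_multiples[OF q] by simp
    have "real ((2 * M) div q) \<le> real (2 * M) / real q" by (rule of_nat_div_le_of_nat)
    moreover have "real M / real q \<le> real (M div q) + 1"
    proof -
      have "M < (M div q + 1) * q" using q dividend_less_times_div[of q M] by (simp add: algebra_simps)
      hence "real M < real ((M div q + 1) * q)" by (simp only: of_nat_less_iff)
      thus ?thesis using q by (simp add: pos_divide_le_eq algebra_simps)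
    qed
    moreover have "real (card {a \<in> {M<..2*M}. q dvd a}) + real (M div q) = real ((2 * M) div q)"
      using c2 by (simp only: of_nat_add[symmetric])
    ultimately have "real (card {a \<in> {M<..2*M}. q dvd a}) \<le> real M / real q + 1" by simp
    hence "real (card (B q)) \<le> (real M / real q + 1) * (real M / real q)"
      unfolding B_def card_cartesian_product of_nat_mult c1 using of_nat_div_le_of_nat[of M q, where ?'a = real]
      by (intro mult_mono) auto
    thus ?thesis by (simp add: power2_eq_square algebra_simps)
  qed
  have "P \<subseteq> {(a, b) \<in> P. coprime a b} \<union> (\<Union>q\<in>Q. B q)"
  proof
    fix z assume z: "z \<in> P"
    obtain a b where ab: "z = (a, b)" by (cases z)
    show "z \<in> {(a, b) \<in> P. coprime a b} \<union> (\<Union>q\<in>Q. B q)"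
    proof (cases "coprime a b")
      case False
      hence "gcd a b \<noteq> 1" using coprime_iff_gcd_eq_1 by blast
      then obtain q where q: "prime q" "q dvd gcd a b" using prime_factor_nat by blast
      hence "q dvd a" "q dvd b" by (auto intro: dvd_trans)
      moreover have "q \<le> M" using \<open>q dvd b\<close> z ab by (auto simp: P_def dest!: dvd_imp_le)
      ultimately show ?thesis using z ab q by (auto simp: P_def B_def Q_def)
    qed (use z ab in auto)
  qed
  hence "card P \<le> card ({(a, b) \<in> P. coprime a b} \<union> (\<Union>q\<in>Q. B q))"
    using finP finQ by (intro card_mono) (auto simp: B_def intro: finite_subset[of _ P])
  also have "\<dots> \<le> card {(a, b) \<in> P. coprime a b} + card (\<Union>q\<in>Q. B q)" by (rule card_Un_le)
  also have "card (\<Union>q\<in>Q. B q) \<le> (\<Sum>q\<in>Q. card (B q))" using finQ by (rule card_UN_le)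
  finally have "real (card P) \<le> real (card {(a, b) \<in> P. coprime a b} + (\<Sum>q\<in>Q. card (B q)))" by (simp only: of_nat_le_iff)
  also have "\<dots> = real (card {(a, b) \<in> P. coprime a b}) + (\<Sum>q\<in>Q. real (card (B q)))" by simp
  also have "(\<Sum>q\<in>Q. real (card (B q))) \<le> (\<Sum>q\<in>Q. real M * real M * (1 / (real q)\<^sup>2) + real M * (1 / real q))"
    by (intro sum_mono cardB)
  also have "\<dots> = real M * real M * (\<Sum>q\<in>Q. 1 / (real q)\<^sup>2) + real M * (\<Sum>q\<in>Q. 1 / real q)"
    by (simp only: sum.distrib sum_distrib_left)
  also have "(\<Sum>q\<in>Q. 1 / real q) \<le> harm M"
  proof -
    have "(\<Sum>q\<in>Q. 1 / real q) \<le> (\<Sum>q\<in>{1..M}. 1 / real q)"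
      by (intro sum_mono2) (auto simp: Q_def dest: prime_gt_0_nat)
    thus ?thesis by (simp add: harm_def divide_inverse)
  qed
  also have "(\<Sum>q\<in>Q. 1 / (real q)\<^sup>2) \<le> 1 / 2" unfolding Q_def by (rule sum_prime_reciprocal_squares_le)
  finally show ?thesis using cardP unfolding P_def[symmetric] by (simp add: mult_left_mono)
qed

text \<open>
  Coprimality gives a unique \<open>c < a\<close> with \<open>a dvd n + b * c\<close>. The quotient \<open>d\<close> is at most \<open>2 * M\<close> since
  \<open>n \<le> M\<^sup>2 \<le> M * a\<close> and \<open>b * c \<le> M * a\<close>.
\<close>
lemma determinant_completion:
  fixes a b n M :: nat
  assumes "coprime a b" "M < a" "b \<le> M" "1 \<le> n" "n \<le> M * M"
  shows "\<exists>c d. c < a \<and> d \<le> 2 * M \<and> int a * int d - int b * int c = int n"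
proof -
  have a0: "a > 0" using assms by simp
  have "coprime (int b) (int a)" using assms by (simp add: coprime_commute)
  then obtain u where u: "[int b * u = 1] (mod int a)" using cong_solve_coprime_int by blast
  define c where "c = nat ((- int n * u) mod int a)"
  have c: "int c = (- int n * u) mod int a" "c < a" using a0 by (simp_all add: c_def nat_less_iff)
  have "[int b * int c = int b * (- int n * u)] (mod int a)" unfolding c(1) by (intro cong_mult) auto
  also have "int b * (- int n * u) = - int n * (int b * u)" by simp
  also have "[- int n * (int b * u) = - int n * 1] (mod int a)" using u by (intro cong_mult) auto
  finally have "int a dvd int n + int b * int c" by (simp add: cong_iff_dvd_diff add.commute)
  hence "int a dvd int (n + b * c)" by simp
  hence "a dvd n + b * c" by (simp only: int_dvd_int_iff)
  then obtain d where d: "n + b * c = a * d" by (elim dvdE)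
  have "a * d \<le> M * M + M * a" unfolding d[symmetric]
    using assms c(2) by (intro add_mono mult_le_mono) auto
  also have "\<dots> \<le> a * M + a * M" using assms by (intro add_mono) auto
  also have "\<dots> = a * (2 * M)" by simp
  finally have "d \<le> 2 * M" using a0 by simp
  moreover have "int a * int d - int b * int c = int n" using arg_cong[OF d, of int] by simp
  ultimately show ?thesis using c(2) by blast
qed

text \<open>
  Different triples \<open>(a, b, n)\<close> give different matrices, because \<open>n\<close> is the determinant. As \<open>N < p\<close>, the entries are
  their own residues.
\<close>
lemma card_nonsquare_GL2_ge:
  assumes p: "prime p" and N: "N < p" "2 * M \<le> N"
  shows "card {(a, b) \<in> {M<..2*M} \<times> {1..M}. coprime a b} * card {n \<in> {1..M*M}. Legendre (int n) (int p) = -1}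
    \<le> card (box_mat2 N p \<inter> nonsquare_GL2 p)"
proof -
  define P where "P = {(a, b) \<in> {M<..2*M} \<times> {1..M}. coprime a b}"
  define S where "S = {n \<in> {1..M*M}. Legendre (int n) (int p) = -1}"
  define g where "g = (\<lambda>((a, b), n). SOME cd. fst cd < a \<and> snd cd \<le> 2 * M \<and> int a * int (snd cd) - int b * int (fst cd) = int n)"
  define \<Phi> where "\<Phi> = (\<lambda>((a, b), n). mat2 (int a) (int b) (int (fst (g ((a, b), n)))) (int (snd (g ((a, b), n)))))"
  have g: "fst (g ((a, b), n)) < a \<and> snd (g ((a, b), n)) \<le> 2 * M \<and> int a * int (snd (g ((a, b), n))) - int b * int (fst (g ((a, b), n))) = int n"
    if "(a, b) \<in> P" "n \<in> S" for a b n
  proof -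
    have "\<exists>c d. c < a \<and> d \<le> 2 * M \<and> int a * int d - int b * int c = int n"
      using that by (intro determinant_completion) (auto simp: P_def S_def)
    hence "\<exists>cd. fst cd < a \<and> snd cd \<le> 2 * M \<and> int a * int (snd cd) - int b * int (fst cd) = int n" by auto
    from someI_ex[OF this] show ?thesis by (simp add: g_def)
  qed
  have "card (P \<times> S) \<le> card (box_mat2 N p \<inter> nonsquare_GL2 p)"
  proof (rule card_inj_on_le)
    show "inj_on \<Phi> (P \<times> S)"
    proof (rule inj_onI)
      fix x y assume xy: "x \<in> P \<times> S" "y \<in> P \<times> S" "\<Phi> x = \<Phi> y"
      obtain a b n where x: "x = ((a, b), n)" by (cases x) auto
      obtain a' b' n' where y: "y = ((a', b'), n')" by (cases y) auto
      have e: "\<Phi> x $ i $ j = \<Phi> y $ i $ j" for i j using xy(3) by simp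
      have "a = a'" "b = b'" "fst (g x) = fst (g y)" "snd (g x) = snd (g y)"
        using e[of 1 1] e[of 1 2] e[of 2 1] e[of 2 2] by (simp_all add: \<Phi>_def x y)
      moreover have "int a * int (snd (g x)) - int b * int (fst (g x)) = int n"
        "int a' * int (snd (g y)) - int b' * int (fst (g y)) = int n'"
        using g[of a b n] g[of a' b' n'] xy(1,2) by (auto simp: x y)
      ultimately show "x = y" by (simp add: x y)
    qed
    show "\<Phi> ` (P \<times> S) \<subseteq> box_mat2 N p \<inter> nonsquare_GL2 p"
    proof (rule image_subsetI)
      fix x assume x: "x \<in> P \<times> S"
      obtain a b n where abn: "x = ((a, b), n)" by (cases x) auto
      define c where "c = fst (g x)"
      define d where "d = snd (g x)"
      have ab: "(a, b) \<in> P" "n \<in> S" using x abn by auto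
      have cd: "c < a" "d \<le> 2 * M" "int a * int d - int b * int c = int n"
        using g[OF ab] by (simp_all add: c_def d_def abn)
      have le: "a \<le> N" "b \<le> N" "c \<le> N" "d \<le> N" using ab cd N by (auto simp: P_def)
      have Phi: "\<Phi> x = mat2 (int a) (int b) (int c) (int d)" by (simp add: \<Phi>_def abn c_def d_def)
      have "\<Phi> x = (\<chi> i j. (\<Phi> x $ i $ j) mod int p)"
        unfolding Phi by (rule mat2_eqI) (use le N in simp_all)
      moreover have "\<forall>i j. 0 \<le> \<Phi> x $ i $ j \<and> \<Phi> x $ i $ j \<le> int N"
        unfolding Phi using le by (simp add: forall_2)
      ultimately have "\<Phi> x \<in> box_mat2 N p" unfolding box_mat2_def by blast
      moreover have "\<Phi> x \<in> nonsquare_GL2 p"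
        unfolding Phi
        by (rule mat2_in_nonsquare_GL2[OF p]) (use le N cd ab in \<open>auto simp: S_def\<close>)
      ultimately show "\<Phi> x \<in> box_mat2 N p \<inter> nonsquare_GL2 p" by blast
    qed
    have "box_mat2 N p \<subseteq> (\<lambda>(a, b, c, d). mat2 a b c d) ` ({0..<int p} \<times> {0..<int p} \<times> {0..<int p} \<times> {0..<int p})"
    proof
      fix A assume "A \<in> box_mat2 N p"
      hence r: "A $ i $ j \<in> {0..<int p}" for i j using N(1) by (auto simp: box_mat2_def)
      have "A = (\<lambda>(a, b, c, d). mat2 a b c d) (A $ 1 $ 1, A $ 1 $ 2, A $ 2 $ 1, A $ 2 $ 2)"
        by (simp, rule mat2_eqI) simp_all
      thus "A \<in> (\<lambda>(a, b, c, d). mat2 a b c d) ` ({0..<int p} \<times> {0..<int p} \<times> {0..<int p} \<times> {0..<int p})"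
        using r by (intro image_eqI[of _ _ "(A $ 1 $ 1, A $ 1 $ 2, A $ 2 $ 1, A $ 2 $ 2)"]) auto
    qed
    hence "finite (box_mat2 N p)" by (rule finite_subset) auto
    thus "finite (box_mat2 N p \<inter> nonsquare_GL2 p)" by simp
  qed
  thus ?thesis by (simp add: card_cartesian_product P_def S_def)
qed

text \<open>
  Passing from \<open>N\<close> to \<open>M\<^sup>2\<close>, which is at least \<open>N\<^sup>2 / 9\<close>, doubles the exponent of \<open>p\<close> and loses the factor \<open>9\<close>, which
  one of the two factors \<open>p powr \<epsilon>\<close> absorbs. In the constant, \<open>324 = 4 * 81\<close>: a quarter of the pairs \<open>(a, b)\<close> is
  coprime, and \<open>N ^ 4 \<le> 81 * M ^ 4\<close>.
\<close>
theorem theorem1p3: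
  fixes \<epsilon> :: real
  assumes "\<epsilon> > 0"
  shows "\<exists>(C::real) (p0::nat). C > 0 \<and>
    (\<forall>(p::nat) (N::nat). prime p \<longrightarrow> p \<ge> p0 \<longrightarrow>
       real p powr (1 / (8 * sqrt (exp 1)) + \<epsilon>) \<le> real N \<longrightarrow> N < p \<longrightarrow>
       real (card (box_mat2 N p \<inter> nonsquare_GL2 p)) \<ge> C * real N ^ 4)"
proof -
  obtain c p1 where c: "c > 0" and nonres: "\<And>p X. prime p \<Longrightarrow> p \<ge> p1 \<Longrightarrow>
    real p powr (1 / (4 * sqrt (exp 1)) + \<epsilon>) \<le> real X \<Longrightarrow>
    c * real X \<le> real (card {n \<in> {1..X}. Legendre (int n) (int p) = -1})"
    using positive_proportion_of_nonresidues[OF assms] by blast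
  have "eventually (\<lambda>x::real. 1 + ln x \<le> x / 4) at_top" by real_asymp
  then obtain m0 where m0: "\<And>x. x \<ge> m0 \<Longrightarrow> 1 + ln x \<le> x / (4::real)"
    unfolding eventually_at_top_linorder by blast
  have "eventually (\<lambda>x::real. 9 + 3 * \<bar>m0\<bar> \<le> x powr \<epsilon>) at_top" using assms by real_asymp
  then obtain x0 where x0: "\<And>x. x \<ge> x0 \<Longrightarrow> 9 + 3 * \<bar>m0\<bar> \<le> x powr \<epsilon>"
    unfolding eventually_at_top_linorder by blast
  show ?thesis
  proof (rule exI[of _ "c / 324"], rule exI[of _ "p1 + nat \<lceil>x0\<rceil> + 1"], intro conjI allI impI)
    show "c / 324 > 0" using c by simp
    fix p N :: nat
    assume p: "prime p" "p1 + nat \<lceil>x0\<rceil> + 1 \<le> p" and N: "real p powr (1 / (8 * sqrt (exp 1)) + \<epsilon>) \<le> real N" "N < p"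
    have pp: "p \<ge> 1" "p \<ge> p1" "real p \<ge> x0" using p(2) by linarith+
    have big: "9 + 3 * \<bar>m0\<bar> \<le> real p powr \<epsilon>" by (rule x0[OF pp(3)])
    have "real p powr \<epsilon> \<le> real p powr (1 / (8 * sqrt (exp 1)) + \<epsilon>)" using pp by (intro powr_mono) auto
    hence Nbig: "9 + 3 * \<bar>m0\<bar> \<le> real N" using big N(1) by linarith
    define M where "M = N div 2"
    have M: "2 * M \<le> N" "N \<le> 2 * M + 1" by (auto simp: M_def)
    have M3: "real N / 3 \<le> real M" using M(2) Nbig by linarith
    have M1: "M \<ge> 1" "real M \<ge> m0" using M3 Nbig by linarith+
    have harm: "harm M \<le> real M / 4"
    proof -
      have "harm M \<le> ln (real M) + 1"
        using M1 euler_mascheroni_sequence_decreasing[of 1 M] by (simp add: harm_expand)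
      thus ?thesis using m0[OF M1(2)] by linarith
    qed
    have "real M * harm M \<le> real M * (real M / 4)" using harm by (intro mult_left_mono) auto
    hence cop: "real M * real M / 4 \<le> real (card {(a, b) \<in> {M<..2*M} \<times> {1..M}. coprime a b})"
      using card_coprime_pairs[of M] by simp
    have "real p powr (1 / (4 * sqrt (exp 1)) + \<epsilon>) * 9 \<le> real p powr (1 / (4 * sqrt (exp 1)) + \<epsilon>) * real p powr \<epsilon>"
      using big by (intro mult_left_mono) auto
    also have "\<dots> = real p powr (1 / (8 * sqrt (exp 1)) + \<epsilon>) * real p powr (1 / (8 * sqrt (exp 1)) + \<epsilon>)"
      by (simp add: powr_add[symmetric] add.commute)
    also have "\<dots> \<le> real N * real N" using N by (intro mult_mono) auto
    also have "\<dots> \<le> (3 * real M) * (3 * real M)" using M3 by (intro mult_mono) auto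
    finally have "real p powr (1 / (4 * sqrt (exp 1)) + \<epsilon>) \<le> real (M * M)" by simp
    hence res: "c * real (M * M) \<le> real (card {n \<in> {1..M*M}. Legendre (int n) (int p) = -1})"
      by (rule nonres[OF p(1) pp(2)])
    have "(c / 324) * real N ^ 4 \<le> (c / 324) * (3 * real M) ^ 4"
      using M3 c by (intro mult_left_mono power_mono) auto
    also have "\<dots> = (real M * real M / 4) * (c * real (M * M))" by (simp add: power4_eq_xxxx)
    also have "\<dots> \<le> real (card {(a, b) \<in> {M<..2*M} \<times> {1..M}. coprime a b})
        * real (card {n \<in> {1..M*M}. Legendre (int n) (int p) = -1})"
      using cop res c by (intro mult_mono) auto
    also have "\<dots> \<le> real (card (box_mat2 N p \<inter> nonsquare_GL2 p))"
      using card_nonsquare_GL2_ge[OF p(1) N(2) M(1)] by (simp only: of_nat_mult[symmetric] of_nat_le_iff)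
    finally show "c / 324 * real N ^ 4 \<le> real (card (box_mat2 N p \<inter> nonsquare_GL2 p))" .
  qed
qed

end
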